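(* For every $m\ge 0$ there is an isomorphism \[ J(X_m)\cong M_\Lambda\big/\big((\omega_m(T_1),\dots,\omega_m(T_l))\mathrm{Div}_\Lambda+\mathrm{Pr}_\Lambda\big). \]
   Context: Fix a prime $p$, $l\ge1$, and a finite connected multigraph $X$ with vertices $v_1,\dots,v_n$; directed edges come in pairs $e,e^{-1}$ and $S$ contains one orientation of each edge. $\Gamma\cong\mathbb{Z}_p^l$ (multiplicative), $\alpha\colon S\to\Gamma$ a voltage assignment (extended by $\alpha(e^{-1})=\alpha(e)^{-1}$), $\alpha_m$ its reduction mod $\Gamma^{p^m}$. The derived graph $X_m$ has vertex set $V(X)\times\Gamma/\Gamma^{p^m}$ with one edge joining $(v,g)$ and $(v',g\alpha_m(e))$ for each $e\in S$ from $v$ to $v'$; $X_\infty$ is the analogous graph on $V(X)\times\Gamma$. All $X_m$ are assumed connected. For a locally finite graph $Y$: $\mathrm{Div}(Y)$ = finitely supported $\mathbb{Z}_p$-combinations of vertices, $\mathrm{Div}^0(Y)$ those of coefficient sum $0$, $\mathrm{Pr}(Y)$ the $\mathbb{Z}_p$-span of $p_v=(\deg(v)-2\ell(v))v-\sum_{w\ne v}\mathrm{mult}(v,w)w$ ($\deg$ counts loops twice, $\ell(v)$ = loops at $v$, $\mathrm{mult}$ = number of joining edges), $J(Y)=\mathrm{Div}^0(Y)/\mathrm{Pr}(Y)$. $\Gamma$ acts on $X_\infty$ and $X_m$ by multiplication in the second coordinate. Let $R=\mathbb{Z}_p[\Gamma]$, $\Lambda=\mathbb{Z}_p[[\Gamma]]\cong\mathbb{Z}_p[[T_1,\dots,T_l]]$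 via $\gamma_i\mapsto1+T_i$ for topological generators $\gamma_i$, and $\omega_m(T_i)=(1+T_i)^{p^m}-1$. Let $v_{i,0}=(v_i,1)$; $\mathrm{Div}_\Lambda=\mathrm{Div}(X_\infty)\otimes_R\Lambda$ is $\Lambda$-free on $v_{1,0},\dots,v_{n,0}$. Let $A_\alpha=(\alpha_{ij})$ with $\alpha_{ij}=\sum\alpha(e)$ over directed edges $e$ from $v_i$ to $v_j$ ($i\ne j$), $\alpha_{ii}=\sum(\alpha(e)+\alpha(e)^{-1})$ over the loops at $v_i$; $D$ = diagonal degree matrix; $\Delta_\infty=D-A_\alpha$; $p_{i,0}=\sum_j(\Delta_\infty)_{ij}v_{j,0}$. $\mathrm{Pr}_\Lambda$ is the $\Lambda$-submodule of $\mathrm{Div}_\Lambda$ generated by $p_{1,0},\dots,p_{n,0}$, and $M_\Lambda$ the $\Lambda$-submodule generated by the $p_{i,0}$, the elements $v_{i,0}-v_{j,0}$ ($1\le j<i\le n$) and $(T_1,\dots,T_l)\mathrm{Div}_\Lambda$. *)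

theory Defs
  imports
    "Graph_Theory.Digraph_Component"
    "HOL-Number_Theory.Residues"
    "HOL-Algebra.Product_Groups"
    "HOL-Algebra.Generated_Groups"
    "HOL-Algebra.Ideal"
    "HOL-Algebra.Module"
begin

hide_const (open) Topological_Spaces.connected Multiset.mult

section \<open>Modules\<close>

text \<open>The ring-multiplicative fields of a module record are irrelevant and left unspecified.\<close>

definition free_module :: "('a, 'r) ring_scheme \<Rightarrow> 'b set \<Rightarrow> ('a, 'b \<Rightarrow> 'a) module" where
  "free_module K B =
    \<lparr>carrier = {f. (\<forall>b\<in>B. f b \<in> carrier K) \<and> (\<forall>b. b \<notin> B \<longrightarrow> f b = \<zero>\<^bsub>K\<^esub>)
                  \<and> finite {b. f b \<noteq> \<zero>\<^bsub>K\<^esub>}},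
     mult = undefined, one = undefined,
     zero = (\<lambda>_. \<zero>\<^bsub>K\<^esub>),
     add = (\<lambda>f g b. f b \<oplus>\<^bsub>K\<^esub> g b),
     smult = (\<lambda>a f b. a \<otimes>\<^bsub>K\<^esub> f b)\<rparr>"

definition single :: "('a, 'r) ring_scheme \<Rightarrow> 'b \<Rightarrow> ('b \<Rightarrow> 'a)" where
  "single K b = (\<lambda>x. if x = b then \<one>\<^bsub>K\<^esub> else \<zero>\<^bsub>K\<^esub>)"

definition mod_span :: "('a, 'r) ring_scheme \<Rightarrow> ('a, 'b) module \<Rightarrow> 'b set \<Rightarrow> 'b set" where
  "mod_span K M A = (\<lambda>N. submodule N K M) hull A"

definition ideal_smult :: "('a, 'r) ring_scheme \<Rightarrow> 'a set \<Rightarrow> ('a, 'b) module \<Rightarrow> 'b set" where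
  "ideal_smult K I M = mod_span K M {a \<odot>\<^bsub>M\<^esub> x | a x. a \<in> I \<and> x \<in> carrier M}"

definition quotient_module :: "('a, 'b) module \<Rightarrow> 'b set \<Rightarrow> ('a, 'b set) module" where
  "quotient_module M N =
    \<lparr>carrier = a_rcosets\<^bsub>M\<^esub> N, mult = undefined, one = undefined,
     zero = N,
     add = (\<lambda>C D. C <+>\<^bsub>M\<^esub> D),
     smult = (\<lambda>a C. \<Union>x\<in>C. N +>\<^bsub>M\<^esub> (a \<odot>\<^bsub>M\<^esub> x))\<rparr>"

definition module_iso ::
    "('a, 'r) ring_scheme \<Rightarrow> ('a, 'b) module \<Rightarrow> ('a, 'c) module \<Rightarrow> ('b \<Rightarrow> 'c) set" where
  "module_iso K M N = {h \<in> iso (add_monoid M) (add_monoid N).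
     \<forall>a\<in>carrier K. \<forall>x\<in>carrier M. h (a \<odot>\<^bsub>M\<^esub> x) = a \<odot>\<^bsub>N\<^esub> h x}"

definition with_action :: "('a, 'b) module \<Rightarrow> ('c \<Rightarrow> 'b \<Rightarrow> 'b) \<Rightarrow> ('c, 'b) module" where
  "with_action M act =
    \<lparr>carrier = carrier M, mult = mult M, one = one M, zero = zero M, add = add M, smult = act\<rparr>"

text \<open>Extension of scalars \<open>M \<otimes>\<^sub>R L\<close> of an \<open>R\<close>-module \<open>M\<close> along \<open>f : R \<rightarrow> L\<close>, presented as the
  \<open>L\<close>-module generated by the symbols \<open>x \<otimes> 1\<close> (\<open>x \<in> M\<close>) subject to
  \<open>(x + y) \<otimes> 1 = x \<otimes> 1 + y \<otimes> 1\<close> and \<open>rx \<otimes> 1 = f(r) (x \<otimes> 1)\<close>.\<close>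

definition base_change_rels ::
    "('r, 's) ring_scheme \<Rightarrow> ('c, 't) ring_scheme \<Rightarrow> ('r \<Rightarrow> 'c) \<Rightarrow> ('r, 'b) module \<Rightarrow> ('b \<Rightarrow> 'c) set" where
  "base_change_rels R L f M =
    (let F = free_module L (carrier M) in
     mod_span L F
      ({single L (x \<oplus>\<^bsub>M\<^esub> y) \<ominus>\<^bsub>F\<^esub> (single L x \<oplus>\<^bsub>F\<^esub> single L y) | x y.
          x \<in> carrier M \<and> y \<in> carrier M}
       \<union> {single L (r \<odot>\<^bsub>M\<^esub> x) \<ominus>\<^bsub>F\<^esub> f r \<odot>\<^bsub>F\<^esub> single L x | r x.
          r \<in> carrier R \<and> x \<in> carrier M}))"

definition base_change ::
    "('r, 's) ring_scheme \<Rightarrow> ('c, 't) ring_scheme \<Rightarrow> ('r \<Rightarrow> 'c) \<Rightarrow> ('r, 'b) module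
      \<Rightarrow> ('c, ('b \<Rightarrow> 'c) set) module" where
  "base_change R L f M =
     quotient_module (free_module L (carrier M)) (base_change_rels R L f M)"

definition tensor_one ::
    "('r, 's) ring_scheme \<Rightarrow> ('c, 't) ring_scheme \<Rightarrow> ('r \<Rightarrow> 'c) \<Rightarrow> ('r, 'b) module
      \<Rightarrow> 'b \<Rightarrow> ('b \<Rightarrow> 'c) set" where
  "tensor_one R L f M x =
     base_change_rels R L f M +>\<^bsub>free_module L (carrier M)\<^esub> single L x"

section \<open>Rings\<close>

definition inverse_limit :: "(nat \<Rightarrow> 'a ring) \<Rightarrow> (nat \<Rightarrow> 'a \<Rightarrow> 'a) \<Rightarrow> (nat \<Rightarrow> 'a) ring" where
  "inverse_limit R \<pi> =
    \<lparr>carrier = {x. (\<forall>k. x k \<in> carrier (R k)) \<and> (\<forall>k. \<pi> k (x (Suc k)) = x k)},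
     mult = (\<lambda>x y k. x k \<otimes>\<^bsub>R k\<^esub> y k), one = (\<lambda>k. \<one>\<^bsub>R k\<^esub>),
     zero = (\<lambda>k. \<zero>\<^bsub>R k\<^esub>), add = (\<lambda>x y k. x k \<oplus>\<^bsub>R k\<^esub> y k)\<rparr>"

text \<open>Component \<open>k\<close> is the residue mod \<open>p\<^sup>k\<^sup>+\<^sup>1\<close>, since
  \<^const>\<open>residue_ring\<close> is not a ring for modulus \<open>1\<close>.\<close>

definition Zp :: "nat \<Rightarrow> (nat \<Rightarrow> int) ring" where
  "Zp p = inverse_limit (\<lambda>k. residue_ring (int p ^ Suc k)) (\<lambda>k x. x mod int p ^ Suc k)"

definition group_ring :: "('a, 'r) ring_scheme \<Rightarrow> ('g, 'm) monoid_scheme \<Rightarrow> ('g \<Rightarrow> 'a) ring" where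
  "group_ring K G =
    \<lparr>carrier = carrier (free_module K (carrier G)),
     mult = (\<lambda>f f' x. if x \<in> carrier G
        then \<Oplus>\<^bsub>K\<^esub>y\<in>{y \<in> carrier G. f y \<noteq> \<zero>\<^bsub>K\<^esub>}. f y \<otimes>\<^bsub>K\<^esub> f' (inv\<^bsub>G\<^esub> y \<otimes>\<^bsub>G\<^esub> x)
        else \<zero>\<^bsub>K\<^esub>),
     one = single K \<one>\<^bsub>G\<^esub>,
     zero = (\<lambda>_. \<zero>\<^bsub>K\<^esub>),
     add = (\<lambda>f f' x. f x \<oplus>\<^bsub>K\<^esub> f' x)\<rparr>"

definition group_ring_map ::
    "('a, 'r) ring_scheme \<Rightarrow> ('g, 'm) monoid_scheme \<Rightarrow> ('h, 'n) monoid_scheme \<Rightarrow> ('g \<Rightarrow> 'h)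
      \<Rightarrow> ('g \<Rightarrow> 'a) \<Rightarrow> ('h \<Rightarrow> 'a)" where
  "group_ring_map K G H \<phi> f = (\<lambda>h. if h \<in> carrier H
     then \<Oplus>\<^bsub>K\<^esub>x\<in>{x \<in> carrier G. f x \<noteq> \<zero>\<^bsub>K\<^esub> \<and> \<phi> x = h}. f x
     else \<zero>\<^bsub>K\<^esub>)"

section \<open>The group \<open>\<Gamma>\<close> and its Iwasawa algebra\<close>

definition powers :: "('g, 'm) monoid_scheme \<Rightarrow> nat \<Rightarrow> 'g set" where
  "powers G k = (\<lambda>x. x [^]\<^bsub>G\<^esub> k) ` carrier G"

definition layer :: "nat \<Rightarrow> ('g, 'm) monoid_scheme \<Rightarrow> nat \<Rightarrow> 'g set monoid" where
  "layer p \<Gamma> m = \<Gamma> Mod powers \<Gamma> (p ^ m)"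

text \<open>For \<open>\<Gamma> \<cong> \<int>\<^sub>p\<^sup>l\<close> the subgroups \<open>\<Gamma>\<^bsup>p^m\<^esup>\<close> are a neighbourhood basis of the identity, so the
  condition below says that the \<open>\<gamma> i\<close> generate a dense subgroup.\<close>

definition topological_generators ::
    "nat \<Rightarrow> ('g, 'm) monoid_scheme \<Rightarrow> nat \<Rightarrow> (nat \<Rightarrow> 'g) \<Rightarrow> bool" where
  "topological_generators p \<Gamma> l \<gamma> \<longleftrightarrow>
     (\<forall>i\<in>{1..l}. \<gamma> i \<in> carrier \<Gamma>) \<and>
     (\<forall>m. \<forall>x\<in>carrier \<Gamma>. \<exists>h\<in>generate \<Gamma> (\<gamma> ` {1..l}). x \<in> powers \<Gamma> (p ^ m) #>\<^bsub>\<Gamma>\<^esub> h)"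

text \<open>\<open>\<int>\<^sub>p[[\<Gamma>]] = lim \<int>\<^sub>p[\<Gamma>/\<Gamma>\<^bsup>p^m\<^esup>]\<close>; the transition maps send the coset \<open>D\<close> of
  \<open>\<Gamma>\<^bsup>p^(m+1)\<^esup>\<close> to the coset \<open>\<Gamma>\<^bsup>p^m\<^esup> D\<close>.\<close>

definition Iwasawa :: "nat \<Rightarrow> ('g, 'm) monoid_scheme \<Rightarrow> (nat \<Rightarrow> 'g set \<Rightarrow> nat \<Rightarrow> int) ring" where
  "Iwasawa p \<Gamma> = inverse_limit
     (\<lambda>m. group_ring (Zp p) (layer p \<Gamma> m))
     (\<lambda>m. group_ring_map (Zp p) (layer p \<Gamma> (Suc m)) (layer p \<Gamma> m)
            (\<lambda>D. powers \<Gamma> (p ^ m) <#>\<^bsub>\<Gamma>\<^esub> D))"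

definition to_Iwasawa ::
    "nat \<Rightarrow> ('g, 'm) monoid_scheme \<Rightarrow> ('g \<Rightarrow> nat \<Rightarrow> int) \<Rightarrow> (nat \<Rightarrow> 'g set \<Rightarrow> nat \<Rightarrow> int)" where
  "to_Iwasawa p \<Gamma> r = (\<lambda>m. group_ring_map (Zp p) \<Gamma> (layer p \<Gamma> m)
     (\<lambda>x. powers \<Gamma> (p ^ m) #>\<^bsub>\<Gamma>\<^esub> x) r)"

text \<open>The identification of \<open>\<Lambda>\<close> with \<open>\<int>\<^sub>p[[T\<^sub>1,\<dots>,T\<^sub>l]]\<close> is by \<open>\<gamma>\<^sub>i = 1 + T\<^sub>i\<close>.\<close>

definition Tvar ::
    "nat \<Rightarrow> ('g, 'm) monoid_scheme \<Rightarrow> (nat \<Rightarrow> 'g) \<Rightarrow> nat \<Rightarrow> (nat \<Rightarrow> 'g set \<Rightarrow> nat \<Rightarrow> int)" where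
  "Tvar p \<Gamma> \<gamma> i =
     to_Iwasawa p \<Gamma> (single (Zp p) (\<gamma> i)) \<ominus>\<^bsub>Iwasawa p \<Gamma>\<^esub> \<one>\<^bsub>Iwasawa p \<Gamma>\<^esub>"

definition omega ::
    "nat \<Rightarrow> ('g, 'm) monoid_scheme \<Rightarrow> nat \<Rightarrow> (nat \<Rightarrow> 'g set \<Rightarrow> nat \<Rightarrow> int)
      \<Rightarrow> (nat \<Rightarrow> 'g set \<Rightarrow> nat \<Rightarrow> int)" where
  "omega p \<Gamma> m T =
     (\<one>\<^bsub>Iwasawa p \<Gamma>\<^esub> \<oplus>\<^bsub>Iwasawa p \<Gamma>\<^esub> T) [^]\<^bsub>Iwasawa p \<Gamma>\<^esub> (p ^ m) \<ominus>\<^bsub>Iwasawa p \<Gamma>\<^esub> \<one>\<^bsub>Iwasawa p \<Gamma>\<^esub>"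

section \<open>Graphs, divisors and Jacobians\<close>

text \<open>A multigraph is given by a \<^typ>\<open>('v, 'e) pre_digraph\<close> whose arcs are the set \<open>S\<close> of edges
  with their chosen orientation. The pair \<open>(e, True)\<close> is the directed edge \<open>e\<close>, and
  \<open>(e, False)\<close> is its inverse. Degree, loops, multiplicity and connectedness do not depend on
  the orientation.\<close>

definition directed_edges :: "('v, 'e) pre_digraph \<Rightarrow> ('e \<times> bool) set" where
  "directed_edges Y = arcs Y \<times> UNIV"

fun dsource :: "('v, 'e) pre_digraph \<Rightarrow> 'e \<times> bool \<Rightarrow> 'v" where
  "dsource Y (e, b) = (if b then tail Y e else head Y e)"

fun dtarget :: "('v, 'e) pre_digraph \<Rightarrow> 'e \<times> bool \<Rightarrow> 'v" where
  "dtarget Y (e, b) = (if b then head Y e else tail Y e)"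

fun dvoltage :: "('g, 'm) monoid_scheme \<Rightarrow> ('e \<Rightarrow> 'g) \<Rightarrow> 'e \<times> bool \<Rightarrow> 'g" where
  "dvoltage \<Gamma> \<alpha> (e, b) = (if b then \<alpha> e else inv\<^bsub>\<Gamma>\<^esub> (\<alpha> e))"

definition loops_at :: "('v, 'e) pre_digraph \<Rightarrow> 'v \<Rightarrow> 'e set" where
  "loops_at Y v = {e \<in> arcs Y. tail Y e = v \<and> head Y e = v}"

definition mdegree :: "('v, 'e) pre_digraph \<Rightarrow> 'v \<Rightarrow> nat" where
  "mdegree Y v = in_degree Y v + out_degree Y v"

definition edge_mult :: "('v, 'e) pre_digraph \<Rightarrow> 'v \<Rightarrow> 'v \<Rightarrow> nat" where
  "edge_mult Y v w =
     card {e \<in> arcs Y. tail Y e = v \<and> head Y e = w \<or> tail Y e = w \<and> head Y e = v}"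

definition derived_graph ::
    "('v, 'e) pre_digraph \<Rightarrow> ('h, 'm) monoid_scheme \<Rightarrow> ('e \<Rightarrow> 'h) \<Rightarrow> ('v \<times> 'h, 'e \<times> 'h) pre_digraph" where
  "derived_graph X G \<beta> =
    \<lparr>verts = verts X \<times> carrier G, arcs = arcs X \<times> carrier G,
     tail = (\<lambda>(e, g). (tail X e, g)),
     head = (\<lambda>(e, g). (head X e, g \<otimes>\<^bsub>G\<^esub> \<beta> e))\<rparr>"

definition X_layer ::
    "nat \<Rightarrow> ('g, 'm) monoid_scheme \<Rightarrow> ('v, 'e) pre_digraph \<Rightarrow> ('e \<Rightarrow> 'g) \<Rightarrow> nat
      \<Rightarrow> ('v \<times> 'g set, 'e \<times> 'g set) pre_digraph" where
  "X_layer p \<Gamma> X \<alpha> m =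
     derived_graph X (layer p \<Gamma> m) (\<lambda>e. powers \<Gamma> (p ^ m) #>\<^bsub>\<Gamma>\<^esub> \<alpha> e)"

definition Div :: "('a, 'r) ring_scheme \<Rightarrow> ('v, 'e) pre_digraph \<Rightarrow> ('a, 'v \<Rightarrow> 'a) module" where
  "Div K Y = free_module K (verts Y)"

definition Div0 :: "('a, 'r) ring_scheme \<Rightarrow> ('v, 'e) pre_digraph \<Rightarrow> ('v \<Rightarrow> 'a) set" where
  "Div0 K Y = {d \<in> carrier (Div K Y). (\<Oplus>\<^bsub>K\<^esub>v\<in>{v \<in> verts Y. d v \<noteq> \<zero>\<^bsub>K\<^esub>}. d v) = \<zero>\<^bsub>K\<^esub>}"

definition principal :: "('a, 'r) ring_scheme \<Rightarrow> ('v, 'e) pre_digraph \<Rightarrow> 'v \<Rightarrow> ('v \<Rightarrow> 'a)" where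
  "principal K Y v = (\<lambda>w.
     if w = v then add_pow K (int (mdegree Y v) - 2 * int (card (loops_at Y v))) \<one>\<^bsub>K\<^esub>
     else add_pow K (- int (edge_mult Y v w)) \<one>\<^bsub>K\<^esub>)"

definition Pr :: "('a, 'r) ring_scheme \<Rightarrow> ('v, 'e) pre_digraph \<Rightarrow> ('v \<Rightarrow> 'a) set" where
  "Pr K Y = mod_span K (Div K Y) (principal K Y ` verts Y)"

text \<open>The action of the group ring of \<open>G\<close> on divisors of a derived graph with group \<open>G\<close>,
  extending \<open>h \<cdot> (v, g) = (v, h g)\<close>.\<close>

definition divisor_action ::
    "('a, 'r) ring_scheme \<Rightarrow> ('h, 'm) monoid_scheme \<Rightarrow> ('h \<Rightarrow> 'a) \<Rightarrow> ('v \<times> 'h \<Rightarrow> 'a) \<Rightarrow> ('v \<times> 'h \<Rightarrow> 'a)" where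
  "divisor_action K G r d = (\<lambda>(v, g). if g \<in> carrier G
     then \<Oplus>\<^bsub>K\<^esub>h\<in>{h \<in> carrier G. r h \<noteq> \<zero>\<^bsub>K\<^esub>}. r h \<otimes>\<^bsub>K\<^esub> d (v, inv\<^bsub>G\<^esub> h \<otimes>\<^bsub>G\<^esub> g)
     else \<zero>\<^bsub>K\<^esub>)"

text \<open>\<open>J(X\<^sub>m) = Div\<^sup>0(X\<^sub>m) / Pr(X\<^sub>m)\<close>, where \<open>Pr\<close> is the \<open>\<int>\<^sub>p\<close>-span; the scalars are extended from
  \<open>\<int>\<^sub>p\<close> to \<open>\<Lambda>\<close>, acting through \<open>\<Lambda> \<rightarrow> \<int>\<^sub>p[\<Gamma>/\<Gamma>\<^bsup>p^m\<^esup>]\<close>.\<close>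

definition Jac_layer ::
    "nat \<Rightarrow> ('g, 'm) monoid_scheme \<Rightarrow> ('v, 'e) pre_digraph \<Rightarrow> ('e \<Rightarrow> 'g) \<Rightarrow> nat
      \<Rightarrow> (nat \<Rightarrow> 'g set \<Rightarrow> nat \<Rightarrow> int, ('v \<times> 'g set \<Rightarrow> nat \<Rightarrow> int) set) module" where
  "Jac_layer p \<Gamma> X \<alpha> m =
    (let K = Zp p; Y = X_layer p \<Gamma> X \<alpha> m in
     quotient_module
       ((with_action (Div K Y) (\<lambda>z. divisor_action K (layer p \<Gamma> m) (z m)))\<lparr>carrier := Div0 K Y\<rparr>)
       (Pr K Y))"

section \<open>The modules over \<open>\<Lambda>\<close>\<close>

definition Div_infty ::
    "nat \<Rightarrow> ('g, 'm) monoid_scheme \<Rightarrow> ('v, 'e) pre_digraph \<Rightarrow> ('e \<Rightarrow> 'g)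
      \<Rightarrow> ('g \<Rightarrow> nat \<Rightarrow> int, 'v \<times> 'g \<Rightarrow> nat \<Rightarrow> int) module" where
  "Div_infty p \<Gamma> X \<alpha> =
     with_action (Div (Zp p) (derived_graph X \<Gamma> \<alpha>)) (divisor_action (Zp p) \<Gamma>)"

type_synonym ('v, 'g) div_lambda = "(('v \<times> 'g \<Rightarrow> nat \<Rightarrow> int) \<Rightarrow> (nat \<Rightarrow> 'g set \<Rightarrow> nat \<Rightarrow> int)) set"

definition Div_Lambda ::
    "nat \<Rightarrow> ('g, 'm) monoid_scheme \<Rightarrow> ('v, 'e) pre_digraph \<Rightarrow> ('e \<Rightarrow> 'g)
      \<Rightarrow> (nat \<Rightarrow> 'g set \<Rightarrow> nat \<Rightarrow> int, ('v, 'g) div_lambda) module" where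
  "Div_Lambda p \<Gamma> X \<alpha> =
     base_change (group_ring (Zp p) \<Gamma>) (Iwasawa p \<Gamma>) (to_Iwasawa p \<Gamma>) (Div_infty p \<Gamma> X \<alpha>)"

definition base_vertex ::
    "nat \<Rightarrow> ('g, 'm) monoid_scheme \<Rightarrow> ('v, 'e) pre_digraph \<Rightarrow> ('e \<Rightarrow> 'g) \<Rightarrow> (nat \<Rightarrow> 'v) \<Rightarrow> nat
      \<Rightarrow> ('v, 'g) div_lambda" where
  "base_vertex p \<Gamma> X \<alpha> v i =
     tensor_one (group_ring (Zp p) \<Gamma>) (Iwasawa p \<Gamma>) (to_Iwasawa p \<Gamma>) (Div_infty p \<Gamma> X \<alpha>)
       (single (Zp p) (v i, \<one>\<^bsub>\<Gamma>\<^esub>))"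

definition A_entry ::
    "nat \<Rightarrow> ('g, 'm) monoid_scheme \<Rightarrow> ('v, 'e) pre_digraph \<Rightarrow> ('e \<Rightarrow> 'g) \<Rightarrow> (nat \<Rightarrow> 'v) \<Rightarrow> nat \<Rightarrow> nat
      \<Rightarrow> ('g \<Rightarrow> nat \<Rightarrow> int)" where
  "A_entry p \<Gamma> X \<alpha> v i j =
    (let R = group_ring (Zp p) \<Gamma> in
     if i = j
     then \<Oplus>\<^bsub>R\<^esub>e\<in>loops_at X (v i). single (Zp p) (\<alpha> e) \<oplus>\<^bsub>R\<^esub> single (Zp p) (inv\<^bsub>\<Gamma>\<^esub> (\<alpha> e))
     else \<Oplus>\<^bsub>R\<^esub>d\<in>{d \<in> directed_edges X. dsource X d = v i \<and> dtarget X d = v j}.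
            single (Zp p) (dvoltage \<Gamma> \<alpha> d))"

definition D_entry ::
    "nat \<Rightarrow> ('g, 'm) monoid_scheme \<Rightarrow> ('v, 'e) pre_digraph \<Rightarrow> (nat \<Rightarrow> 'v) \<Rightarrow> nat \<Rightarrow> nat
      \<Rightarrow> ('g \<Rightarrow> nat \<Rightarrow> int)" where
  "D_entry p \<Gamma> X v i j =
    (let R = group_ring (Zp p) \<Gamma> in
     if i = j then add_pow R (mdegree X (v i)) \<one>\<^bsub>R\<^esub> else \<zero>\<^bsub>R\<^esub>)"

definition Laplacian_infty ::
    "nat \<Rightarrow> ('g, 'm) monoid_scheme \<Rightarrow> ('v, 'e) pre_digraph \<Rightarrow> ('e \<Rightarrow> 'g) \<Rightarrow> (nat \<Rightarrow> 'v) \<Rightarrow> nat \<Rightarrow> nat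
      \<Rightarrow> ('g \<Rightarrow> nat \<Rightarrow> int)" where
  "Laplacian_infty p \<Gamma> X \<alpha> v i j =
     D_entry p \<Gamma> X v i j \<ominus>\<^bsub>group_ring (Zp p) \<Gamma>\<^esub> A_entry p \<Gamma> X \<alpha> v i j"

definition base_principal ::
    "nat \<Rightarrow> ('g, 'm) monoid_scheme \<Rightarrow> ('v, 'e) pre_digraph \<Rightarrow> ('e \<Rightarrow> 'g) \<Rightarrow> nat \<Rightarrow> (nat \<Rightarrow> 'v) \<Rightarrow> nat
      \<Rightarrow> ('v, 'g) div_lambda" where
  "base_principal p \<Gamma> X \<alpha> n v i =
     (\<Oplus>\<^bsub>Div_Lambda p \<Gamma> X \<alpha>\<^esub>j\<in>{1..n}.
        to_Iwasawa p \<Gamma> (Laplacian_infty p \<Gamma> X \<alpha> v i j)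
          \<odot>\<^bsub>Div_Lambda p \<Gamma> X \<alpha>\<^esub> base_vertex p \<Gamma> X \<alpha> v j)"

definition Pr_Lambda ::
    "nat \<Rightarrow> ('g, 'm) monoid_scheme \<Rightarrow> ('v, 'e) pre_digraph \<Rightarrow> ('e \<Rightarrow> 'g) \<Rightarrow> nat \<Rightarrow> (nat \<Rightarrow> 'v)
      \<Rightarrow> ('v, 'g) div_lambda set" where
  "Pr_Lambda p \<Gamma> X \<alpha> n v =
     mod_span (Iwasawa p \<Gamma>) (Div_Lambda p \<Gamma> X \<alpha>) (base_principal p \<Gamma> X \<alpha> n v ` {1..n})"

definition M_Lambda ::
    "nat \<Rightarrow> nat \<Rightarrow> ('g, 'm) monoid_scheme \<Rightarrow> (nat \<Rightarrow> 'g) \<Rightarrow> ('v, 'e) pre_digraph \<Rightarrow> ('e \<Rightarrow> 'g)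
      \<Rightarrow> nat \<Rightarrow> (nat \<Rightarrow> 'v) \<Rightarrow> ('v, 'g) div_lambda set" where
  "M_Lambda p l \<Gamma> \<gamma> X \<alpha> n v =
    (let L = Iwasawa p \<Gamma>; DL = Div_Lambda p \<Gamma> X \<alpha> in
     mod_span L DL
      (base_principal p \<Gamma> X \<alpha> n v ` {1..n}
       \<union> {base_vertex p \<Gamma> X \<alpha> v i \<ominus>\<^bsub>DL\<^esub> base_vertex p \<Gamma> X \<alpha> v j | i j. 1 \<le> j \<and> j < i \<and> i \<le> n}
       \<union> ideal_smult L (Idl\<^bsub>L\<^esub> (Tvar p \<Gamma> \<gamma> ` {1..l})) DL))"

definition M_Lambda_quotient ::
    "nat \<Rightarrow> nat \<Rightarrow> ('g, 'm) monoid_scheme \<Rightarrow> (nat \<Rightarrow> 'g) \<Rightarrow> ('v, 'e) pre_digraph \<Rightarrow> ('e \<Rightarrow> 'g)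
      \<Rightarrow> nat \<Rightarrow> (nat \<Rightarrow> 'v) \<Rightarrow> nat
      \<Rightarrow> (nat \<Rightarrow> 'g set \<Rightarrow> nat \<Rightarrow> int, ('v, 'g) div_lambda set) module" where
  "M_Lambda_quotient p l \<Gamma> \<gamma> X \<alpha> n v m =
    (let L = Iwasawa p \<Gamma>; DL = Div_Lambda p \<Gamma> X \<alpha> in
     quotient_module (DL\<lparr>carrier := M_Lambda p l \<Gamma> \<gamma> X \<alpha> n v\<rparr>)
       (ideal_smult L (Idl\<^bsub>L\<^esub> ((\<lambda>i. omega p \<Gamma> m (Tvar p \<Gamma> \<gamma> i)) ` {1..l})) DL
          <+>\<^bsub>DL\<^esub> Pr_Lambda p \<Gamma> X \<alpha> n v))"

end

(* The layer map Div_Lambda -> Div(X_m) is induced by reduction of vertices and Lambda-linear through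
   Lambda -> Z_p[Gamma/Gamma^(p^m)]. In coordinates with respect to the base vertices it is this ring
   map applied to every coefficient, so its kernel is I Div_Lambda with I the kernel of the ring map;
   it carries Pr_Lambda onto Pr(X_m), and M_Lambda is the preimage of Div^0(X_m). The isomorphism
   is induced by taking preimages.

   The algebraic input is that I is generated by the elements omega_m(T_i) = gamma_i^(p^m) - 1. An
   element of the kernel of Z_p[Gamma/Gamma^(p^(k+1))] -> Z_p[Gamma/Gamma^(p^k)] is a combination of the
   gamma_i^(p^k) - 1, because the gamma_i^(p^k) generate Gamma^(p^k) modulo Gamma^(p^(k+1)).
   Correcting level by level yields an infinite series, which converges because
   gamma_i^(p^(m+t)) - 1 is a multiple of gamma_i^(p^m) - 1 with a cofactor that tends to 0. *)
theory Submission
  imports Defs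
begin

text \<open>The cofactor of gamma_i^(p^(m+t)) - 1 over gamma_i^(p^m) - 1 is a product of t geometric
  sums 1 + x + ... + x^(p-1) with x a p-power of gamma_i. Such a sum acts as multiplication by p,
  but only on the layers in which x is already trivial. Smallness is therefore neither a matter of
  the layer alone nor of divisibility by p alone, and convergence is measured by layer index and
  p-adic precision jointly; this is the origin of the condition j + r < t in
  \<open>filtration\<close>.

  \<open>M_Lambda\<close> does not mention m, although it has to be the preimage of Div^0(X_m) for
  every m. The link is the coefficient sum: for an element of Lambda it is the same in all layers,
  and in layer 0, where the group is trivial, it determines the component.

  Products in group rings and actions on divisors are given by explicit sums. They are identified
  with bilinear extensions of maps on basis elements, after which every algebraic law is checked on
  basis elements only.\<close>

definition self_module :: "('a, 'r) ring_scheme \<Rightarrow> ('a, 'a) module" where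
  "self_module K = \<lparr>carrier = carrier K, mult = mult K, one = one K, zero = zero K, add = add K,
     smult = mult K\<rparr>"

definition linear_maps ::
    "('a, 'r) ring_scheme \<Rightarrow> ('a, 'b, 'm) module_scheme \<Rightarrow> ('a, 'c, 'n) module_scheme \<Rightarrow> ('b \<Rightarrow> 'c) set" where
  "linear_maps K M N = {h \<in> carrier M \<rightarrow> carrier N.
     (\<forall>x\<in>carrier M. \<forall>y\<in>carrier M. h (x \<oplus>\<^bsub>M\<^esub> y) = h x \<oplus>\<^bsub>N\<^esub> h y) \<and>
     (\<forall>a\<in>carrier K. \<forall>x\<in>carrier M. h (a \<odot>\<^bsub>M\<^esub> x) = a \<odot>\<^bsub>N\<^esub> h x)}"

text \<open>The index set does not occur: the sum runs over the support of \<open>f\<close>, which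
  is finite for \<open>f\<close> in a free module even when the basis is infinite, such as Gamma or
  the vertices of X_infinity.\<close>

definition lin_comb ::
    "('a, 'r) ring_scheme \<Rightarrow> ('a, 'c, 'm) module_scheme \<Rightarrow> ('b \<Rightarrow> 'a) \<Rightarrow> ('b \<Rightarrow> 'c) \<Rightarrow> 'c" where
  "lin_comb K N f F = (\<Oplus>\<^bsub>N\<^esub>b\<in>{b. f b \<noteq> \<zero>\<^bsub>K\<^esub>}. f b \<odot>\<^bsub>N\<^esub> F b)"

lemma self_module_simps [simp]:
  "carrier (self_module K) = carrier K" "zero (self_module K) = zero K"
  "add (self_module K) = add K" "smult (self_module K) = mult K"
  by (simp_all add: self_module_def)

lemma finsum_self_module [simp]: "finsum (self_module K) f A = finsum K f A"
  by (simp add: finsum_def finprod_def)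

text \<open>Ideals of Lambda are handled as submodules of this module, and evaluation at a point and
  the coefficient sum as linear maps into it, so one set of facts on modules serves all of
  them.\<close>

lemma module_self_module:
  assumes "cring K" shows "module K (self_module K)"
proof -
  interpret cring K by fact
  show ?thesis
    by (intro moduleI abelian_groupI)
       (auto simp: assms a_assoc l_distr r_distr m_assoc intro: a_comm)
qed

lemma a_inv_self_module [simp]: "a_inv (self_module K) x = a_inv K x"
  by (simp add: a_inv_def m_inv_def)

lemma free_module_simps [simp]:
  "zero (free_module K B) = (\<lambda>_. \<zero>\<^bsub>K\<^esub>)"
  "add (free_module K B) = (\<lambda>f g b. f b \<oplus>\<^bsub>K\<^esub> g b)"
  "smult (free_module K B) = (\<lambda>a f b. a \<otimes>\<^bsub>K\<^esub> f b)"
  by (simp_all add: free_module_def)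

lemma free_module_carrier:
  "f \<in> carrier (free_module K B) \<longleftrightarrow>
     (\<forall>b\<in>B. f b \<in> carrier K) \<and> (\<forall>b. b \<notin> B \<longrightarrow> f b = \<zero>\<^bsub>K\<^esub>) \<and> finite {b. f b \<noteq> \<zero>\<^bsub>K\<^esub>}"
  by (simp add: free_module_def)

section \<open>Free modules and induction on the support\<close>

context cring
begin

lemma free_module_closed: "f \<in> carrier (free_module R B) \<Longrightarrow> f b \<in> carrier R"
  by (cases "b \<in> B") (auto simp: free_module_carrier)

lemma free_module_add:
  assumes "f \<in> carrier (free_module R B)" "g \<in> carrier (free_module R B)"
  shows "(\<lambda>b. f b \<oplus> g b) \<in> carrier (free_module R B)"
proof -
  have "{b. f b \<oplus> g b \<noteq> \<zero>} \<subseteq> {b. f b \<noteq> \<zero>} \<union> {b. g b \<noteq> \<zero>}"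
    by (auto simp: free_module_closed assms)
  with assms show ?thesis
    by (auto simp: free_module_carrier intro: finite_subset)
qed

lemma free_module_smult:
  assumes "a \<in> carrier R" "f \<in> carrier (free_module R B)"
  shows "(\<lambda>b. a \<otimes> f b) \<in> carrier (free_module R B)"
proof -
  have "{b. a \<otimes> f b \<noteq> \<zero>} \<subseteq> {b. f b \<noteq> \<zero>}"
    using assms by auto
  with assms show ?thesis
    by (auto simp: free_module_carrier intro: finite_subset)
qed

lemma free_module_zero: "(\<lambda>_. \<zero>) \<in> carrier (free_module R B)"
  by (simp add: free_module_carrier)

lemma free_module_single: "b \<in> B \<Longrightarrow> single R b \<in> carrier (free_module R B)"
  by (auto simp: free_module_carrier single_def)

lemma module_free_module: "module R (free_module R B)"
proof (intro moduleI abelian_groupI)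
  fix x assume x: "x \<in> carrier (free_module R B)"
  have "(\<lambda>b. \<ominus> \<one> \<otimes> x b) \<in> carrier (free_module R B)"
    by (intro free_module_smult x) auto
  moreover have "(\<lambda>b. \<ominus> \<one> \<otimes> x b \<oplus> x b) = (\<lambda>_. \<zero>)"
    by (auto simp: free_module_closed[OF x] l_minus l_neg)
  ultimately show "\<exists>y\<in>carrier (free_module R B).
      y \<oplus>\<^bsub>free_module R B\<^esub> x = \<zero>\<^bsub>free_module R B\<^esub>"
    by (intro bexI[where x = "\<lambda>b. \<ominus> \<one> \<otimes> x b"]) auto
qed (auto simp: is_cring free_module_closed free_module_add free_module_smult free_module_zero
      a_assoc l_distr r_distr m_assoc intro!: ext, auto intro: a_comm simp: free_module_closed)

lemma free_module_a_inv:
  assumes "f \<in> carrier (free_module R B)"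
  shows "\<ominus>\<^bsub>free_module R B\<^esub> f = (\<lambda>b. \<ominus> f b)"
proof -
  interpret F: module R "free_module R B" by (rule module_free_module)
  have "\<ominus>\<^bsub>free_module R B\<^esub> f = (\<ominus> \<one>) \<odot>\<^bsub>free_module R B\<^esub> f"
    using assms by (simp add: F.smult_l_minus F.smult_one del: free_module_simps)
  also have "\<dots> = (\<lambda>b. \<ominus> f b)"
    by (auto simp: l_minus free_module_closed[OF assms])
  finally show ?thesis .
qed

lemma free_module_minus:
  assumes "f \<in> carrier (free_module R B)" "g \<in> carrier (free_module R B)"
  shows "f \<ominus>\<^bsub>free_module R B\<^esub> g = (\<lambda>b. f b \<ominus> g b)"
  by (simp add: a_minus_def free_module_a_inv[OF assms(2)])

text \<open>The induction runs over a finite set containing the support: splitting off the term at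
  one point \<open>c\<close> leaves a function supported in the smaller set.\<close>

lemma free_module_induct [consumes 1, case_names zero add single]:
  assumes f: "f \<in> carrier (free_module R B)"
    and zero: "P (\<lambda>_. \<zero>)"
    and add: "\<And>f g. f \<in> carrier (free_module R B) \<Longrightarrow> g \<in> carrier (free_module R B) \<Longrightarrow>
       P f \<Longrightarrow> P g \<Longrightarrow> P (\<lambda>b. f b \<oplus> g b)"
    and single: "\<And>a b. a \<in> carrier R \<Longrightarrow> b \<in> B \<Longrightarrow> P (\<lambda>x. a \<otimes> single R b x)"
  shows "P f"
proof -
  have "finite S \<Longrightarrow> f \<in> carrier (free_module R B) \<Longrightarrow> {b. f b \<noteq> \<zero>} \<subseteq> S \<Longrightarrow> P f" for S f
  proof (induction S arbitrary: f rule: finite_induct)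
    case empty
    then have "f = (\<lambda>_. \<zero>)" by auto
    with zero show ?case by simp
  next
    case (insert c S)
    note closed = free_module_closed[OF insert.prems(1)]
    show ?case
    proof (cases "c \<in> B")
      \<comment> \<open>Outside \<open>B\<close> the coefficient is zero, so \<open>c\<close> can
        simply be dropped from the enclosing set.\<close>
      case False
      with insert.prems have "f c = \<zero>" by (auto simp: free_module_carrier)
      with insert show ?thesis by auto
    next
      case True
      let ?g = "\<lambda>x. if x = c then \<zero> else f x"
      have "{b. ?g b \<noteq> \<zero>} \<subseteq> {b. f b \<noteq> \<zero>}" by auto
      with insert.prems(1) have g: "?g \<in> carrier (free_module R B)"
        by (auto simp: free_module_carrier intro: finite_subset)
      have "{b. ?g b \<noteq> \<zero>} \<subseteq> S" using insert.prems(2) by auto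
      then have "P ?g" by (rule insert.IH[OF g])
      moreover have "P (\<lambda>x. f c \<otimes> single R c x)" using True closed by (intro single)
      moreover have "(\<lambda>x. f c \<otimes> single R c x) \<in> carrier (free_module R B)"
        by (intro free_module_smult free_module_single True closed)
      ultimately have "P (\<lambda>b. (f c \<otimes> single R c b) \<oplus> ?g b)" using g by (intro add)
      also have "(\<lambda>b. (f c \<otimes> single R c b) \<oplus> ?g b) = f"
        by (auto simp: single_def closed)
      finally show ?thesis .
    qed
  qed
  from this[of "{b. f b \<noteq> \<zero>}" f] f show ?thesis by (auto simp: free_module_carrier)
qed

end

section \<open>Finite linear combinations\<close>

context module
begin

lemma finsum_cong_closed:
  assumes "\<And>i. i \<in> A \<Longrightarrow> f i = g i" "\<And>i. i \<in> A \<Longrightarrow> g i \<in> carrier M"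
  shows "finsum M f A = finsum M g A"
  by (rule M.finsum_cong') (use assms in auto)

text \<open>The extra terms have coefficient zero. This puts functions with different supports over
  one common index set, which additivity in the coefficients requires.\<close>

lemma lin_comb_superset:
  assumes f: "f \<in> carrier (free_module R B)" and F: "F \<in> B \<rightarrow> carrier M"
    and A: "finite A" "A \<subseteq> B" "{b. f b \<noteq> \<zero>} \<subseteq> A"
  shows "lin_comb R M f F = (\<Oplus>\<^bsub>M\<^esub>b\<in>A. f b \<odot>\<^bsub>M\<^esub> F b)"
  unfolding lin_comb_def
  by (rule M.add.finprod_mono_neutral_cong_left)
     (use A in \<open>auto intro!: smult_closed smult_l_null R.free_module_closed[OF f] funcset_mem[OF F]\<close>)

lemma lin_comb_closed:
  assumes f: "f \<in> carrier (free_module R B)" and F: "F \<in> B \<rightarrow> carrier M"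
  shows "lin_comb R M f F \<in> carrier M"
  unfolding lin_comb_def
  by (rule M.finsum_closed) (use assms R.free_module_closed[OF f] in \<open>auto simp: free_module_carrier\<close>)

lemma support_subset: "f \<in> carrier (free_module R B) \<Longrightarrow> {b. f b \<noteq> \<zero>} \<subseteq> B"
  by (auto simp: free_module_carrier)

lemma support_finite: "f \<in> carrier (free_module R B) \<Longrightarrow> finite {b. f b \<noteq> \<zero>}"
  by (auto simp: free_module_carrier)

lemma lin_comb_add:
  assumes f: "f \<in> carrier (free_module R B)" and g: "g \<in> carrier (free_module R B)"
    and F: "F \<in> B \<rightarrow> carrier M"
  shows "lin_comb R M (\<lambda>b. f b \<oplus> g b) F = lin_comb R M f F \<oplus>\<^bsub>M\<^esub> lin_comb R M g F"
proof -
  let ?A = "{b. f b \<noteq> \<zero>} \<union> {b. g b \<noteq> \<zero>}"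
  have A: "finite ?A" "?A \<subseteq> B"
    using support_subset[OF f] support_subset[OF g] support_finite[OF f] support_finite[OF g]
    by auto
  have s: "{b. f b \<oplus> g b \<noteq> \<zero>} \<subseteq> ?A" by auto
  have FA: "F b \<in> carrier M" if "b \<in> ?A" for b using that A(2) F by blast
  have "lin_comb R M (\<lambda>b. f b \<oplus> g b) F = (\<Oplus>\<^bsub>M\<^esub>b\<in>?A. (f b \<oplus> g b) \<odot>\<^bsub>M\<^esub> F b)"
    by (rule lin_comb_superset[OF R.free_module_add[OF f g] F A s])
  also have "\<dots> = (\<Oplus>\<^bsub>M\<^esub>b\<in>?A. f b \<odot>\<^bsub>M\<^esub> F b \<oplus>\<^bsub>M\<^esub> g b \<odot>\<^bsub>M\<^esub> F b)"
    using FA R.free_module_closed[OF f] R.free_module_closed[OF g]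
    by (intro finsum_cong_closed smult_l_distr M.add.m_closed smult_closed) auto
  also have "\<dots> = (\<Oplus>\<^bsub>M\<^esub>b\<in>?A. f b \<odot>\<^bsub>M\<^esub> F b) \<oplus>\<^bsub>M\<^esub> (\<Oplus>\<^bsub>M\<^esub>b\<in>?A. g b \<odot>\<^bsub>M\<^esub> F b)"
    using FA R.free_module_closed[OF f] R.free_module_closed[OF g]
    by (intro M.finsum_addf) auto
  also have "\<dots> = lin_comb R M f F \<oplus>\<^bsub>M\<^esub> lin_comb R M g F"
    by (subst (1 2) lin_comb_superset[OF _ F A]) (use f g in auto)
  finally show ?thesis .
qed

lemma lin_comb_smult:
  assumes a: "a \<in> carrier R" and f: "f \<in> carrier (free_module R B)" and F: "F \<in> B \<rightarrow> carrier M"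
  shows "lin_comb R M (\<lambda>b. a \<otimes> f b) F = a \<odot>\<^bsub>M\<^esub> lin_comb R M f F"
proof -
  let ?A = "{b. f b \<noteq> \<zero>}"
  note A = support_finite[OF f] support_subset[OF f]
  have s: "{b. a \<otimes> f b \<noteq> \<zero>} \<subseteq> ?A" using a by auto
  have FA: "F b \<in> carrier M" if "b \<in> ?A" for b using that A(2) F by blast
  have "lin_comb R M (\<lambda>b. a \<otimes> f b) F = (\<Oplus>\<^bsub>M\<^esub>b\<in>?A. (a \<otimes> f b) \<odot>\<^bsub>M\<^esub> F b)"
    by (rule lin_comb_superset[OF R.free_module_smult[OF a f] F A s])
  also have "\<dots> = (\<Oplus>\<^bsub>M\<^esub>b\<in>?A. a \<odot>\<^bsub>M\<^esub> (f b \<odot>\<^bsub>M\<^esub> F b))"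
    using FA a R.free_module_closed[OF f]
    by (intro finsum_cong_closed smult_assoc1 smult_closed) auto
  also have "\<dots> = a \<odot>\<^bsub>M\<^esub> lin_comb R M f F"
    unfolding lin_comb_def
    by (rule finsum_smult_ldistr[symmetric]) (use A(1) FA a R.free_module_closed[OF f] in auto)
  finally show ?thesis .
qed

lemma lin_comb_single:
  assumes b: "b \<in> B" and F: "F \<in> B \<rightarrow> carrier M"
  shows "lin_comb R M (single R b) F = F b"
proof -
  have "lin_comb R M (single R b) F = (\<Oplus>\<^bsub>M\<^esub>c\<in>{b}. single R b c \<odot>\<^bsub>M\<^esub> F c)"
    by (rule lin_comb_superset[OF R.free_module_single[OF b] F])
       (use b in \<open>auto simp: single_def\<close>)
  also have "\<dots> = F b"
    using funcset_mem[OF F b] by (simp add: single_def M.finsum_insert)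
  finally show ?thesis .
qed

lemma lin_comb_zero: "lin_comb R M (\<lambda>_. \<zero>) F = \<zero>\<^bsub>M\<^esub>"
  by (simp add: lin_comb_def)

lemma lin_comb_cong:
  assumes f: "f \<in> carrier (free_module R B)" and G: "G \<in> B \<rightarrow> carrier M"
    and "\<And>b. b \<in> B \<Longrightarrow> F b = G b"
  shows "lin_comb R M f F = lin_comb R M f G"
  unfolding lin_comb_def
proof (rule finsum_cong_closed)
  fix b assume "b \<in> {b. f b \<noteq> \<zero>}"
  then have "b \<in> B" using support_subset[OF f] by auto
  then show "f b \<odot>\<^bsub>M\<^esub> F b = f b \<odot>\<^bsub>M\<^esub> G b" "f b \<odot>\<^bsub>M\<^esub> G b \<in> carrier M"
    using assms R.free_module_closed[OF f] by auto
qed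

lemma lin_comb_add_right:
  assumes f: "f \<in> carrier (free_module R B)" and F: "F \<in> B \<rightarrow> carrier M" and G: "G \<in> B \<rightarrow> carrier M"
  shows "lin_comb R M f (\<lambda>b. F b \<oplus>\<^bsub>M\<^esub> G b) = lin_comb R M f F \<oplus>\<^bsub>M\<^esub> lin_comb R M f G"
  using f
proof (induction rule: R.free_module_induct)
  case (add f g)
  have "lin_comb R M f F \<in> carrier M" "lin_comb R M g F \<in> carrier M"
    "lin_comb R M f G \<in> carrier M" "lin_comb R M g G \<in> carrier M"
    using add F G by (auto intro: lin_comb_closed)
  with add show ?case using F G
    by (subst (1 2 3) lin_comb_add[where B = B]) (auto simp: M.add.m_ac)
next
  case (single a b)
  have FG: "(\<lambda>b. F b \<oplus>\<^bsub>M\<^esub> G b) \<in> B \<rightarrow> carrier M" using F G by auto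
  have "F b \<in> carrier M" "G b \<in> carrier M" using single F G by auto
  with single show ?case
    by (simp add: lin_comb_smult[OF _ _ F] lin_comb_smult[OF _ _ G] lin_comb_smult[OF _ _ FG]
      R.free_module_single lin_comb_single[OF _ F] lin_comb_single[OF _ G] lin_comb_single[OF _ FG]
      smult_r_distr)
qed (simp add: lin_comb_zero)

lemma lin_comb_smult_right:
  assumes f: "f \<in> carrier (free_module R B)" and F: "F \<in> B \<rightarrow> carrier M" and c: "c \<in> carrier R"
  shows "lin_comb R M f (\<lambda>b. c \<odot>\<^bsub>M\<^esub> F b) = c \<odot>\<^bsub>M\<^esub> lin_comb R M f F"
  using f
proof (induction rule: R.free_module_induct)
  case (add f g)
  have "lin_comb R M f F \<in> carrier M" "lin_comb R M g F \<in> carrier M"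
    using add F by (auto intro: lin_comb_closed)
  with add show ?case using F c
    by (subst (1 2) lin_comb_add[where B = B]) (auto simp: smult_r_distr)
next
  case (single a b)
  have cF: "(\<lambda>b. c \<odot>\<^bsub>M\<^esub> F b) \<in> B \<rightarrow> carrier M" using F c by auto
  have "F b \<in> carrier M" using F single by auto
  with single c show ?case
    by (simp add: lin_comb_smult[OF _ _ F] lin_comb_smult[OF _ _ cF] R.free_module_single
      lin_comb_single[OF _ F] lin_comb_single[OF _ cF] smult_assoc1[symmetric] R.m_comm)
qed (use c in \<open>simp add: lin_comb_zero\<close>)

lemma lin_comb_linear:
  assumes F: "F \<in> B \<rightarrow> carrier M"
  shows "(\<lambda>f. lin_comb R M f F) \<in> linear_maps R (free_module R B) M"
  using lin_comb_closed[OF _ F] lin_comb_add[OF _ _ F] lin_comb_smult[OF _ _ F]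
  by (auto simp: linear_maps_def)

text \<open>An explicit description with a coefficient function, where \<open>mod_span\<close> would
  give bare membership. The coefficients of elements of Div_Lambda and of the ideals in Lambda are
  extracted through it.\<close>

lemma finite_combinations_submodule:
  assumes b: "b \<in> I \<rightarrow> carrier M" and I: "finite I"
  shows "submodule {\<Oplus>\<^bsub>M\<^esub>i\<in>I. z i \<odot>\<^bsub>M\<^esub> b i | z. z \<in> I \<rightarrow> carrier R} R M" (is "submodule ?S R M")
proof (rule submoduleI)
  show "?S \<subseteq> carrier M" using b by (auto intro!: M.finsum_closed)
  have "\<zero>\<^bsub>M\<^esub> = (\<Oplus>\<^bsub>M\<^esub>i\<in>I. \<zero> \<odot>\<^bsub>M\<^esub> b i)"
    using b by (subst finsum_cong_closed[where g = "\<lambda>_. \<zero>\<^bsub>M\<^esub>"]) (auto simp: Pi_iff)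
  then show "\<zero>\<^bsub>M\<^esub> \<in> ?S" by (auto intro!: exI[where x = "\<lambda>_. \<zero>"])
next
  fix x y assume "x \<in> ?S" "y \<in> ?S"
  then obtain z w where z: "z \<in> I \<rightarrow> carrier R" "x = (\<Oplus>\<^bsub>M\<^esub>i\<in>I. z i \<odot>\<^bsub>M\<^esub> b i)"
    and w: "w \<in> I \<rightarrow> carrier R" "y = (\<Oplus>\<^bsub>M\<^esub>i\<in>I. w i \<odot>\<^bsub>M\<^esub> b i)" by auto
  have "x \<oplus>\<^bsub>M\<^esub> y = (\<Oplus>\<^bsub>M\<^esub>i\<in>I. z i \<odot>\<^bsub>M\<^esub> b i \<oplus>\<^bsub>M\<^esub> w i \<odot>\<^bsub>M\<^esub> b i)"
    unfolding z w using z w b by (intro M.finsum_addf[symmetric]) auto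
  also have "\<dots> = (\<Oplus>\<^bsub>M\<^esub>i\<in>I. (z i \<oplus> w i) \<odot>\<^bsub>M\<^esub> b i)"
    using z w b by (intro finsum_cong_closed smult_l_distr[symmetric]) auto
  finally show "x \<oplus>\<^bsub>M\<^esub> y \<in> ?S" using z w by (auto intro!: exI[where x = "\<lambda>i. z i \<oplus> w i"])
next
  have *: "a \<odot>\<^bsub>M\<^esub> x \<in> ?S" if "a \<in> carrier R" "x \<in> ?S" for a x
  proof -
    from that obtain z where z: "z \<in> I \<rightarrow> carrier R" "x = (\<Oplus>\<^bsub>M\<^esub>i\<in>I. z i \<odot>\<^bsub>M\<^esub> b i)" by auto
    have "a \<odot>\<^bsub>M\<^esub> x = (\<Oplus>\<^bsub>M\<^esub>i\<in>I. a \<odot>\<^bsub>M\<^esub> (z i \<odot>\<^bsub>M\<^esub> b i))"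
      unfolding z using z b that I by (intro finsum_smult_ldistr) auto
    also have "\<dots> = (\<Oplus>\<^bsub>M\<^esub>i\<in>I. (a \<otimes> z i) \<odot>\<^bsub>M\<^esub> b i)"
      using z b that by (intro finsum_cong_closed smult_assoc1[symmetric]) auto
    finally show ?thesis using z that by (auto intro!: exI[where x = "\<lambda>i. a \<otimes> z i"])
  qed
  then show "\<And>a x. a \<in> carrier R \<Longrightarrow> x \<in> ?S \<Longrightarrow> a \<odot>\<^bsub>M\<^esub> x \<in> ?S" .
  fix x assume x: "x \<in> ?S"
  then have "x \<in> carrier M" using b by (auto intro!: M.finsum_closed)
  then have "\<ominus>\<^bsub>M\<^esub> x = (\<ominus> \<one>) \<odot>\<^bsub>M\<^esub> x" by (simp add: smult_l_minus)
  then show "\<ominus>\<^bsub>M\<^esub> x \<in> ?S" using *[of "\<ominus> \<one>" x] x by simp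
qed

end

section \<open>Spans\<close>

text \<open>\<open>hull\<close> intersects all submodules that contain \<open>A\<close>. As
  \<open>A\<close> lies in the carrier, the carrier is one of them, which bounds the intersection;
  the closure properties pass to intersections.\<close>

lemma mod_span_submodule:
  assumes "module K M" "A \<subseteq> carrier M"
  shows "submodule (mod_span K M A) K M"
proof -
  interpret module K M by fact
  show ?thesis
  proof (rule submoduleI)
    show "mod_span K M A \<subseteq> carrier M"
      unfolding mod_span_def using assms(2) carrier_is_submodule by (rule hull_minimal)
  qed (auto simp: mod_span_def hull_def
       dest: submoduleE subgroup.one_closed[OF submodule.axioms(1)])
qed

lemma mod_span_minimal:
  "submodule N K M \<Longrightarrow> A \<subseteq> N \<Longrightarrow> mod_span K M A \<subseteq> N"
  unfolding mod_span_def by (rule hull_minimal)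

lemma mod_span_superset: "A \<subseteq> mod_span K M A"
  unfolding mod_span_def by (rule hull_subset)

lemma (in module) finite_combination_member:
  assumes b: "b \<in> I \<rightarrow> carrier M" and I: "finite I" and i: "i \<in> I"
  shows "b i \<in> {\<Oplus>\<^bsub>M\<^esub>i\<in>I. z i \<odot>\<^bsub>M\<^esub> b i | z. z \<in> I \<rightarrow> carrier R}"
proof -
  have bc: "b j \<in> carrier M" if "j \<in> I" for j using b that by auto
  have "(\<Oplus>\<^bsub>M\<^esub>j\<in>I. (if i = j then \<one> else \<zero>) \<odot>\<^bsub>M\<^esub> b j) = (\<Oplus>\<^bsub>M\<^esub>j\<in>I. if i = j then b j else \<zero>\<^bsub>M\<^esub>)"
    using bc by (intro finsum_cong_closed) auto
  also have "\<dots> = b i" using i I b by (rule M.finsum_singleton)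
  finally show ?thesis
    by (intro CollectI exI[where x = "\<lambda>j. if i = j then \<one> else \<zero>"] conjI) auto
qed

text \<open>Over an infinite index set the sum has the default value zero, which every submodule
  contains.\<close>

lemma submodule_finsum:
  assumes "module R M" "submodule S R M" "f \<in> I \<rightarrow> S"
  shows "finsum M f I \<in> S"
proof -
  interpret module R M by fact
  note E = submoduleE[OF assms(2)]
  have zero: "\<zero>\<^bsub>M\<^esub> \<in> S" using subgroup.one_closed[OF submodule.axioms(1)[OF assms(2)]] by simp
  show ?thesis using assms(3)
  proof (induction I rule: infinite_finite_induct)
    case (insert a I)
    then have "f a \<in> S" "f \<in> I \<rightarrow> carrier M" "f a \<in> carrier M" using E(1) by auto
    with insert E(5) show ?case by (simp add: M.finsum_insert)
  qed (simp_all add: zero M.finsum_infinite)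
qed

section \<open>Linear maps, kernels and preimages\<close>

lemma linear_mapsD:
  assumes "h \<in> linear_maps K M N"
  shows "x \<in> carrier M \<Longrightarrow> h x \<in> carrier N"
    and "x \<in> carrier M \<Longrightarrow> y \<in> carrier M \<Longrightarrow> h (x \<oplus>\<^bsub>M\<^esub> y) = h x \<oplus>\<^bsub>N\<^esub> h y"
    and "a \<in> carrier K \<Longrightarrow> x \<in> carrier M \<Longrightarrow> h (a \<odot>\<^bsub>M\<^esub> x) = a \<odot>\<^bsub>N\<^esub> h x"
  using assms by (auto simp: linear_maps_def)

lemma linear_maps_zero:
  assumes "module K M" "module K N" "h \<in> linear_maps K M N"
  shows "h \<zero>\<^bsub>M\<^esub> = \<zero>\<^bsub>N\<^esub>"
proof -
  interpret M: module K M by fact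
  interpret N: module K N by fact
  have "h \<zero>\<^bsub>M\<^esub> = h (\<zero>\<^bsub>K\<^esub> \<odot>\<^bsub>M\<^esub> \<zero>\<^bsub>M\<^esub>)" by simp
  also have "\<dots> = \<zero>\<^bsub>N\<^esub>"
    by (subst linear_mapsD(3)[OF assms(3)]) (auto intro!: N.smult_l_null linear_mapsD(1)[OF assms(3)])
  finally show ?thesis .
qed

lemma linear_maps_uminus:
  assumes "module K M" "module K N" "h \<in> linear_maps K M N" "x \<in> carrier M"
  shows "h (\<ominus>\<^bsub>M\<^esub> x) = \<ominus>\<^bsub>N\<^esub> h x"
proof -
  interpret M: module K M by fact
  interpret N: module K N by fact
  have "h (\<ominus>\<^bsub>M\<^esub> x) = h ((\<ominus>\<^bsub>K\<^esub> \<one>\<^bsub>K\<^esub>) \<odot>\<^bsub>M\<^esub> x)"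
    using assms(4) by (simp add: M.smult_l_minus)
  also have "\<dots> = \<ominus>\<^bsub>N\<^esub> h x"
    using assms(4) linear_mapsD(1)[OF assms(3,4)]
    by (subst linear_mapsD(3)[OF assms(3)]) (auto simp: N.smult_l_minus)
  finally show ?thesis .
qed

lemma linear_maps_minus:
  assumes "module K M" "module K N" "h \<in> linear_maps K M N" "x \<in> carrier M" "y \<in> carrier M"
  shows "h (x \<ominus>\<^bsub>M\<^esub> y) = h x \<ominus>\<^bsub>N\<^esub> h y"
proof -
  interpret M: module K M by fact
  show ?thesis
    using assms by (simp add: a_minus_def linear_mapsD(2)[OF assms(3)] linear_maps_uminus)
qed

lemma linear_maps_finsum:
  assumes "module K M" "module K N" "h \<in> linear_maps K M N" "f \<in> A \<rightarrow> carrier M"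
  shows "h (finsum M f A) = finsum N (\<lambda>i. h (f i)) A"
proof -
  interpret M: module K M by fact
  interpret N: module K N by fact
  note h = linear_mapsD[OF assms(3)]
  show ?thesis using assms(4)
  proof (induction A rule: infinite_finite_induct)
    case (insert a A)
    then have "finsum M f A \<in> carrier M" by (intro M.M.finsum_closed) auto
    moreover have "f a \<in> carrier M" "(\<lambda>i. h (f i)) \<in> A \<rightarrow> carrier N" "h (f a) \<in> carrier N"
      using insert.prems h(1) by auto
    ultimately show ?case using insert by (simp add: h N.M.finsum_insert)
  qed (simp_all add: linear_maps_zero[OF assms(1-3)] M.M.finsum_infinite N.M.finsum_infinite)
qed

lemma linear_maps_vimage_submodule:
  assumes "module K M" "module K N" "h \<in> linear_maps K M N" "submodule S K N"
  shows "submodule {x \<in> carrier M. h x \<in> S} K M"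
proof -
  interpret M: module K M by fact
  interpret N: module K N by fact
  note h = linear_mapsD[OF assms(3)]
  show ?thesis
    by (rule M.submoduleI)
       (auto simp: h linear_maps_zero[OF assms(1-3)] linear_maps_uminus[OF assms(1-3)]
          N.submoduleE[OF assms(4)] intro: N.submoduleE[OF assms(4)]
          subgroup.one_closed[OF submodule.axioms(1)[OF assms(4)], simplified])
qed

lemma linear_maps_kernel_submodule:
  assumes "module K M" "module K N" "h \<in> linear_maps K M N"
  shows "submodule {x \<in> carrier M. h x = \<zero>\<^bsub>N\<^esub>} K M"
proof -
  interpret N: module K N by fact
  have "submodule {\<zero>\<^bsub>N\<^esub>} K N" by (rule N.submoduleI) auto
  from linear_maps_vimage_submodule[OF assms this] show ?thesis by simp
qed

section \<open>Quotients\<close>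

lemma carrier_quotient_module:
  "C \<in> carrier (quotient_module M N) \<longleftrightarrow> (\<exists>x\<in>carrier M. C = N +>\<^bsub>M\<^esub> x)"
  by (auto simp: quotient_module_def A_RCOSETS_def')

lemma a_r_coset_carrier_update [simp]:
  "N +>\<^bsub>M\<lparr>carrier := S\<rparr>\<^esub> x = N +>\<^bsub>M\<^esub> x"
  by (simp add: a_r_coset_def')

lemma submodule_abelian_subgroup:
  assumes "module K M" "submodule N K M"
  shows "abelian_subgroup N M"
proof -
  interpret module K M by fact
  show ?thesis
    by (rule abelian_subgroupI3)
       (use submodule.axioms(1)[OF assms(2)] in \<open>auto intro: additive_subgroup.intro M.abelian_group_axioms\<close>)
qed

lemma coset_mem_iff:
  assumes "module K M" "submodule N K M" "x \<in> carrier M" "y \<in> carrier M"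
  shows "x \<in> N +>\<^bsub>M\<^esub> y \<longleftrightarrow> x \<ominus>\<^bsub>M\<^esub> y \<in> N"
proof -
  interpret abelian_subgroup N M by (rule submodule_abelian_subgroup) fact+
  show ?thesis unfolding a_minus_def using assms by (intro a_rcos_module) auto
qed

lemma coset_eq_iff:
  assumes "module K M" "submodule N K M" "x \<in> carrier M" "y \<in> carrier M"
  shows "N +>\<^bsub>M\<^esub> x = N +>\<^bsub>M\<^esub> y \<longleftrightarrow> x \<ominus>\<^bsub>M\<^esub> y \<in> N"
proof -
  interpret module K M by fact
  interpret abelian_subgroup N M by (rule submodule_abelian_subgroup) fact+
  have "x \<ominus>\<^bsub>M\<^esub> y \<in> N \<longleftrightarrow> x \<in> N +>\<^bsub>M\<^esub> y"
    using coset_mem_iff[OF assms] by simp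
  also have "\<dots> \<longleftrightarrow> N +>\<^bsub>M\<^esub> x = N +>\<^bsub>M\<^esub> y"
    using assms a_rcos_self[of x] a_repr_independence'[of x y] by auto
  finally show ?thesis by simp
qed

lemma quotient_add:
  assumes "module K M" "submodule N K M" "x \<in> carrier M" "y \<in> carrier M"
  shows "(N +>\<^bsub>M\<^esub> x) \<oplus>\<^bsub>quotient_module M N\<^esub> (N +>\<^bsub>M\<^esub> y) = N +>\<^bsub>M\<^esub> (x \<oplus>\<^bsub>M\<^esub> y)"
proof -
  interpret abelian_subgroup N M by (rule submodule_abelian_subgroup) fact+
  show ?thesis using assms by (simp add: quotient_module_def a_rcos_sum)
qed

text \<open>The scalar action on a coset is defined as a union over all its members. All members
  give the same coset because \<open>N\<close> is stable under scalars, so the union is one of a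
  constant family.\<close>

lemma quotient_smult:
  assumes "module K M" "submodule N K M" "a \<in> carrier K" "x \<in> carrier M"
  shows "a \<odot>\<^bsub>quotient_module M N\<^esub> (N +>\<^bsub>M\<^esub> x) = N +>\<^bsub>M\<^esub> (a \<odot>\<^bsub>M\<^esub> x)"
proof -
  interpret module K M by fact
  interpret abelian_subgroup N M by (rule submodule_abelian_subgroup) fact+
  have "N +>\<^bsub>M\<^esub> (a \<odot>\<^bsub>M\<^esub> y) = N +>\<^bsub>M\<^esub> (a \<odot>\<^bsub>M\<^esub> x)" if "y \<in> N +>\<^bsub>M\<^esub> x" for y
  proof -
    from that obtain n where n: "n \<in> N" "y = n \<oplus>\<^bsub>M\<^esub> x" by (auto simp: a_r_coset_def')
    have "n \<in> carrier M" using n by (auto intro: a_Hcarr)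
    then have y: "y \<in> carrier M" "y \<ominus>\<^bsub>M\<^esub> x = n" using n assms
      by (auto simp: a_minus_def M.a_assoc M.r_neg)
    have "a \<odot>\<^bsub>M\<^esub> y \<ominus>\<^bsub>M\<^esub> a \<odot>\<^bsub>M\<^esub> x = a \<odot>\<^bsub>M\<^esub> (y \<ominus>\<^bsub>M\<^esub> x)"
      using y(1) assms by (simp add: a_minus_def smult_r_distr smult_r_minus)
    also have "\<dots> \<in> N" using y n assms by (simp add: submoduleE(4)[OF assms(2)])
    finally show ?thesis using assms y by (subst coset_eq_iff[OF assms(1,2)]) auto
  qed
  moreover have "x \<in> N +>\<^bsub>M\<^esub> x" using assms by (intro a_rcos_self)
  ultimately have "(\<Union>y\<in>N +>\<^bsub>M\<^esub> x. N +>\<^bsub>M\<^esub> (a \<odot>\<^bsub>M\<^esub> y)) = N +>\<^bsub>M\<^esub> (a \<odot>\<^bsub>M\<^esub> x)"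
    by (intro SUP_eq_const) blast+
  then show ?thesis by (simp add: quotient_module_def)
qed

lemma quotient_zero:
  assumes "module K M" "submodule N K M"
  shows "\<zero>\<^bsub>quotient_module M N\<^esub> = N +>\<^bsub>M\<^esub> \<zero>\<^bsub>M\<^esub>"
proof -
  interpret module K M by fact
  show ?thesis using submoduleE(1)[OF assms(2)] by (simp add: quotient_module_def)
qed

lemma module_quotient_module:
  assumes "module K M" "submodule N K M"
  shows "module K (quotient_module M N)"
proof -
  interpret module K M by fact
  note q = quotient_add[OF assms] quotient_smult[OF assms] quotient_zero[OF assms]
  show ?thesis
  proof (intro moduleI abelian_groupI)
    fix C assume "C \<in> carrier (quotient_module M N)"
    then obtain x where x: "x \<in> carrier M" "C = N +>\<^bsub>M\<^esub> x" by (auto simp: carrier_quotient_module)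
    then show "\<exists>D\<in>carrier (quotient_module M N).
        D \<oplus>\<^bsub>quotient_module M N\<^esub> C = \<zero>\<^bsub>quotient_module M N\<^esub>"
      by (intro bexI[where x = "N +>\<^bsub>M\<^esub> (\<ominus>\<^bsub>M\<^esub> x)"])
         (auto simp: q carrier_quotient_module M.l_neg simp del: M.a_coset_add_zero)
  next
    fix C D assume "C \<in> carrier (quotient_module M N)" "D \<in> carrier (quotient_module M N)"
    then show "C \<oplus>\<^bsub>quotient_module M N\<^esub> D = D \<oplus>\<^bsub>quotient_module M N\<^esub> C"
      by (auto simp: q carrier_quotient_module M.a_comm)
  next
    show "\<zero>\<^bsub>quotient_module M N\<^esub> \<in> carrier (quotient_module M N)"
      unfolding carrier_quotient_module q by (auto simp del: M.a_coset_add_zero)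
  qed (auto simp: R.is_cring carrier_quotient_module q M.a_assoc smult_l_distr smult_r_distr
         smult_assoc1 simp del: M.a_coset_add_zero)
qed

text \<open>Since \<open>h\<close> kills \<open>N\<close>, it is constant on each coset. The image
  of a coset is a singleton, and \<open>the_elem\<close> reads off its value without a choice of
  representative.\<close>

lemma quotient_lift:
  assumes "module K M" "submodule N K M" "module K P" "h \<in> linear_maps K M P"
    and ker: "\<And>x. x \<in> N \<Longrightarrow> h x = \<zero>\<^bsub>P\<^esub>"
  obtains g where "g \<in> linear_maps K (quotient_module M N) P"
    and "\<And>x. x \<in> carrier M \<Longrightarrow> g (N +>\<^bsub>M\<^esub> x) = h x"
proof
  interpret M: module K M by fact
  interpret P: module K P by fact
  interpret abelian_subgroup N M by (rule submodule_abelian_subgroup) fact+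
  note h = linear_mapsD[OF assms(4)]
  let ?g = "\<lambda>C. the_elem (h ` C)"
  have g: "?g (N +>\<^bsub>M\<^esub> x) = h x" if x: "x \<in> carrier M" for x
  proof -
    have "h y = h x" if "y \<in> N +>\<^bsub>M\<^esub> x" for y
    proof -
      from that obtain n where n: "n \<in> N" "y = n \<oplus>\<^bsub>M\<^esub> x" by (auto simp: a_r_coset_def')
      with x show ?thesis by (simp add: h(1,2) a_Hcarr ker)
    qed
    moreover have "x \<in> N +>\<^bsub>M\<^esub> x" using x by (intro a_rcos_self)
    ultimately have "h ` (N +>\<^bsub>M\<^esub> x) = {h x}" by blast
    then show ?thesis by simp
  qed
  then show "\<And>x. x \<in> carrier M \<Longrightarrow> ?g (N +>\<^bsub>M\<^esub> x) = h x" .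
  show "?g \<in> linear_maps K (quotient_module M N) P"
    unfolding linear_maps_def
  proof (intro CollectI conjI ballI funcsetI)
    fix C assume "C \<in> carrier (quotient_module M N)"
    then obtain x where x: "x \<in> carrier M" "C = N +>\<^bsub>M\<^esub> x" by (auto simp: carrier_quotient_module)
    then show "?g C \<in> carrier P" by (simp add: g h(1))
    fix a assume "a \<in> carrier K"
    with x show "?g (a \<odot>\<^bsub>quotient_module M N\<^esub> C) = a \<odot>\<^bsub>P\<^esub> ?g C"
      by (simp only: quotient_smult[OF assms(1,2)] g h(3) M.smult_closed)
  next
    fix C D assume "C \<in> carrier (quotient_module M N)" "D \<in> carrier (quotient_module M N)"
    then obtain x y where "x \<in> carrier M" "C = N +>\<^bsub>M\<^esub> x" "y \<in> carrier M" "D = N +>\<^bsub>M\<^esub> y"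
      by (auto simp: carrier_quotient_module)
    then show "?g (C \<oplus>\<^bsub>quotient_module M N\<^esub> D) = ?g C \<oplus>\<^bsub>P\<^esub> ?g D"
      by (simp only: quotient_add[OF assms(1,2)] g h(2) M.M.add.m_closed)
  qed
qed

text \<open>The preimage of the coset of \<open>h x\<close> modulo \<open>Q\<close> is the coset of
  \<open>x\<close> modulo the preimage of \<open>Q\<close>; both conditions on \<open>y\<close> say
  that \<open>h y\<close> and \<open>h x\<close> differ by an element of \<open>Q\<close>. It is
  applied with \<open>M\<close> = Div_Lambda, \<open>P\<close> the divisors of a layer,
  \<open>N\<close> = Div^0 and \<open>Q\<close> = Pr.\<close>

lemma quotient_module_iso_vimage:
  assumes M: "module K M" and P: "module K P" and lin: "h \<in> linear_maps K M P"
    and surj: "carrier P \<subseteq> h ` carrier M"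
    and N: "submodule N K P" and Q: "submodule Q K P" and QN: "Q \<subseteq> N"
  shows "(\<lambda>C. {x \<in> carrier M. h x \<in> C}) \<in> module_iso K
     (quotient_module (P\<lparr>carrier := N\<rparr>) Q)
     (quotient_module (M\<lparr>carrier := {x \<in> carrier M. h x \<in> N}\<rparr>) {x \<in> carrier M. h x \<in> Q})"
    (is "?g \<in> module_iso K ?A (quotient_module ?M' ?Q')")
proof -
  interpret M: module K M by fact
  interpret P: module K P by fact
  note h = linear_mapsD[OF lin]
  let ?N' = "{x \<in> carrier M. h x \<in> N}"
  have N': "submodule ?N' K M" and Q': "submodule ?Q' K M"
    by (intro linear_maps_vimage_submodule[OF M P lin] N Q)+
  have modP: "module K (P\<lparr>carrier := N\<rparr>)" and modM: "module K ?M'"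
    using submodule.submodule_is_module[OF N P] submodule.submodule_is_module[OF N' M] .
  have subQ: "submodule Q K (P\<lparr>carrier := N\<rparr>)"
    by (rule module.module_incl_imp_submodule[OF modP])
       (use QN submodule.submodule_is_module[OF Q P] in auto)
  have subQ': "submodule ?Q' K ?M'"
    by (rule module.module_incl_imp_submodule[OF modM])
       (use QN submodule.submodule_is_module[OF Q' M] in auto)
  have g: "?g (Q +>\<^bsub>P\<^esub> h x) = ?Q' +>\<^bsub>M\<^esub> x" if x: "x \<in> carrier M" for x
  proof -
    have "h y \<in> Q +>\<^bsub>P\<^esub> h x \<longleftrightarrow> y \<in> ?Q' +>\<^bsub>M\<^esub> x" if y: "y \<in> carrier M" for y
    proof -
      have "h y \<in> Q +>\<^bsub>P\<^esub> h x \<longleftrightarrow> h y \<ominus>\<^bsub>P\<^esub> h x \<in> Q"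
        using x y by (intro coset_mem_iff[OF P Q] h)
      also have "\<dots> \<longleftrightarrow> y \<ominus>\<^bsub>M\<^esub> x \<in> ?Q'"
        using M.M.minus_closed[OF y x] linear_maps_minus[OF M P lin y x] by auto
      also have "\<dots> \<longleftrightarrow> y \<in> ?Q' +>\<^bsub>M\<^esub> x"
        using x y by (intro coset_mem_iff[OF M Q', symmetric])
      finally show ?thesis .
    qed
    moreover have "?Q' +>\<^bsub>M\<^esub> x \<subseteq> carrier M"
      using x by (intro M.a_r_coset_subset_G) auto
    ultimately show ?thesis by auto
  qed
  \<comment> \<open>Surjectivity enters here: every coset has a representative of the form
    \<open>h x\<close>, and then \<open>x\<close> lies in the preimage of \<open>N\<close>.\<close>
  have A: "C \<in> carrier ?A \<longleftrightarrow> (\<exists>x\<in>?N'. C = Q +>\<^bsub>P\<^esub> h x)" for C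
  proof -
    have "N \<subseteq> h ` ?N'" using surj P.submoduleE(1)[OF N] by auto
    then show ?thesis by (auto simp: carrier_quotient_module)
  qed
  have hN: "h x \<in> N" if "x \<in> ?N'" for x using that by simp
  have add: "(Q +>\<^bsub>P\<^esub> h x) \<oplus>\<^bsub>?A\<^esub> (Q +>\<^bsub>P\<^esub> h y) = Q +>\<^bsub>P\<^esub> h (x \<oplus>\<^bsub>M\<^esub> y)"
    if "x \<in> ?N'" "y \<in> ?N'" for x y
    using quotient_add[OF modP subQ, of "h x" "h y"] that by (simp add: h)
  have smult: "a \<odot>\<^bsub>?A\<^esub> (Q +>\<^bsub>P\<^esub> h x) = Q +>\<^bsub>P\<^esub> h (a \<odot>\<^bsub>M\<^esub> x)" if "x \<in> ?N'" "a \<in> carrier K" for a x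
    using quotient_smult[OF modP subQ, of a "h x"] that by (simp add: h)
  have inj: "inj_on ?g (carrier ?A)"
  proof (rule inj_onI)
    fix C D assume "C \<in> carrier ?A" "D \<in> carrier ?A" and eq: "?g C = ?g D"
    then obtain x y where x: "x \<in> ?N'" "C = Q +>\<^bsub>P\<^esub> h x" and y: "y \<in> ?N'" "D = Q +>\<^bsub>P\<^esub> h y"
      by (auto simp: A)
    have "?Q' +>\<^bsub>M\<^esub> x = ?Q' +>\<^bsub>M\<^esub> y" using eq x y g by simp
    then have "x \<ominus>\<^bsub>M\<^esub> y \<in> ?Q'" using x y by (subst (asm) coset_eq_iff[OF M Q']) auto
    then show "C = D" using x y
      using linear_maps_minus[OF M P lin, of x y] by (simp add: coset_eq_iff[OF P Q] h(1))
  qed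
  have img: "?g ` carrier ?A = carrier (quotient_module ?M' ?Q')"
  proof -
    have "carrier ?A = (\<lambda>x. Q +>\<^bsub>P\<^esub> h x) ` ?N'" using A by blast
    then have "?g ` carrier ?A = (\<lambda>x. ?g (Q +>\<^bsub>P\<^esub> h x)) ` ?N'"
      by (simp only: image_image)
    also have "\<dots> = (\<lambda>x. ?Q' +>\<^bsub>M\<^esub> x) ` ?N'"
      by (intro image_cong refl g) auto
    also have "\<dots> = carrier (quotient_module ?M' ?Q')"
      by (auto simp: carrier_quotient_module)
    finally show ?thesis .
  qed
  have clA: "x \<oplus>\<^bsub>M\<^esub> y \<in> ?N'" if "x \<in> ?N'" "y \<in> ?N'" for x y
    using M.submoduleE(5)[OF N'] that .
  have clS: "a \<odot>\<^bsub>M\<^esub> x \<in> ?N'" if "a \<in> carrier K" "x \<in> ?N'" for a x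
    using M.submoduleE(4)[OF N'] that .
  show ?thesis
    unfolding module_iso_def
  proof (intro CollectI conjI isoI homI ballI)
    show "bij_betw ?g (carrier (add_monoid ?A)) (carrier (add_monoid (quotient_module ?M' ?Q')))"
      using inj img by (simp add: bij_betw_def)
    fix C assume C: "C \<in> carrier (add_monoid ?A)"
    then show "?g C \<in> carrier (add_monoid (quotient_module ?M' ?Q'))" using img by auto
    fix D assume D: "D \<in> carrier (add_monoid ?A)"
    obtain x y where x: "x \<in> ?N'" "C = Q +>\<^bsub>P\<^esub> h x" and y: "y \<in> ?N'" "D = Q +>\<^bsub>P\<^esub> h y"
      using C D by (auto simp: A)
    have "?g (C \<oplus>\<^bsub>?A\<^esub> D) = ?Q' +>\<^bsub>M\<^esub> (x \<oplus>\<^bsub>M\<^esub> y)"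
      unfolding x(2) y(2) add[OF x(1) y(1)] using x y by (intro g) auto
    also have "\<dots> = ?g C \<oplus>\<^bsub>quotient_module ?M' ?Q'\<^esub> ?g D"
      using quotient_add[OF modM subQ', of x y] x y by (simp add: g)
    finally show "?g (C \<otimes>\<^bsub>add_monoid ?A\<^esub> D) =
        ?g C \<otimes>\<^bsub>add_monoid (quotient_module ?M' ?Q')\<^esub> ?g D" by simp
  next
    fix a C assume a: "a \<in> carrier K" and C: "C \<in> carrier ?A"
    obtain x where x: "x \<in> ?N'" "C = Q +>\<^bsub>P\<^esub> h x"
      using C by (auto simp: A)
    have "?g (a \<odot>\<^bsub>?A\<^esub> C) = ?Q' +>\<^bsub>M\<^esub> (a \<odot>\<^bsub>M\<^esub> x)"
      unfolding x(2) smult[OF x(1) a] using x a by (intro g) auto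
    also have "\<dots> = a \<odot>\<^bsub>quotient_module ?M' ?Q'\<^esub> ?g C"
      using quotient_smult[OF modM subQ', of a x] x a by (simp add: g)
    finally show "?g (a \<odot>\<^bsub>?A\<^esub> C) = a \<odot>\<^bsub>quotient_module ?M' ?Q'\<^esub> ?g C" .
  qed
qed

section \<open>Extension of scalars\<close>

context
  fixes R :: "('r, 's) ring_scheme" and L :: "('c, 't) ring_scheme" and f :: "'r \<Rightarrow> 'c"
    and M :: "('r, 'b) module"
  assumes M: "module R M" and L: "cring L" and f: "f \<in> carrier R \<rightarrow> carrier L"
begin

interpretation M: module R M by (rule M)
interpretation L: cring L by (rule L)
interpretation F: module L "free_module L (carrier M)" by (rule L.module_free_module)

private abbreviation "F \<equiv> free_module L (carrier M)"
private abbreviation "rels \<equiv> base_change_rels R L f M"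

lemma base_change_rels_submodule: "submodule rels L F"
  unfolding base_change_rels_def Let_def using f
  by (intro mod_span_submodule L.module_free_module)
     (auto intro!: F.M.minus_closed L.free_module_single F.M.add.m_closed F.smult_closed
       simp del: free_module_simps)

lemma module_base_change: "module L (base_change R L f M)"
  unfolding base_change_def
  by (intro module_quotient_module L.module_free_module base_change_rels_submodule)

lemma tensor_one_closed: "x \<in> carrier M \<Longrightarrow> tensor_one R L f M x \<in> carrier (base_change R L f M)"
  by (auto simp: base_change_def carrier_quotient_module tensor_one_def intro!: L.free_module_single)

lemma tensor_one_add:
  assumes "x \<in> carrier M" "y \<in> carrier M"
  shows "tensor_one R L f M (x \<oplus>\<^bsub>M\<^esub> y) =
    tensor_one R L f M x \<oplus>\<^bsub>base_change R L f M\<^esub> tensor_one R L f M y"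
proof -
  have "single L (x \<oplus>\<^bsub>M\<^esub> y) \<ominus>\<^bsub>F\<^esub> (single L x \<oplus>\<^bsub>F\<^esub> single L y) \<in> rels"
    unfolding base_change_rels_def Let_def
    by (rule subsetD[OF mod_span_superset]) (use assms in blast)
  then show ?thesis
    unfolding tensor_one_def base_change_def
    using assms
    by (subst quotient_add[OF L.module_free_module base_change_rels_submodule])
       (auto simp: coset_eq_iff[OF L.module_free_module base_change_rels_submodule]
         L.free_module_single F.M.add.m_closed simp del: free_module_simps)
qed

lemma tensor_one_smult:
  assumes "r \<in> carrier R" "x \<in> carrier M"
  shows "tensor_one R L f M (r \<odot>\<^bsub>M\<^esub> x) = f r \<odot>\<^bsub>base_change R L f M\<^esub> tensor_one R L f M x"
proof -
  have "single L (r \<odot>\<^bsub>M\<^esub> x) \<ominus>\<^bsub>F\<^esub> (f r \<odot>\<^bsub>F\<^esub> single L x) \<in> rels"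
    unfolding base_change_rels_def Let_def
    by (rule subsetD[OF mod_span_superset]) (use assms in blast)
  then show ?thesis
    unfolding tensor_one_def base_change_def
    using assms f
    by (subst quotient_smult[OF L.module_free_module base_change_rels_submodule])
       (auto simp: coset_eq_iff[OF L.module_free_module base_change_rels_submodule] Pi_iff
         L.free_module_single F.smult_closed simp del: free_module_simps)
qed

text \<open>Every element is the coset of a finite \<open>L\<close>-combination of symbols, so
  induction on the support of that combination reduces the claim to the symbols themselves.\<close>

lemma base_change_generated:
  assumes S: "submodule S L (base_change R L f M)"
    and "\<And>x. x \<in> carrier M \<Longrightarrow> tensor_one R L f M x \<in> S"
  shows "carrier (base_change R L f M) = S"
proof
  interpret B: module L "base_change R L f M" by (rule module_base_change)
  show "S \<subseteq> carrier (base_change R L f M)" by (rule B.submoduleE(1)[OF S])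
  show "carrier (base_change R L f M) \<subseteq> S"
  proof
    fix C assume "C \<in> carrier (base_change R L f M)"
    then obtain g where g: "g \<in> carrier F" "C = rels +>\<^bsub>F\<^esub> g"
      by (auto simp: base_change_def carrier_quotient_module)
    note q = quotient_add[OF L.module_free_module base_change_rels_submodule, folded base_change_def]
      quotient_smult[OF L.module_free_module base_change_rels_submodule, folded base_change_def]
      quotient_zero[OF L.module_free_module base_change_rels_submodule, folded base_change_def]
    from g(1) have "rels +>\<^bsub>F\<^esub> g \<in> S"
    proof (induction rule: L.free_module_induct)
      case zero
      have "\<zero>\<^bsub>base_change R L f M\<^esub> \<in> S"
        using subgroup.one_closed[OF submodule.axioms(1)[OF S]] by simp
      then show ?case unfolding q by simp
    next
      case (add g h)
      then show ?case using q(1)[of g h] B.submoduleE(5)[OF S, of "rels +>\<^bsub>F\<^esub> g" "rels +>\<^bsub>F\<^esub> h"] by simp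
    next
      case (single a x)
      then show ?case
        using q(2)[of a "single L x"] B.submoduleE(4)[OF S, of a "tensor_one R L f M x"] assms(2)
        by (simp add: tensor_one_def L.free_module_single)
    qed
    then show "C \<in> S" using g by simp
  qed
qed

text \<open>The universal property of extension of scalars: a map that is linear along
  \<open>f\<close> extends \<open>L\<close>-linearly to formal combinations of symbols and kills the
  defining relations.\<close>

lemma base_change_lift:
  assumes N: "module L N" and h: "h \<in> carrier M \<rightarrow> carrier N"
    and add: "\<And>x y. x \<in> carrier M \<Longrightarrow> y \<in> carrier M \<Longrightarrow> h (x \<oplus>\<^bsub>M\<^esub> y) = h x \<oplus>\<^bsub>N\<^esub> h y"
    and smult: "\<And>r x. r \<in> carrier R \<Longrightarrow> x \<in> carrier M \<Longrightarrow> h (r \<odot>\<^bsub>M\<^esub> x) = f r \<odot>\<^bsub>N\<^esub> h x"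
  obtains g where "g \<in> linear_maps L (base_change R L f M) N"
    and "\<And>x. x \<in> carrier M \<Longrightarrow> g (tensor_one R L f M x) = h x"
proof -
  interpret N: module L N by fact
  let ?h = "\<lambda>c. lin_comb L N c h"
  have lin: "?h \<in> linear_maps L F N" using h by (rule N.lin_comb_linear)
  note hD = linear_mapsD[OF lin]
  have hc: "h x \<in> carrier N" if "x \<in> carrier M" for x using that h by auto
  have hs: "?h (single L x) = h x" if "x \<in> carrier M" for x
    using that by (rule N.lin_comb_single[OF _ h])
  have fc: "f r \<in> carrier L" if "r \<in> carrier R" for r using that f by auto
  note clF = L.free_module_single F.M.add.m_closed F.smult_closed
  \<comment> \<open>The kernel of the extension is a submodule, so only the two families of
    generating relations have to be checked.\<close>
  have "rels \<subseteq> {c \<in> carrier F. ?h c = \<zero>\<^bsub>N\<^esub>}"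
    unfolding base_change_rels_def Let_def
  proof (rule mod_span_minimal[OF linear_maps_kernel_submodule[OF L.module_free_module N lin]],
      intro Un_least subsetI; elim CollectE exE conjE; hypsubst)
    fix x y assume xy: "x \<in> carrier M" "y \<in> carrier M"
    then show "single L (x \<oplus>\<^bsub>M\<^esub> y) \<ominus>\<^bsub>F\<^esub> (single L x \<oplus>\<^bsub>F\<^esub> single L y) \<in> {c \<in> carrier F. ?h c = \<zero>\<^bsub>N\<^esub>}"
      by (simp add: linear_maps_minus[OF L.module_free_module N lin] hD hs clF add hc N.M.r_neg
          a_minus_def[of N] del: free_module_simps)
  next
    fix r x assume rx: "r \<in> carrier R" "x \<in> carrier M"
    then show "single L (r \<odot>\<^bsub>M\<^esub> x) \<ominus>\<^bsub>F\<^esub> f r \<odot>\<^bsub>F\<^esub> single L x \<in> {c \<in> carrier F. ?h c = \<zero>\<^bsub>N\<^esub>}"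
      by (simp add: linear_maps_minus[OF L.module_free_module N lin] hD hs clF fc smult hc N.M.r_neg
          a_minus_def[of N] del: free_module_simps)
  qed
  then have "\<And>c. c \<in> rels \<Longrightarrow> ?h c = \<zero>\<^bsub>N\<^esub>" by auto
  from quotient_lift[OF L.module_free_module base_change_rels_submodule N lin this]
  obtain g where "g \<in> linear_maps L (base_change R L f M) N"
    and "\<And>c. c \<in> carrier F \<Longrightarrow> g (rels +>\<^bsub>F\<^esub> c) = ?h c"
    by (auto simp: base_change_def)
  with that[of g] show thesis
    by (simp add: tensor_one_def hs L.free_module_single)
qed

end

section \<open>Convolution\<close>

text \<open>Pushforward of finitely supported measures. Maps between group rings, reduction of
  divisors to a layer and translation by a group element are all of this kind.\<close>

definition pushforward ::
    "('a, 'r) ring_scheme \<Rightarrow> 'c set \<Rightarrow> ('b \<Rightarrow> 'c) \<Rightarrow> ('b \<Rightarrow> 'a) \<Rightarrow> ('c \<Rightarrow> 'a)" where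
  "pushforward K C \<phi> f = lin_comb K (free_module K C) f (\<lambda>b. single K (\<phi> b))"

text \<open>The product of a group ring and the action of a group ring on divisors are both instances.\<close>

definition convolution ::
    "('a, 'r) ring_scheme \<Rightarrow> 'b set \<Rightarrow> ('g \<Rightarrow> 'b \<Rightarrow> 'b) \<Rightarrow> ('g \<Rightarrow> 'a) \<Rightarrow> ('b \<Rightarrow> 'a) \<Rightarrow> ('b \<Rightarrow> 'a)" where
  "convolution K B act r d = lin_comb K (free_module K B) r (\<lambda>g. pushforward K B (act g) d)"

lemma linear_maps_compose:
  "f \<in> linear_maps K M N \<Longrightarrow> g \<in> linear_maps K N P \<Longrightarrow> (\<lambda>x. g (f x)) \<in> linear_maps K M P"
  by (auto simp: linear_maps_def Pi_iff)

context cring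
begin

text \<open>The reduction to basis vectors on which most identities for pushforwards, convolutions
  and coefficient sums rest.\<close>

lemma linear_maps_eqI:
  assumes "f \<in> linear_maps R (free_module R B) N" "g \<in> linear_maps R (free_module R B) N"
    and N: "module R N" and "\<And>b. b \<in> B \<Longrightarrow> f (single R b) = g (single R b)"
    and "x \<in> carrier (free_module R B)"
  shows "f x = g x"
  using assms(5)
proof (induction rule: free_module_induct)
  case zero
  then show ?case
    using linear_maps_zero[OF module_free_module N assms(1)] linear_maps_zero[OF module_free_module N assms(2)]
    by simp
next
  case (add x y)
  then show ?case
    using linear_mapsD(2)[OF assms(1), of x y] linear_mapsD(2)[OF assms(2), of x y] by simp
next
  case (single a b)
  then show ?case
    using linear_mapsD(3)[OF assms(1), of a "single R b"] linear_mapsD(3)[OF assms(2), of a "single R b"]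
    by (simp add: assms(4) free_module_single)
qed

lemma evaluation_linear: "(\<lambda>f. f b) \<in> linear_maps R (free_module R B) (self_module R)"
  by (auto simp: linear_maps_def free_module_closed)

text \<open>Evaluation at a point is linear. This translates combinations of functions into the
  pointwise sums by which the group ring product and \<open>divisor_action\<close> are
  defined.\<close>

lemma lin_comb_apply:
  assumes f: "f \<in> carrier (free_module R B)" and F: "F \<in> B \<rightarrow> carrier (free_module R C)"
  shows "lin_comb R (free_module R C) f F c = lin_comb R (self_module R) f (\<lambda>b. F b c)"
proof -
  interpret F: module R "free_module R C" by (rule module_free_module)
  interpret S: module R "self_module R" by (rule module_self_module[OF is_cring])
  have "(\<lambda>b. F b c) \<in> B \<rightarrow> carrier (self_module R)"
    using free_module_closed[OF funcset_mem[OF F]] by auto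
  note F' = this
  have "(\<lambda>f. lin_comb R (free_module R C) f F c) \<in> linear_maps R (free_module R B) (self_module R)"
    by (rule linear_maps_compose[OF F.lin_comb_linear[OF F] evaluation_linear])
  then show ?thesis
    by (rule linear_maps_eqI[OF _ S.lin_comb_linear[OF F'] module_self_module[OF is_cring] _ f])
       (simp add: F.lin_comb_single[OF _ F] S.lin_comb_single[OF _ F'])
qed

lemma pushforward_linear:
  assumes "\<phi> \<in> B \<rightarrow> C"
  shows "pushforward R C \<phi> \<in> linear_maps R (free_module R B) (free_module R C)"
proof -
  interpret F: module R "free_module R C" by (rule module_free_module)
  have "(\<lambda>b. single R (\<phi> b)) \<in> B \<rightarrow> carrier (free_module R C)"
    using assms by (auto intro!: free_module_single)
  from F.lin_comb_linear[OF this] show ?thesis unfolding pushforward_def .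
qed

lemma pushforward_single:
  assumes "\<phi> \<in> B \<rightarrow> C" "b \<in> B"
  shows "pushforward R C \<phi> (single R b) = single R (\<phi> b)"
proof -
  interpret F: module R "free_module R C" by (rule module_free_module)
  have "(\<lambda>b. single R (\<phi> b)) \<in> B \<rightarrow> carrier (free_module R C)"
    using assms by (auto intro!: free_module_single)
  from F.lin_comb_single[OF assms(2) this] show ?thesis unfolding pushforward_def .
qed

lemma pushforward_closed:
  "\<phi> \<in> B \<rightarrow> C \<Longrightarrow> f \<in> carrier (free_module R B) \<Longrightarrow> pushforward R C \<phi> f \<in> carrier (free_module R C)"
  by (rule linear_mapsD(1)[OF pushforward_linear])

lemma pushforward_compose:
  assumes "\<phi> \<in> B \<rightarrow> C" "\<psi> \<in> C \<rightarrow> D" "f \<in> carrier (free_module R B)"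
  shows "pushforward R D \<psi> (pushforward R C \<phi> f) = pushforward R D (\<lambda>x. \<psi> (\<phi> x)) f"
proof (rule linear_maps_eqI[OF _ _ module_free_module _ assms(3)])
  show "(\<lambda>f. pushforward R D \<psi> (pushforward R C \<phi> f)) \<in> linear_maps R (free_module R B) (free_module R D)"
    by (rule linear_maps_compose[OF pushforward_linear[OF assms(1)] pushforward_linear[OF assms(2)]])
  show "pushforward R D (\<lambda>x. \<psi> (\<phi> x)) \<in> linear_maps R (free_module R B) (free_module R D)"
    using assms by (intro pushforward_linear) auto
next
  fix b assume "b \<in> B"
  then show "pushforward R D \<psi> (pushforward R C \<phi> (single R b)) = pushforward R D (\<lambda>x. \<psi> (\<phi> x)) (single R b)"
    using funcset_mem[OF assms(1)] pushforward_single[of "\<lambda>x. \<psi> (\<phi> x)" B D b] assms(1,2)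
    by (simp add: pushforward_single[OF assms(1)] pushforward_single[OF assms(2)] Pi_iff)
qed

lemma pushforward_cong:
  assumes "\<phi> \<in> B \<rightarrow> C" "\<And>b. b \<in> B \<Longrightarrow> \<phi> b = \<psi> b" "f \<in> carrier (free_module R B)"
  shows "pushforward R C \<phi> f = pushforward R C \<psi> f"
proof -
  interpret F: module R "free_module R C" by (rule module_free_module)
  show ?thesis unfolding pushforward_def
    by (rule F.lin_comb_cong[OF assms(3)]) (use assms in \<open>auto intro!: free_module_single simp: Pi_iff\<close>)
qed

lemma pushforward_id:
  assumes "\<And>b. b \<in> B \<Longrightarrow> \<phi> b = b" "f \<in> carrier (free_module R B)"
  shows "pushforward R B \<phi> f = f"
proof (rule linear_maps_eqI[OF _ _ module_free_module _ assms(2), where g = "\<lambda>x. x"])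
  show "pushforward R B \<phi> \<in> linear_maps R (free_module R B) (free_module R B)"
    using assms by (intro pushforward_linear) auto
qed (use assms in \<open>auto simp: linear_maps_def pushforward_single[of _ B B]\<close>)

lemma pushforward_apply:
  assumes "\<phi> \<in> B \<rightarrow> C" "f \<in> carrier (free_module R B)"
  shows "pushforward R C \<phi> f c = (\<Oplus>b\<in>{b. f b \<noteq> \<zero> \<and> \<phi> b = c}. f b)"
proof -
  have "(\<lambda>b. single R (\<phi> b)) \<in> B \<rightarrow> carrier (free_module R C)"
    using assms by (auto intro!: free_module_single)
  then have "pushforward R C \<phi> f c = (\<Oplus>b\<in>{b. f b \<noteq> \<zero>}. f b \<otimes> single R (\<phi> b) c)"
    unfolding pushforward_def using assms by (simp add: lin_comb_apply lin_comb_def[of _ "self_module R"])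
  also have "\<dots> = (\<Oplus>b\<in>{b. f b \<noteq> \<zero> \<and> \<phi> b = c}. f b)"
    using assms
    by (intro add.finprod_mono_neutral_cong_right)
       (auto simp: free_module_carrier single_def free_module_closed[OF assms(2)])
  finally show ?thesis .
qed

text \<open>For translation by \<open>y\<close> the inverse map is translation by the inverse of
  \<open>y\<close>; this accounts for the inverses in the formulas for the group ring product and
  \<open>divisor_action\<close>.\<close>

lemma pushforward_bij_apply:
  assumes "\<phi> \<in> B \<rightarrow> C" "\<psi> \<in> C \<rightarrow> B" "f \<in> carrier (free_module R B)"
    and "\<And>b. b \<in> B \<Longrightarrow> \<psi> (\<phi> b) = b" "\<And>c. c \<in> C \<Longrightarrow> \<phi> (\<psi> c) = c" "c \<in> C"
  shows "pushforward R C \<phi> f c = f (\<psi> c)"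
proof (rule linear_maps_eqI[OF _ _ module_self_module[OF is_cring] _ assms(3)])
  show "(\<lambda>f. pushforward R C \<phi> f c) \<in> linear_maps R (free_module R B) (self_module R)"
    by (rule linear_maps_compose[OF pushforward_linear evaluation_linear]) fact
  show "(\<lambda>f. f (\<psi> c)) \<in> linear_maps R (free_module R B) (self_module R)"
    by (rule evaluation_linear)
  fix b assume "b \<in> B"
  then show "pushforward R C \<phi> (single R b) c = single R b (\<psi> c)"
    using assms pushforward_single[OF assms(1) \<open>b \<in> B\<close>]
    by (simp add: single_def[of R "\<phi> b"] single_def[of R b]) auto
qed

lemma convolution_linear_left:
  assumes "\<And>g. g \<in> G \<Longrightarrow> act g \<in> B \<rightarrow> B" "d \<in> carrier (free_module R B)"
  shows "(\<lambda>r. convolution R B act r d) \<in> linear_maps R (free_module R G) (free_module R B)"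
proof -
  interpret F: module R "free_module R B" by (rule module_free_module)
  show ?thesis unfolding convolution_def
    by (rule F.lin_comb_linear) (use assms in \<open>auto intro!: pushforward_closed[OF _ assms(2)]\<close>)
qed

lemma convolution_closed:
  assumes "\<And>g. g \<in> G \<Longrightarrow> act g \<in> B \<rightarrow> B" "r \<in> carrier (free_module R G)" "d \<in> carrier (free_module R B)"
  shows "convolution R B act r d \<in> carrier (free_module R B)"
  using linear_mapsD(1)[OF convolution_linear_left] assms by blast

lemma convolution_linear_right:
  assumes "\<And>g. g \<in> G \<Longrightarrow> act g \<in> B \<rightarrow> B" "r \<in> carrier (free_module R G)"
  shows "convolution R B act r \<in> linear_maps R (free_module R B) (free_module R B)"
proof -
  interpret F: module R "free_module R B" by (rule module_free_module)
  have p: "(\<lambda>g. pushforward R B (act g) d) \<in> G \<rightarrow> carrier (free_module R B)"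
    if "d \<in> carrier (free_module R B)" for d
    using assms by (auto intro!: pushforward_closed[OF _ that])
  show ?thesis
    unfolding linear_maps_def
  proof (intro CollectI conjI ballI funcsetI)
    show "\<And>d. d \<in> carrier (free_module R B) \<Longrightarrow> convolution R B act r d \<in> carrier (free_module R B)"
      by (rule convolution_closed) (use assms in auto)
  next
    fix x y assume xy: "x \<in> carrier (free_module R B)" "y \<in> carrier (free_module R B)"
    have "convolution R B act r (x \<oplus>\<^bsub>free_module R B\<^esub> y) = lin_comb R (free_module R B) r
      (\<lambda>g. pushforward R B (act g) x \<oplus>\<^bsub>free_module R B\<^esub> pushforward R B (act g) y)"
      unfolding convolution_def
    proof (rule F.lin_comb_cong[OF assms(2)])
      show "(\<lambda>g. pushforward R B (act g) x \<oplus>\<^bsub>free_module R B\<^esub> pushforward R B (act g) y)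
          \<in> G \<rightarrow> carrier (free_module R B)"
        using p[OF xy(1)] p[OF xy(2)] F.M.add.m_closed by (auto simp: Pi_iff simp del: free_module_simps)
    qed (use xy assms in \<open>intro linear_mapsD(2)[OF pushforward_linear]; auto\<close>)
    then show "convolution R B act r (x \<oplus>\<^bsub>free_module R B\<^esub> y) =
        convolution R B act r x \<oplus>\<^bsub>free_module R B\<^esub> convolution R B act r y"
      unfolding convolution_def by (simp only: F.lin_comb_add_right[OF assms(2) p[OF xy(1)] p[OF xy(2)]])
  next
    fix a x assume ax: "a \<in> carrier R" "x \<in> carrier (free_module R B)"
    have "convolution R B act r (a \<odot>\<^bsub>free_module R B\<^esub> x) = lin_comb R (free_module R B) r
      (\<lambda>g. a \<odot>\<^bsub>free_module R B\<^esub> pushforward R B (act g) x)"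
      unfolding convolution_def
    proof (rule F.lin_comb_cong[OF assms(2)])
      show "(\<lambda>g. a \<odot>\<^bsub>free_module R B\<^esub> pushforward R B (act g) x) \<in> G \<rightarrow> carrier (free_module R B)"
        using p[OF ax(2)] F.smult_closed[OF ax(1)] by (auto simp: Pi_iff simp del: free_module_simps)
    qed (use ax assms in \<open>intro linear_mapsD(3)[OF pushforward_linear]; auto\<close>)
    then show "convolution R B act r (a \<odot>\<^bsub>free_module R B\<^esub> x) = a \<odot>\<^bsub>free_module R B\<^esub> convolution R B act r x"
      unfolding convolution_def by (simp only: F.lin_comb_smult_right[OF assms(2) p[OF ax(2)] ax(1)])
  qed
qed

lemma convolution_single_left:
  assumes "\<And>g. g \<in> G \<Longrightarrow> act g \<in> B \<rightarrow> B" "g \<in> G" "d \<in> carrier (free_module R B)"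
  shows "convolution R B act (single R g) d = pushforward R B (act g) d"
proof -
  interpret F: module R "free_module R B" by (rule module_free_module)
  show ?thesis unfolding convolution_def
    by (rule F.lin_comb_single[OF assms(2)]) (use assms in \<open>auto intro!: pushforward_closed[OF _ assms(3)]\<close>)
qed

lemma convolution_single:
  assumes "\<And>g. g \<in> G \<Longrightarrow> act g \<in> B \<rightarrow> B" "g \<in> G" "b \<in> B"
  shows "convolution R B act (single R g) (single R b) = single R (act g b)"
  using assms
  by (simp add: convolution_single_left[OF assms(1,2)] free_module_single pushforward_single[of _ B])

text \<open>On basis vectors the claim is the equivariance hypothesis \<open>eq\<close>; linearity
  first in \<open>d\<close> and then in \<open>r\<close> does the rest. It yields both ring
  homomorphisms between group rings and the compatibility of the actions on X_infinity and on its
  layers.\<close>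

lemma convolution_pushforward:
  assumes actB: "\<And>g. g \<in> G \<Longrightarrow> act g \<in> B \<rightarrow> B" and actC: "\<And>h. h \<in> H \<Longrightarrow> act' h \<in> C \<rightarrow> C"
    and \<phi>: "\<phi> \<in> G \<rightarrow> H" and \<psi>: "\<psi> \<in> B \<rightarrow> C"
    and eq: "\<And>g b. g \<in> G \<Longrightarrow> b \<in> B \<Longrightarrow> \<psi> (act g b) = act' (\<phi> g) (\<psi> b)"
    and r: "r \<in> carrier (free_module R G)" and d: "d \<in> carrier (free_module R B)"
  shows "pushforward R C \<psi> (convolution R B act r d) =
         convolution R C act' (pushforward R H \<phi> r) (pushforward R C \<psi> d)"
proof -
  have "pushforward R C \<psi> (convolution R B act (single R g) d) =
      convolution R C act' (pushforward R H \<phi> (single R g)) (pushforward R C \<psi> d)" if g: "g \<in> G" for g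
  proof (rule linear_maps_eqI[OF _ _ module_free_module _ d])
    show "(\<lambda>d. pushforward R C \<psi> (convolution R B act (single R g) d))
        \<in> linear_maps R (free_module R B) (free_module R C)"
      by (rule linear_maps_compose[OF convolution_linear_right[OF actB free_module_single[OF g]]
            pushforward_linear[OF \<psi>]])
    show "(\<lambda>d. convolution R C act' (pushforward R H \<phi> (single R g)) (pushforward R C \<psi> d))
        \<in> linear_maps R (free_module R B) (free_module R C)"
      by (rule linear_maps_compose[OF pushforward_linear[OF \<psi>]
            convolution_linear_right[OF actC pushforward_closed[OF \<phi> free_module_single[OF g]]]])
    fix b assume b: "b \<in> B"
    have "\<phi> g \<in> H" "\<psi> b \<in> C" "act g b \<in> B" using g b \<phi> \<psi> actB by auto
    with g b show "pushforward R C \<psi> (convolution R B act (single R g) (single R b)) =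
         convolution R C act' (pushforward R H \<phi> (single R g)) (pushforward R C \<psi> (single R b))"
      by (simp add: convolution_single[OF actB] convolution_single[OF actC] pushforward_single[OF \<phi>]
           pushforward_single[OF \<psi>] eq)
  qed
  then show ?thesis
    by (intro linear_maps_eqI[OF linear_maps_compose[OF convolution_linear_left pushforward_linear]
          linear_maps_compose[OF pushforward_linear convolution_linear_left] module_free_module _ r]
          actB actC d \<phi> \<psi> pushforward_closed[OF \<psi> d])
qed

text \<open>With \<open>act\<close> equal to \<open>op\<close> this is associativity of the group
  ring, in general it is the module law for a permutation action.\<close>

lemma convolution_assoc:
  assumes act: "\<And>g. g \<in> G \<Longrightarrow> act g \<in> B \<rightarrow> B" and op: "\<And>g. g \<in> G \<Longrightarrow> op g \<in> G \<rightarrow> G"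
    and eq: "\<And>g h b. g \<in> G \<Longrightarrow> h \<in> G \<Longrightarrow> b \<in> B \<Longrightarrow> act (op g h) b = act g (act h b)"
    and r: "r \<in> carrier (free_module R G)" and s: "s \<in> carrier (free_module R G)"
    and d: "d \<in> carrier (free_module R B)"
  shows "convolution R B act (convolution R G op r s) d =
         convolution R B act r (convolution R B act s d)"
proof -
  have "convolution R B act (convolution R G op (single R g) s) d =
         convolution R B act (single R g) (convolution R B act s d)" if g: "g \<in> G" for g
  proof -
    have gg: "act g \<in> B \<rightarrow> B" "op g \<in> G \<rightarrow> G" using act op g by auto
    have "convolution R B act (pushforward R G (op g) s) d =
      pushforward R B (act g) (convolution R B act s d)"
    proof (rule linear_maps_eqI[OF _ _ module_free_module _ s])
      show "(\<lambda>s. convolution R B act (pushforward R G (op g) s) d) \<in> linear_maps R (free_module R G) (free_module R B)"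
        by (intro linear_maps_compose[OF pushforward_linear convolution_linear_left] gg act d)
      show "(\<lambda>s. pushforward R B (act g) (convolution R B act s d)) \<in> linear_maps R (free_module R G) (free_module R B)"
        by (intro linear_maps_compose[OF convolution_linear_left pushforward_linear] gg act d)
      fix h assume h: "h \<in> G"
      then have "op g h \<in> G" using gg by auto
      then show "convolution R B act (pushforward R G (op g) (single R h)) d =
        pushforward R B (act g) (convolution R B act (single R h) d)"
        using h d g gg act[OF h]
        by (simp add: pushforward_single[OF gg(2)] convolution_single_left[OF act]
              pushforward_compose[OF act[OF h] gg(1) d])
           (rule pushforward_cong, use eq act in auto)
    qed
    then show ?thesis
      using g s d by (simp add: convolution_single_left[OF act] convolution_single_left[OF op]
            convolution_closed[OF act])
  qed
  then show ?thesis
    by (intro linear_maps_eqI[OF linear_maps_compose[OF convolution_linear_left convolution_linear_left]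
        convolution_linear_left module_free_module _ r] act op d s convolution_closed[OF act s d])
qed

lemma convolution_one:
  assumes "\<And>g. g \<in> G \<Longrightarrow> act g \<in> B \<rightarrow> B" "e \<in> G" "\<And>b. b \<in> B \<Longrightarrow> act e b = b"
    "d \<in> carrier (free_module R B)"
  shows "convolution R B act (single R e) d = d"
  using assms by (simp add: convolution_single_left[OF assms(1,2)] pushforward_id)

lemma convolution_commute:
  assumes op: "\<And>g. g \<in> G \<Longrightarrow> op g \<in> G \<rightarrow> G"
    and eq: "\<And>g h. g \<in> G \<Longrightarrow> h \<in> G \<Longrightarrow> op g h = op h g"
    and r: "r \<in> carrier (free_module R G)" and s: "s \<in> carrier (free_module R G)"
  shows "convolution R G op r s = convolution R G op s r"
proof -
  have *: "convolution R G op (single R g) s = convolution R G op s (single R g)" if g: "g \<in> G" for g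
    using g
    by (intro linear_maps_eqI[OF convolution_linear_right convolution_linear_left module_free_module _ s])
       (auto intro!: op free_module_single simp: convolution_single[OF op] eq)
  show ?thesis
    by (rule linear_maps_eqI[OF convolution_linear_left[OF op s] convolution_linear_right[OF op s]
          module_free_module * r])
qed

end

section \<open>Group rings\<close>

lemma group_ring_simps [simp]:
  "carrier (group_ring K G) = carrier (free_module K (carrier G))"
  "zero (group_ring K G) = (\<lambda>_. \<zero>\<^bsub>K\<^esub>)"
  "add (group_ring K G) = (\<lambda>f f' x. f x \<oplus>\<^bsub>K\<^esub> f' x)"
  "one (group_ring K G) = single K \<one>\<^bsub>G\<^esub>"
  by (simp_all add: group_ring_def)

locale group_ring_setup = K: cring K + G: comm_group G
  for K :: "('a, 'r) ring_scheme" and G :: "('g, 'm) monoid_scheme"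
begin

lemma mult_funcset: "g \<in> carrier G \<Longrightarrow> (\<otimes>\<^bsub>G\<^esub>) g \<in> carrier G \<rightarrow> carrier G"
  by auto

lemma translation_apply:
  assumes "f \<in> carrier (free_module K (carrier G))" "y \<in> carrier G" "x \<in> carrier G"
  shows "pushforward K (carrier G) ((\<otimes>\<^bsub>G\<^esub>) y) f x = f (inv\<^bsub>G\<^esub> y \<otimes>\<^bsub>G\<^esub> x)"
  using assms by (intro K.pushforward_bij_apply) (auto simp: G.m_assoc[symmetric])

text \<open>The bridge from the pointwise formula to the bilinear extension of the group law.
  Outside the carrier both sides have the default value zero.\<close>

lemma group_ring_mult:
  assumes r: "r \<in> carrier (free_module K (carrier G))" and s: "s \<in> carrier (free_module K (carrier G))"
  shows "r \<otimes>\<^bsub>group_ring K G\<^esub> s = convolution K (carrier G) (mult G) r s"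
proof
  interpret S: module K "self_module K" by (rule module_self_module[OF K.is_cring])
  fix x
  have c: "convolution K (carrier G) (mult G) r s \<in> carrier (free_module K (carrier G))"
    by (rule K.convolution_closed[OF mult_funcset r s])
  show "(r \<otimes>\<^bsub>group_ring K G\<^esub> s) x = convolution K (carrier G) (mult G) r s x"
  proof (cases "x \<in> carrier G")
    case False
    with c show ?thesis by (simp add: group_ring_def free_module_carrier)
  next
    case True
    have "convolution K (carrier G) (mult G) r s x =
        lin_comb K (self_module K) r (\<lambda>y. pushforward K (carrier G) ((\<otimes>\<^bsub>G\<^esub>) y) s x)"
      unfolding convolution_def
      by (rule K.lin_comb_apply[OF r]) (auto intro!: K.pushforward_closed[OF _ s])
    also have "\<dots> = lin_comb K (self_module K) r (\<lambda>y. s (inv\<^bsub>G\<^esub> y \<otimes>\<^bsub>G\<^esub> x))"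
      by (rule S.lin_comb_cong[OF r]) (auto simp: translation_apply[OF s] True K.free_module_closed[OF s])
    also have "\<dots> = (r \<otimes>\<^bsub>group_ring K G\<^esub> s) x"
      using True S.support_subset[OF r] by (auto simp: group_ring_def lin_comb_def intro!: arg_cong2[where f = "finsum K"])
    finally show ?thesis by simp
  qed
qed

lemma cring_group_ring: "cring (group_ring K G)"
proof -
  interpret F: module K "free_module K (carrier G)" by (rule K.module_free_module)
  note cl = K.convolution_closed[OF mult_funcset]
  show ?thesis
  proof (intro cringI abelian_groupI comm_monoidI)
    fix x assume x: "x \<in> carrier (group_ring K G)"
    show "\<exists>y\<in>carrier (group_ring K G). y \<oplus>\<^bsub>group_ring K G\<^esub> x = \<zero>\<^bsub>group_ring K G\<^esub>"
      using F.M.l_neg[of x] F.M.a_inv_closed[of x] x by auto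
  next
    fix x y z assume xyz: "x \<in> carrier (group_ring K G)" "y \<in> carrier (group_ring K G)" "z \<in> carrier (group_ring K G)"
    note xyz = xyz[unfolded group_ring_simps]
    from xyz show "(x \<oplus>\<^bsub>group_ring K G\<^esub> y) \<otimes>\<^bsub>group_ring K G\<^esub> z =
        x \<otimes>\<^bsub>group_ring K G\<^esub> z \<oplus>\<^bsub>group_ring K G\<^esub> y \<otimes>\<^bsub>group_ring K G\<^esub> z"
      using linear_mapsD(2)[OF K.convolution_linear_left[OF mult_funcset xyz(3)] xyz(1,2)]
      by (simp add: group_ring_mult K.free_module_add)
  next
    fix x y assume xy: "x \<in> carrier (group_ring K G)" "y \<in> carrier (group_ring K G)"
    then show "x \<otimes>\<^bsub>group_ring K G\<^esub> y = y \<otimes>\<^bsub>group_ring K G\<^esub> x"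
      using K.convolution_commute[OF mult_funcset G.m_comm] by (simp add: group_ring_mult)
    show "x \<oplus>\<^bsub>group_ring K G\<^esub> y = y \<oplus>\<^bsub>group_ring K G\<^esub> x"
      using F.M.a_comm[of x y] xy by simp
  next
    fix x y z assume xyz: "x \<in> carrier (group_ring K G)" "y \<in> carrier (group_ring K G)" "z \<in> carrier (group_ring K G)"
    then show "x \<otimes>\<^bsub>group_ring K G\<^esub> y \<otimes>\<^bsub>group_ring K G\<^esub> z = x \<otimes>\<^bsub>group_ring K G\<^esub> (y \<otimes>\<^bsub>group_ring K G\<^esub> z)"
      using K.convolution_assoc[OF mult_funcset mult_funcset G.m_assoc, of x y z]
      by (simp add: group_ring_mult cl)
    show "x \<oplus>\<^bsub>group_ring K G\<^esub> y \<oplus>\<^bsub>group_ring K G\<^esub> z = x \<oplus>\<^bsub>group_ring K G\<^esub> (y \<oplus>\<^bsub>group_ring K G\<^esub> z)"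
      using F.M.a_assoc[of x y z] xyz by simp
  next
    fix x assume x: "x \<in> carrier (group_ring K G)"
    then show "\<one>\<^bsub>group_ring K G\<^esub> \<otimes>\<^bsub>group_ring K G\<^esub> x = x"
      by (simp add: group_ring_mult K.free_module_single K.convolution_one[OF mult_funcset])
    show "\<zero>\<^bsub>group_ring K G\<^esub> \<oplus>\<^bsub>group_ring K G\<^esub> x = x"
      using x by (simp add: K.free_module_closed)
  qed (auto simp: group_ring_mult cl K.free_module_single K.free_module_add K.free_module_zero)
qed

lemma single_mult:
  assumes "x \<in> carrier G" "y \<in> carrier G"
  shows "single K x \<otimes>\<^bsub>group_ring K G\<^esub> single K y = single K (x \<otimes>\<^bsub>G\<^esub> y)"
  using assms by (simp add: group_ring_mult K.free_module_single K.convolution_single[OF mult_funcset])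

text \<open>The action \<open>a\<close> is a parameter of its own, required to agree with
  convolution on finitely supported arguments, because \<open>divisor_action\<close> is given by a
  pointwise formula.\<close>

lemma module_convolution:
  assumes act: "\<And>g. g \<in> carrier G \<Longrightarrow> act g \<in> B \<rightarrow> B"
    and mult: "\<And>g h b. g \<in> carrier G \<Longrightarrow> h \<in> carrier G \<Longrightarrow> b \<in> B \<Longrightarrow> act (g \<otimes>\<^bsub>G\<^esub> h) b = act g (act h b)"
    and one: "\<And>b. b \<in> B \<Longrightarrow> act \<one>\<^bsub>G\<^esub> b = b"
    and a: "\<And>r d. r \<in> carrier (free_module K (carrier G)) \<Longrightarrow> d \<in> carrier (free_module K B) \<Longrightarrow>
      a r d = convolution K B act r d"
  shows "module (group_ring K G) (with_action (free_module K B) a)"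
proof -
  interpret F: module K "free_module K B" by (rule K.module_free_module)
  interpret A: cring "group_ring K G" by (rule cring_group_ring)
  note cl = K.convolution_closed[OF act]
  show ?thesis
  proof (intro moduleI abelian_groupI A.is_cring)
    fix x assume "x \<in> carrier (with_action (free_module K B) a)"
    then show "\<exists>y\<in>carrier (with_action (free_module K B) a).
        y \<oplus>\<^bsub>with_action (free_module K B) a\<^esub> x = \<zero>\<^bsub>with_action (free_module K B) a\<^esub>"
      using F.M.l_neg[of x] F.M.a_inv_closed[of x] by (auto simp: with_action_def)
  next
    fix x y assume "x \<in> carrier (with_action (free_module K B) a)" "y \<in> carrier (with_action (free_module K B) a)"
    then show "x \<oplus>\<^bsub>with_action (free_module K B) a\<^esub> y = y \<oplus>\<^bsub>with_action (free_module K B) a\<^esub> x"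
      using F.M.a_comm[of x y] by (simp add: with_action_def)
  next
    fix x y z assume "x \<in> carrier (with_action (free_module K B) a)" "y \<in> carrier (with_action (free_module K B) a)"
       "z \<in> carrier (with_action (free_module K B) a)"
    then show "x \<oplus>\<^bsub>with_action (free_module K B) a\<^esub> y \<oplus>\<^bsub>with_action (free_module K B) a\<^esub> z =
        x \<oplus>\<^bsub>with_action (free_module K B) a\<^esub> (y \<oplus>\<^bsub>with_action (free_module K B) a\<^esub> z)"
      using F.M.a_assoc[of x y z] by (simp add: with_action_def)
  next
    fix r s d assume "r \<in> carrier (group_ring K G)" "s \<in> carrier (group_ring K G)"
       "d \<in> carrier (with_action (free_module K B) a)"
    then have rsd: "r \<in> carrier (free_module K (carrier G))" "s \<in> carrier (free_module K (carrier G))"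
      "d \<in> carrier (free_module K B)" by (simp_all add: with_action_def)
    then show "(r \<otimes>\<^bsub>group_ring K G\<^esub> s) \<odot>\<^bsub>with_action (free_module K B) a\<^esub> d =
       r \<odot>\<^bsub>with_action (free_module K B) a\<^esub> (s \<odot>\<^bsub>with_action (free_module K B) a\<^esub> d)"
      using K.convolution_assoc[OF act mult_funcset mult, of r s d]
      by (simp add: with_action_def a group_ring_mult cl K.convolution_closed[OF mult_funcset])
    show "(r \<oplus>\<^bsub>group_ring K G\<^esub> s) \<odot>\<^bsub>with_action (free_module K B) a\<^esub> d =
       r \<odot>\<^bsub>with_action (free_module K B) a\<^esub> d \<oplus>\<^bsub>with_action (free_module K B) a\<^esub> s \<odot>\<^bsub>with_action (free_module K B) a\<^esub> d"
      using linear_mapsD(2)[OF K.convolution_linear_left[OF act rsd(3)] rsd(1,2)] rsd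
      by (simp add: with_action_def a K.free_module_add)
  next
    fix r x y assume "r \<in> carrier (group_ring K G)" "x \<in> carrier (with_action (free_module K B) a)"
       "y \<in> carrier (with_action (free_module K B) a)"
    then have rxy: "r \<in> carrier (free_module K (carrier G))" "x \<in> carrier (free_module K B)"
      "y \<in> carrier (free_module K B)" by (simp_all add: with_action_def)
    then show "r \<odot>\<^bsub>with_action (free_module K B) a\<^esub> (x \<oplus>\<^bsub>with_action (free_module K B) a\<^esub> y) =
       r \<odot>\<^bsub>with_action (free_module K B) a\<^esub> x \<oplus>\<^bsub>with_action (free_module K B) a\<^esub> r \<odot>\<^bsub>with_action (free_module K B) a\<^esub> y"
      using linear_mapsD(2)[OF K.convolution_linear_right[OF act rxy(1)] rxy(2,3)]
      by (simp add: with_action_def a K.free_module_add)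
  next
    fix x assume "x \<in> carrier (with_action (free_module K B) a)"
    then show "\<one>\<^bsub>group_ring K G\<^esub> \<odot>\<^bsub>with_action (free_module K B) a\<^esub> x = x"
      "\<zero>\<^bsub>with_action (free_module K B) a\<^esub> \<oplus>\<^bsub>with_action (free_module K B) a\<^esub> x = x"
      using K.convolution_one[where G = "carrier G" and act = act and B = B and e = "\<one>\<^bsub>G\<^esub>" and d = x, OF act] one
      by (simp_all add: with_action_def a K.free_module_single K.free_module_closed)
  qed (auto simp: with_action_def a cl K.free_module_single K.free_module_add K.free_module_zero)
qed

abbreviation translate :: "'g \<Rightarrow> 'b \<times> 'g \<Rightarrow> 'b \<times> 'g" where
  "translate h \<equiv> (\<lambda>(v, g). (v, h \<otimes>\<^bsub>G\<^esub> g))"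

lemma translate_funcset: "h \<in> carrier G \<Longrightarrow> translate h \<in> V \<times> carrier G \<rightarrow> V \<times> carrier G"
  by auto

text \<open>Translating \<open>d\<close> by \<open>h\<close> means evaluating it at the translate by
  the inverse of \<open>h\<close>, which turns the bilinear extension into the defining sum.\<close>

lemma divisor_action_convolution:
  assumes r: "r \<in> carrier (free_module K (carrier G))"
    and d: "d \<in> carrier (free_module K (V \<times> carrier G))"
  shows "divisor_action K G r d = convolution K (V \<times> carrier G) translate r d"
proof
  interpret S: module K "self_module K" by (rule module_self_module[OF K.is_cring])
  fix x :: "'b \<times> 'g"
  obtain v g where x: "x = (v, g)" by force
  have c: "convolution K (V \<times> carrier G) translate r d \<in> carrier (free_module K (V \<times> carrier G))"
    by (rule K.convolution_closed[OF translate_funcset r d])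
  show "divisor_action K G r d x = convolution K (V \<times> carrier G) translate r d x"
  proof (cases "g \<in> carrier G")
    case False
    with c show ?thesis by (simp add: x divisor_action_def free_module_carrier)
  next
    case True
    show ?thesis
    proof (cases "v \<in> V")
      \<comment> \<open>Translation keeps the first coordinate, so over a point outside
        \<open>V\<close> every term of the sum vanishes.\<close>
      case False
      then have "d (v, h) = \<zero>\<^bsub>K\<^esub>" for h using d by (simp add: free_module_carrier)
      with False c K.free_module_closed[OF r] show ?thesis
        by (simp add: x divisor_action_def free_module_carrier)
    next
      case v: True
      have tr: "pushforward K (V \<times> carrier G) (translate h) d (v, g) = d (v, inv\<^bsub>G\<^esub> h \<otimes>\<^bsub>G\<^esub> g)"
        if "h \<in> carrier G" for h
        using d that v True
        by (subst K.pushforward_bij_apply[where \<psi> = "translate (inv\<^bsub>G\<^esub> h)" and B = "V \<times> carrier G"])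
           (auto simp: G.m_assoc[symmetric])
      have "convolution K (V \<times> carrier G) translate r d x =
          lin_comb K (self_module K) r (\<lambda>h. pushforward K (V \<times> carrier G) (translate h) d (v, g))"
        unfolding convolution_def x
        by (rule K.lin_comb_apply[OF r]) (auto intro!: K.pushforward_closed[OF translate_funcset] d)
      also have "\<dots> = lin_comb K (self_module K) r (\<lambda>h. d (v, inv\<^bsub>G\<^esub> h \<otimes>\<^bsub>G\<^esub> g))"
        by (rule S.lin_comb_cong[OF r]) (auto simp: tr True K.free_module_closed[OF d])
      also have "\<dots> = divisor_action K G r d x"
        using True S.support_subset[OF r]
        by (auto simp: divisor_action_def x lin_comb_def intro!: arg_cong2[where f = "finsum K"])
      finally show ?thesis by simp
    qed
  qed
qed

lemma module_divisor_action:
  "module (group_ring K G) (with_action (free_module K (V \<times> carrier G)) (divisor_action K G))"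
  by (rule module_convolution[where act = translate])
     (auto simp: divisor_action_convolution G.m_assoc)

end

lemma group_ring_map_pushforward:
  assumes "cring K" "\<phi> \<in> carrier G \<rightarrow> carrier H" "f \<in> carrier (free_module K (carrier G))"
  shows "group_ring_map K G H \<phi> f = pushforward K (carrier H) \<phi> f"
proof
  interpret K: cring K by fact
  fix h
  have c: "pushforward K (carrier H) \<phi> f \<in> carrier (free_module K (carrier H))"
    by (rule K.pushforward_closed[OF assms(2,3)])
  show "group_ring_map K G H \<phi> f h = pushforward K (carrier H) \<phi> f h"
  proof (cases "h \<in> carrier H")
    case True
    have "{x \<in> carrier G. f x \<noteq> \<zero>\<^bsub>K\<^esub> \<and> \<phi> x = h} = {x. f x \<noteq> \<zero>\<^bsub>K\<^esub> \<and> \<phi> x = h}"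
      using assms(3) by (auto simp: free_module_carrier)
    with True show ?thesis by (simp add: group_ring_map_def K.pushforward_apply[OF assms(2,3)])
  qed (use c in \<open>simp add: group_ring_map_def free_module_carrier\<close>)
qed

lemma pushforward_ring_hom:
  assumes "cring K" "comm_group G" "comm_group H" "\<phi> \<in> hom G H"
  shows "pushforward K (carrier H) \<phi> \<in> ring_hom (group_ring K G) (group_ring K H)"
proof -
  interpret G: group_ring_setup K G using assms(1,2) by (rule group_ring_setup.intro)
  interpret H: group_ring_setup K H using assms(1,3) by (rule group_ring_setup.intro)
  have \<phi>: "\<phi> \<in> carrier G \<rightarrow> carrier H" using assms(4) by (auto simp: hom_def)
  interpret h: group_hom G H \<phi>
    using assms(4) by (intro group_hom.intro group_hom_axioms.intro G.G.is_group H.G.is_group)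
  note lin = G.K.pushforward_linear[OF \<phi>]
  show ?thesis
  proof (rule ring_hom_memI)
    fix x y assume xy: "x \<in> carrier (group_ring K G)" "y \<in> carrier (group_ring K G)"
    then show "pushforward K (carrier H) \<phi> (x \<otimes>\<^bsub>group_ring K G\<^esub> y) =
        pushforward K (carrier H) \<phi> x \<otimes>\<^bsub>group_ring K H\<^esub> pushforward K (carrier H) \<phi> y"
      by (simp add: G.group_ring_mult H.group_ring_mult G.K.pushforward_closed[OF \<phi>]
         G.K.convolution_pushforward[OF G.mult_funcset H.mult_funcset \<phi> \<phi>] hom_mult[OF assms(4)])
    show "pushforward K (carrier H) \<phi> (x \<oplus>\<^bsub>group_ring K G\<^esub> y) =
        pushforward K (carrier H) \<phi> x \<oplus>\<^bsub>group_ring K H\<^esub> pushforward K (carrier H) \<phi> y"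
      using linear_mapsD(2)[OF lin, of x y] xy by simp
  qed (auto simp: G.K.pushforward_closed[OF \<phi>] G.K.pushforward_single[OF \<phi>])
qed

section \<open>Inverse limits and the Iwasawa algebra\<close>

lemma inverse_limit_simps [simp]:
  "add (inverse_limit R \<pi>) = (\<lambda>x y k. x k \<oplus>\<^bsub>R k\<^esub> y k)"
  "mult (inverse_limit R \<pi>) = (\<lambda>x y k. x k \<otimes>\<^bsub>R k\<^esub> y k)"
  "zero (inverse_limit R \<pi>) = (\<lambda>k. \<zero>\<^bsub>R k\<^esub>)"
  "one (inverse_limit R \<pi>) = (\<lambda>k. \<one>\<^bsub>R k\<^esub>)"
  by (simp_all add: inverse_limit_def)

lemma inverse_limit_carrier:
  "x \<in> carrier (inverse_limit R \<pi>) \<longleftrightarrow> (\<forall>k. x k \<in> carrier (R k)) \<and> (\<forall>k. \<pi> k (x (Suc k)) = x k)"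
  by (simp add: inverse_limit_def)

text \<open>The axioms hold componentwise. Compatible families are closed under the operations,
  negation included, because the transition maps are ring homomorphisms.\<close>

lemma cring_inverse_limit:
  assumes R: "\<And>k. cring (R k)" and \<pi>: "\<And>k. \<pi> k \<in> ring_hom (R (Suc k)) (R k)"
  shows "cring (inverse_limit R \<pi>)"
proof -
  interpret cring "R k" for k by (rule R)
  note hom = ring_hom_add[OF \<pi>] ring_hom_mult[OF \<pi>] ring_hom_one[OF \<pi>] ring_hom_zero[OF \<pi> ring_axioms ring_axioms]
  show ?thesis
  proof (intro cringI abelian_groupI comm_monoidI)
    fix x assume x: "x \<in> carrier (inverse_limit R \<pi>)"
    interpret h: ring_hom_ring "R (Suc k)" "R k" "\<pi> k" for k
      by (intro ring_hom_ringI2 ring_axioms \<pi>)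
    have "\<pi> k (\<ominus>\<^bsub>R (Suc k)\<^esub> x (Suc k)) = \<ominus>\<^bsub>R k\<^esub> x k" for k
      using x h.hom_a_inv by (auto simp: inverse_limit_carrier)
    then show "\<exists>y\<in>carrier (inverse_limit R \<pi>).
        y \<oplus>\<^bsub>inverse_limit R \<pi>\<^esub> x = \<zero>\<^bsub>inverse_limit R \<pi>\<^esub>"
      using x by (intro bexI[where x = "\<lambda>k. \<ominus>\<^bsub>R k\<^esub> x k"]) (auto simp: inverse_limit_carrier l_neg)
  qed (auto simp: inverse_limit_carrier hom a_ac m_ac l_distr r_distr)
qed

lemma inverse_limit_component:
  "(\<lambda>x. x k) \<in> ring_hom (inverse_limit R \<pi>) (R k)"
  by (rule ring_hom_memI) (auto simp: inverse_limit_carrier)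

subsection \<open>The ring of p-adic integers\<close>

lemma residue_ring_simps [simp]:
  "carrier (residue_ring m) = {0..m - 1}" "mult (residue_ring m) = (\<lambda>x y. x * y mod m)"
  "one (residue_ring m) = 1" "zero (residue_ring m) = 0" "add (residue_ring m) = (\<lambda>x y. (x + y) mod m)"
  by (simp_all add: residue_ring_def)

lemma Zp_simps [simp]:
  "add (Zp p) = (\<lambda>x y k. (x k + y k) mod int p ^ Suc k)"
  "mult (Zp p) = (\<lambda>x y k. (x k * y k) mod int p ^ Suc k)"
  "zero (Zp p) = (\<lambda>k. 0)" "one (Zp p) = (\<lambda>k. 1)"
  by (simp_all add: Zp_def)

lemma Zp_carrier:
  "x \<in> carrier (Zp p) \<longleftrightarrow> (\<forall>k. 0 \<le> x k \<and> x k < int p ^ Suc k) \<and> (\<forall>k. x (Suc k) mod int p ^ Suc k = x k)"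
  by (auto simp: Zp_def inverse_limit_carrier)

lemma cring_Zp:
  assumes "prime p" shows "cring (Zp p)"
  unfolding Zp_def
proof (rule cring_inverse_limit)
  have p: "1 < int p ^ Suc k" for k
    using prime_gt_1_nat[OF assms] by (intro one_less_power) auto
  have p0: "0 < int p ^ Suc k" for k using p[of k] by linarith
  from p show "\<And>k. cring (residue_ring (int p ^ Suc k))"
    by (intro residues.cring residues.intro)
  fix k
  have "int p ^ Suc k dvd int p ^ Suc (Suc k)" by (intro le_imp_power_dvd) simp
  then show "(\<lambda>x. x mod int p ^ Suc k) \<in> ring_hom (residue_ring (int p ^ Suc (Suc k))) (residue_ring (int p ^ Suc k))"
    using p[of k] pos_mod_sign[OF p0[of k]] pos_mod_bound[OF p0[of k]] by (intro ring_hom_memI) (auto simp: mod_mod_cancel mod_mult_eq mod_add_eq simp del: power_Suc)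
qed

lemma Zp_mod: "x \<in> carrier (Zp p) \<Longrightarrow> x k mod int p ^ Suc k = x k"
  by (simp add: Zp_carrier del: power_Suc)

text \<open>At a fixed precision a sum in Z_p is an integer sum followed by a single reduction, so
  it depends only on the residues of the summands at that precision.\<close>

lemma finsum_Zp_apply:
  assumes "prime p" "finite A" "F \<in> A \<rightarrow> carrier (Zp p)"
  shows "(\<Oplus>\<^bsub>Zp p\<^esub>b\<in>A. F b) k = (\<Sum>b\<in>A. F b k) mod int p ^ Suc k"
proof -
  interpret cring "Zp p" by (rule cring_Zp) fact
  show ?thesis using assms(2,3)
  proof (induction A rule: finite_induct)
    case (insert b A)
    then have F: "F \<in> A \<rightarrow> carrier (Zp p)" "F b \<in> carrier (Zp p)" by auto
    with insert show ?case
      by (subst finsum_insert) (auto simp: mod_add_right_eq simp del: power_Suc)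
  qed simp
qed

section \<open>Layers\<close>

text \<open>Needed because \<open>group_ring_map\<close> is identified with a pushforward only on
  the carrier.\<close>

lemma ring_hom_cong:
  "f \<in> ring_hom A B \<Longrightarrow> ring A \<Longrightarrow> (\<And>x. x \<in> carrier A \<Longrightarrow> g x = f x) \<Longrightarrow> g \<in> ring_hom A B"
  by (auto simp: ring_hom_def Pi_iff ring.ring_simprules)

locale iwasawa_algebra = \<Gamma>: comm_group \<Gamma> for p :: nat and \<Gamma> :: "('g, 'm) monoid_scheme" +
  assumes prime_p: "prime p"
begin

abbreviation "K \<equiv> Zp p"
abbreviation "N m \<equiv> powers \<Gamma> (p ^ m)"
abbreviation "G m \<equiv> layer p \<Gamma> m"
abbreviation "A m \<equiv> group_ring (Zp p) (layer p \<Gamma> m)"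
abbreviation "L \<equiv> Iwasawa p \<Gamma>"
abbreviation "coset m x \<equiv> powers \<Gamma> (p ^ m) #>\<^bsub>\<Gamma>\<^esub> x"
abbreviation "transition m \<equiv> (\<lambda>D. powers \<Gamma> (p ^ m) <#>\<^bsub>\<Gamma>\<^esub> D)"

sublocale K: cring K by (rule cring_Zp[OF prime_p])

lemma subgroup_powers: "subgroup (powers \<Gamma> k) \<Gamma>"
proof (rule \<Gamma>.subgroupI)
  show "powers \<Gamma> k \<noteq> {}" by (auto simp: powers_def)
  fix a b assume "a \<in> powers \<Gamma> k" "b \<in> powers \<Gamma> k"
  then show "inv\<^bsub>\<Gamma>\<^esub> a \<in> powers \<Gamma> k" "a \<otimes>\<^bsub>\<Gamma>\<^esub> b \<in> powers \<Gamma> k"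
    by (auto simp: powers_def \<Gamma>.nat_pow_inv[symmetric] \<Gamma>.nat_pow_distrib[symmetric])
qed (auto simp: powers_def)

lemma powers_pow: "x \<in> carrier \<Gamma> \<Longrightarrow> x [^]\<^bsub>\<Gamma>\<^esub> k \<in> powers \<Gamma> k"
  by (auto simp: powers_def)

lemma comm_group_layer: "comm_group (G m)"
  unfolding layer_def by (rule \<Gamma>.abelian_FactGroup[OF subgroup_powers])

sublocale G: comm_group "G m" for m by (rule comm_group_layer)

lemma coset_hom: "coset m \<in> hom \<Gamma> (G m)"
  unfolding layer_def by (rule normal.r_coset_hom_Mod[OF \<Gamma>.subgroup_imp_normal[OF subgroup_powers]])

lemma coset_closed: "x \<in> carrier \<Gamma> \<Longrightarrow> coset m x \<in> carrier (G m)"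
  using coset_hom by (auto simp: hom_def)

lemma carrier_layer: "D \<in> carrier (G m) \<longleftrightarrow> (\<exists>x\<in>carrier \<Gamma>. D = coset m x)"
  by (auto simp: layer_def FactGroup_def RCOSETS_def)

lemma coset_mult: "x \<in> carrier \<Gamma> \<Longrightarrow> y \<in> carrier \<Gamma> \<Longrightarrow> coset m (x \<otimes>\<^bsub>\<Gamma>\<^esub> y) = coset m x \<otimes>\<^bsub>G m\<^esub> coset m y"
  by (rule hom_mult[OF coset_hom])

lemma coset_one: "coset m \<one>\<^bsub>\<Gamma>\<^esub> = \<one>\<^bsub>G m\<^esub>"
  by (rule hom_one[OF coset_hom]) unfold_locales

lemma coset_eqD:
  assumes "x \<in> carrier \<Gamma>" "y \<in> carrier \<Gamma>" "coset m x = coset m y"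
  obtains n where "n \<in> N m" "x = n \<otimes>\<^bsub>\<Gamma>\<^esub> y"
proof -
  have "x \<in> coset m y" using \<Gamma>.rcos_self[OF assms(1) subgroup_powers, of "p ^ m"] assms(3) by simp
  then show thesis using that by (auto simp: r_coset_def)
qed

lemma coset_powers: "n \<in> N m \<Longrightarrow> coset m n = \<one>\<^bsub>G m\<^esub>"
  using \<Gamma>.coset_join2[OF subgroup.mem_carrier[OF subgroup_powers] subgroup_powers, of n "p ^ m"]
  by (simp add: layer_def FactGroup_def)

lemma powers_Suc_subset: "N (Suc m) \<subseteq> N m"
proof
  fix x assume "x \<in> N (Suc m)"
  then obtain y where y: "y \<in> carrier \<Gamma>" "x = y [^]\<^bsub>\<Gamma>\<^esub> (p * p ^ m)" by (auto simp: powers_def)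
  then have "x = (y [^]\<^bsub>\<Gamma>\<^esub> p) [^]\<^bsub>\<Gamma>\<^esub> (p ^ m)" by (simp add: \<Gamma>.nat_pow_pow)
  with y show "x \<in> N m" using powers_pow[of "y [^]\<^bsub>\<Gamma>\<^esub> p" "p ^ m"] by simp
qed

lemma transition_coset:
  assumes x: "x \<in> carrier \<Gamma>" shows "transition m (coset (Suc m) x) = coset m x"
proof -
  \<comment> \<open>The larger subgroup absorbs the smaller one, hence enlarging a coset modulo
    Gamma^(p^(m+1)) gives a coset modulo Gamma^(p^m).\<close>
  have "N m <#>\<^bsub>\<Gamma>\<^esub> N (Suc m) = N m"
  proof
    show "N m <#>\<^bsub>\<Gamma>\<^esub> N (Suc m) \<subseteq> N m"
      using powers_Suc_subset[of m] subgroup.m_closed[OF subgroup_powers, of _ "p ^ m"]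
      unfolding set_mult_def by blast
    show "N m \<subseteq> N m <#>\<^bsub>\<Gamma>\<^esub> N (Suc m)"
    proof
      fix x assume x: "x \<in> N m"
      then have "x = x \<otimes>\<^bsub>\<Gamma>\<^esub> \<one>\<^bsub>\<Gamma>\<^esub>" using subgroup.mem_carrier[OF subgroup_powers] by simp
      with x subgroup.one_closed[OF subgroup_powers, of "p ^ Suc m"]
      show "x \<in> N m <#>\<^bsub>\<Gamma>\<^esub> N (Suc m)" unfolding set_mult_def by blast
    qed
  qed
  then show ?thesis
    using \<Gamma>.setmult_rcos_assoc[of "N m" "N (Suc m)" x] x subgroup.subset[OF subgroup_powers] by simp
qed

lemma transition_hom: "transition m \<in> hom (G (Suc m)) (G m)"
proof (rule homI)
  fix D E assume "D \<in> carrier (G (Suc m))" "E \<in> carrier (G (Suc m))"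
  then obtain x y where x: "x \<in> carrier \<Gamma>" "D = coset (Suc m) x" and y: "y \<in> carrier \<Gamma>" "E = coset (Suc m) y"
    by (auto simp: carrier_layer)
  then show "transition m D \<in> carrier (G m)" by (simp only: transition_coset coset_closed)
  have "transition m (D \<otimes>\<^bsub>G (Suc m)\<^esub> E) = transition m (coset (Suc m) (x \<otimes>\<^bsub>\<Gamma>\<^esub> y))"
    using x y by (simp only: coset_mult)
  also have "\<dots> = coset m (x \<otimes>\<^bsub>\<Gamma>\<^esub> y)"
    using x y by (intro transition_coset \<Gamma>.m_closed)
  also have "\<dots> = transition m D \<otimes>\<^bsub>G m\<^esub> transition m E"
    using x y by (simp only: transition_coset coset_mult)
  finally show "transition m (D \<otimes>\<^bsub>G (Suc m)\<^esub> E) = transition m D \<otimes>\<^bsub>G m\<^esub> transition m E" .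
qed

lemma transition_funcset: "transition m \<in> carrier (G (Suc m)) \<rightarrow> carrier (G m)"
  using transition_hom by (auto simp: hom_def)

lemma coset_funcset: "coset m \<in> carrier \<Gamma> \<rightarrow> carrier (G m)"
  by (auto simp: coset_closed)

sublocale A: cring "A m" for m
  by (rule group_ring_setup.cring_group_ring) (intro group_ring_setup.intro K.is_cring comm_group_layer)

lemma group_ring_setup_layer: "group_ring_setup K (G m)"
  by (intro group_ring_setup.intro K.is_cring comm_group_layer)

lemma group_ring_setup_\<Gamma>: "group_ring_setup K \<Gamma>"
  by (intro group_ring_setup.intro K.is_cring \<Gamma>.comm_group_axioms)

lemma group_ring_map_transition:
  "f \<in> carrier (A (Suc m)) \<Longrightarrow>
    group_ring_map K (G (Suc m)) (G m) (transition m) f = pushforward K (carrier (G m)) (transition m) f"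
  by (rule group_ring_map_pushforward[OF K.is_cring transition_funcset]) simp

lemma cring_Iwasawa: "cring L"
  unfolding Iwasawa_def
proof (rule cring_inverse_limit)
  show "\<And>k. cring (A k)" by (rule A.is_cring)
  show "group_ring_map K (G (Suc k)) (G k) (transition k) \<in> ring_hom (A (Suc k)) (A k)" for k
    by (rule ring_hom_cong[OF pushforward_ring_hom[OF K.is_cring comm_group_layer comm_group_layer transition_hom]
          A.ring_axioms group_ring_map_transition])
qed

sublocale L: cring L by (rule cring_Iwasawa)

lemma L_carrier:
  "z \<in> carrier L \<longleftrightarrow> (\<forall>m. z m \<in> carrier (A m)) \<and>
     (\<forall>m. pushforward K (carrier (G m)) (transition m) (z (Suc m)) = z m)"
  unfolding Iwasawa_def inverse_limit_carrier using group_ring_map_transition by metis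

lemma L_simps [simp]:
  "add L = (\<lambda>x y m. x m \<oplus>\<^bsub>A m\<^esub> y m)" "mult L = (\<lambda>x y m. x m \<otimes>\<^bsub>A m\<^esub> y m)"
  "zero L = (\<lambda>m. \<zero>\<^bsub>A m\<^esub>)" "one L = (\<lambda>m. \<one>\<^bsub>A m\<^esub>)"
  by (simp_all only: Iwasawa_def inverse_limit_simps)

lemma component_hom: "(\<lambda>z. z m) \<in> ring_hom L (A m)"
  unfolding Iwasawa_def by (rule inverse_limit_component)

lemma component_closed: "z \<in> carrier L \<Longrightarrow> z m \<in> carrier (A m)"
  using L_carrier by auto

lemma component_closed': "z \<in> carrier L \<Longrightarrow> z m \<in> carrier (free_module K (carrier (G m)))"
  using component_closed by simp

lemma component_minus:
  assumes "x \<in> carrier L" "y \<in> carrier L" shows "(x \<ominus>\<^bsub>L\<^esub> y) m = x m \<ominus>\<^bsub>A m\<^esub> y m"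
proof -
  interpret h: ring_hom_ring L "A m" "\<lambda>z. z m"
    by (intro ring_hom_ringI2 L.ring_axioms A.ring_axioms component_hom)
  show ?thesis using assms h.hom_a_inv[of y] by (simp add: a_minus_def del: group_ring_simps)
qed

abbreviation "toL \<equiv> to_Iwasawa p \<Gamma>"

lemma to_Iwasawa_component:
  assumes "r \<in> carrier (group_ring K \<Gamma>)"
  shows "toL r m = pushforward K (carrier (G m)) (coset m) r"
  using group_ring_map_pushforward[OF K.is_cring coset_funcset, of r] assms
  by (simp add: to_Iwasawa_def)

lemma to_Iwasawa_closed:
  assumes "r \<in> carrier (group_ring K \<Gamma>)" shows "toL r \<in> carrier L"
proof -
  have r: "r \<in> carrier (free_module K (carrier \<Gamma>))" using assms by simp
  have "pushforward K (carrier (G m)) (transition m) (pushforward K (carrier (G (Suc m))) (coset (Suc m)) r) =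
    pushforward K (carrier (G m)) (coset m) r" for m
    unfolding K.pushforward_compose[OF coset_funcset transition_funcset r]
    by (rule K.pushforward_cong[OF _ _ r]) (auto simp only: transition_coset coset_closed intro!: funcsetI)
  then show ?thesis
    using assms K.pushforward_closed[OF coset_funcset r] by (simp add: L_carrier to_Iwasawa_component)
qed

lemma to_Iwasawa_hom: "toL \<in> ring_hom (group_ring K \<Gamma>) L"
proof (rule ring_hom_memI)
  interpret R: cring "group_ring K \<Gamma>"
    by (rule group_ring_setup.cring_group_ring[OF group_ring_setup_\<Gamma>])
  note h = pushforward_ring_hom[OF K.is_cring \<Gamma>.comm_group_axioms comm_group_layer coset_hom]
  fix x y assume xy: "x \<in> carrier (group_ring K \<Gamma>)" "y \<in> carrier (group_ring K \<Gamma>)"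
  show "toL x \<in> carrier L" using xy by (rule_tac to_Iwasawa_closed)
  show "toL (x \<otimes>\<^bsub>group_ring K \<Gamma>\<^esub> y) = toL x \<otimes>\<^bsub>L\<^esub> toL y"
    using xy by (auto simp: to_Iwasawa_component ring_hom_mult[OF h] simp del: group_ring_simps)
  show "toL (x \<oplus>\<^bsub>group_ring K \<Gamma>\<^esub> y) = toL x \<oplus>\<^bsub>L\<^esub> toL y"
    using xy R.a_closed[OF xy] by (auto simp: to_Iwasawa_component ring_hom_add[OF h] simp del: group_ring_simps)
next
  interpret R: cring "group_ring K \<Gamma>"
    by (rule group_ring_setup.cring_group_ring[OF group_ring_setup_\<Gamma>])
  note h = pushforward_ring_hom[OF K.is_cring \<Gamma>.comm_group_axioms comm_group_layer coset_hom]
  show "toL \<one>\<^bsub>group_ring K \<Gamma>\<^esub> = \<one>\<^bsub>L\<^esub>"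
    by (auto simp: to_Iwasawa_component ring_hom_one[OF h] simp del: group_ring_simps)
qed

definition group_like :: "'g \<Rightarrow> nat \<Rightarrow> 'g set \<Rightarrow> nat \<Rightarrow> int" where
  "group_like x = toL (single K x)"

lemma single_closed: "x \<in> carrier \<Gamma> \<Longrightarrow> single K x \<in> carrier (group_ring K \<Gamma>)"
  by (simp add: K.free_module_single)

lemma group_like_closed [simp]: "x \<in> carrier \<Gamma> \<Longrightarrow> group_like x \<in> carrier L"
  unfolding group_like_def by (intro to_Iwasawa_closed single_closed)

lemma group_like_component: "x \<in> carrier \<Gamma> \<Longrightarrow> group_like x m = single K (coset m x)"
  by (simp add: group_like_def to_Iwasawa_component[OF single_closed] K.pushforward_single[OF coset_funcset])

lemma group_like_mult:
  assumes "x \<in> carrier \<Gamma>" "y \<in> carrier \<Gamma>" shows "group_like (x \<otimes>\<^bsub>\<Gamma>\<^esub> y) = group_like x \<otimes>\<^bsub>L\<^esub> group_like y"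
  unfolding group_like_def
  using assms by (simp only: group_ring_setup.single_mult[OF group_ring_setup_\<Gamma>, symmetric]
      ring_hom_mult[OF to_Iwasawa_hom single_closed single_closed])

lemma group_like_one: "group_like \<one>\<^bsub>\<Gamma>\<^esub> = \<one>\<^bsub>L\<^esub>"
  using ring_hom_one[OF to_Iwasawa_hom] by (simp add: group_like_def)

lemma group_like_pow: "x \<in> carrier \<Gamma> \<Longrightarrow> group_like (x [^]\<^bsub>\<Gamma>\<^esub> (k::nat)) = group_like x [^]\<^bsub>L\<^esub> k"
  by (induction k) (simp_all add: group_like_one group_like_mult del: L_simps)

text \<open>Lower components are pushforwards of higher ones, so vanishing propagates down the
  tower.\<close>

lemma component_zero_mono:
  assumes z: "z \<in> carrier L" and "z m = \<zero>\<^bsub>A m\<^esub>" "j \<le> m"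
  shows "z j = \<zero>\<^bsub>A j\<^esub>"
  using assms(3)
proof (induction rule: inc_induct)
  case (step n)
  have "z n = pushforward K (carrier (G n)) (transition n) (z (Suc n))" using z by (simp add: L_carrier)
  also have "\<dots> = \<zero>\<^bsub>A n\<^esub>"
    unfolding step
    using linear_maps_zero[OF K.module_free_module K.module_free_module K.pushforward_linear[OF transition_funcset]]
    by simp
  finally show ?case .
qed (rule assms)

end

section \<open>The augmentation kernels of the Iwasawa algebra\<close>

context cring
begin

text \<open>The rule by which g - 1 and h - 1 control gh - 1; with the next lemma for inverses it
  covers a whole generated subgroup.\<close>

lemma mult_minus_one:
  "x \<in> carrier R \<Longrightarrow> y \<in> carrier R \<Longrightarrow> x \<otimes> y \<ominus> \<one> = x \<otimes> (y \<ominus> \<one>) \<oplus> (x \<ominus> \<one>)"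
  by algebra

lemma inverse_minus_one:
  "x \<in> carrier R \<Longrightarrow> y \<in> carrier R \<Longrightarrow> y \<otimes> x = \<one> \<Longrightarrow> y \<ominus> \<one> = \<ominus> (y \<otimes> (x \<ominus> \<one>))"
  by algebra

lemma diff_add_eq:
  "x \<in> carrier R \<Longrightarrow> y \<in> carrier R \<Longrightarrow> x \<ominus> y \<oplus> y = x"
  by algebra

lemma diff_diff_sum:
  "x \<in> carrier R \<Longrightarrow> y \<in> carrier R \<Longrightarrow> z \<in> carrier R \<Longrightarrow> x \<ominus> (y \<oplus> z) = (x \<ominus> y) \<ominus> z"
  by algebra

lemma add_pair_swap:
  "a \<in> carrier R \<Longrightarrow> b \<in> carrier R \<Longrightarrow> c \<in> carrier R \<Longrightarrow> d \<in> carrier R \<Longrightarrow>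
    (a \<oplus> b) \<oplus> (c \<oplus> d) = (a \<oplus> c) \<oplus> (b \<oplus> d)"
  by algebra

lemma minus_eq_zeroD:
  "x \<in> carrier R \<Longrightarrow> y \<in> carrier R \<Longrightarrow> x \<ominus> y = \<zero> \<Longrightarrow> x = y"
  using diff_add_eq[of x y] by simp

end

section \<open>The filtration by layer and precision\<close>

context iwasawa_algebra
begin

lemma module_L: "module L (self_module L)"
  by (rule module_self_module[OF L.is_cring])

text \<open>\<open>L\<close> is separated and complete for this filtration, in which \<open>j\<close> is the level in the tower of
  layers and \<open>r\<close> the \<open>p\<close>-adic precision.\<close>

definition filtration :: "nat \<Rightarrow> (nat \<Rightarrow> 'g set \<Rightarrow> nat \<Rightarrow> int) set" where
  "filtration t = {z \<in> carrier L. \<forall>j D r. j + r < t \<longrightarrow> z j D r = 0}"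

lemma L_add_apply: "(z \<oplus>\<^bsub>L\<^esub> w) j D r = (z j D r + w j D r) mod int p ^ Suc r"
  by simp

lemma coefficient_closed: "z \<in> carrier L \<Longrightarrow> z j D \<in> carrier K"
  by (rule K.free_module_closed[OF component_closed'])

text \<open>Component \<open>r\<close> being zero means divisibility by p^(r+1). Residues of a
  product depend only on residues of the factors, so functions with this property are stable under
  multiplication.\<close>

lemma group_ring_mult_coefficient_zero:
  assumes f: "f \<in> carrier (A j)" and g: "g \<in> carrier (A j)" and z: "\<And>D. g D r = 0"
  shows "(f \<otimes>\<^bsub>A j\<^esub> g) D r = 0"
proof -
  have f': "finite {y. f y \<noteq> \<zero>\<^bsub>K\<^esub>}" using f by (auto simp: free_module_carrier)
  show ?thesis
  proof (cases "D \<in> carrier (G j)")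
    case True
    have "(f \<otimes>\<^bsub>A j\<^esub> g) D r =
        (\<Oplus>\<^bsub>K\<^esub>y\<in>{y \<in> carrier (G j). f y \<noteq> \<zero>\<^bsub>K\<^esub>}. f y \<otimes>\<^bsub>K\<^esub> g (inv\<^bsub>G j\<^esub> y \<otimes>\<^bsub>G j\<^esub> D)) r"
      using True by (simp add: group_ring_def)
    also have "\<dots> = (\<Sum>y\<in>{y \<in> carrier (G j). f y \<noteq> \<zero>\<^bsub>K\<^esub>}.
        (f y \<otimes>\<^bsub>K\<^esub> g (inv\<^bsub>G j\<^esub> y \<otimes>\<^bsub>G j\<^esub> D)) r) mod int p ^ Suc r"
      using f g K.free_module_closed
      by (intro finsum_Zp_apply[OF prime_p] finite_subset[OF _ f'] funcsetI K.m_closed) auto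
    also have "\<dots> = 0" by (simp add: z)
    finally show ?thesis .
  qed (simp add: group_ring_def)
qed

lemma filtration_submodule: "submodule (filtration t) L (self_module L)"
proof -
  interpret M: module L "self_module L" by (rule module_L)
  have *: "a \<otimes>\<^bsub>L\<^esub> z \<in> filtration t" if "a \<in> carrier L" "z \<in> filtration t" for a z
  proof -
    have z: "z \<in> carrier L" using that by (simp add: filtration_def)
    have "(a \<otimes>\<^bsub>L\<^esub> z) j D r = 0" if "j + r < t" for j D r
    proof -
      have "(a j \<otimes>\<^bsub>A j\<^esub> z j) D r = 0"
        using \<open>z \<in> filtration t\<close> that
        by (intro group_ring_mult_coefficient_zero component_closed z \<open>a \<in> carrier L\<close>)
           (auto simp: filtration_def)
      then show ?thesis by simp
    qed
    with z that show ?thesis unfolding filtration_def by (auto simp del: L_simps)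
  qed
  show ?thesis
  proof (rule M.submoduleI)
    fix z assume z: "z \<in> filtration t"
    then have "\<ominus>\<^bsub>L\<^esub> z = (\<ominus>\<^bsub>L\<^esub> \<one>\<^bsub>L\<^esub>) \<otimes>\<^bsub>L\<^esub> z"
      by (simp add: filtration_def L.l_minus del: L_simps)
    then show "\<ominus>\<^bsub>self_module L\<^esub> z \<in> filtration t"
      using *[OF L.a_inv_closed[OF L.one_closed] z] by simp
  next
    fix z w assume "z \<in> filtration t" "w \<in> filtration t"
    then show "z \<oplus>\<^bsub>self_module L\<^esub> w \<in> filtration t"
      using L.a_closed[of z w] by (auto simp: filtration_def)
  qed (use * L.zero_closed in \<open>auto simp: filtration_def\<close>)
qed

lemma filtration_closed: "z \<in> filtration t \<Longrightarrow> z \<in> carrier L"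
  by (simp add: filtration_def)

lemma filtration_mult: "a \<in> carrier L \<Longrightarrow> z \<in> filtration t \<Longrightarrow> a \<otimes>\<^bsub>L\<^esub> z \<in> filtration t"
  using module.submoduleE(4)[OF module_L filtration_submodule] by simp

lemma filtration_mult': "a \<in> carrier L \<Longrightarrow> z \<in> filtration t \<Longrightarrow> z \<otimes>\<^bsub>L\<^esub> a \<in> filtration t"
  using filtration_mult[of a z t] by (simp add: L.m_comm filtration_closed del: L_simps)

lemma filtration_minus: "a \<in> filtration t \<Longrightarrow> z \<in> filtration t \<Longrightarrow> a \<ominus>\<^bsub>L\<^esub> z \<in> filtration t"
  using module.submoduleE(3,5)[OF module_L filtration_submodule] by (simp add: a_minus_def)

lemma filtration_finsum: "f \<in> I \<rightarrow> filtration t \<Longrightarrow> finsum L f I \<in> filtration t"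
  using submodule_finsum[OF module_L filtration_submodule] by simp

lemma filtration_separated:
  assumes "z \<in> carrier L" "\<And>t. z \<in> filtration t" shows "z = \<zero>\<^bsub>L\<^esub>"
proof -
  have "z j D r = 0" for j D r using assms(2)[of "Suc (j + r)"] by (simp add: filtration_def)
  then have "z = (\<lambda>j D r. 0)" by (intro ext)
  then show ?thesis by simp
qed

text \<open>Addition in \<open>L\<close> has an explicit formula on residues and subtraction does
  not, so the residue of the difference is obtained from x = (x - y) + y modulo p^(r+1).\<close>

lemma filtration_diffI:
  assumes "x \<in> carrier L" "y \<in> carrier L" "\<And>j D r. j + r < t \<Longrightarrow> x j D r = y j D r"
  shows "x \<ominus>\<^bsub>L\<^esub> y \<in> filtration t"
proof -
  let ?d = "x \<ominus>\<^bsub>L\<^esub> y"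
  have d: "?d \<in> carrier L" using assms by simp
  have "?d j D r = 0" if "j + r < t" for j D r
  proof -
    have "x j D r = (?d \<oplus>\<^bsub>L\<^esub> y) j D r"
      using L.diff_add_eq[OF assms(1,2)] by simp
    also have "\<dots> = (?d j D r + y j D r) mod int p ^ Suc r" by (rule L_add_apply)
    finally have "(?d j D r + y j D r) mod int p ^ Suc r = y j D r mod int p ^ Suc r"
      using Zp_mod[OF coefficient_closed[OF assms(2)], of j D r] assms(3)[OF that] by simp
    then have "?d j D r mod int p ^ Suc r = 0"
      using mod_eq_dvd_iff[of "?d j D r + y j D r" "int p ^ Suc r" "y j D r"] by (simp add: mod_eq_0_iff_dvd)
    then show ?thesis using Zp_mod[OF coefficient_closed[OF d], of j D r] by simp
  qed
  then show ?thesis using d by (simp add: filtration_def)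
qed

text \<open>From j + r < t and t at most m + 1 it follows that j is at most m, and all components up
  to \<open>m\<close> vanish.\<close>

lemma filtration_zeroI:
  assumes z: "z \<in> carrier L" and "z m = \<zero>\<^bsub>A m\<^esub>" "t \<le> Suc m"
  shows "z \<in> filtration t"
proof -
  have "z j D r = 0" if "j + r < t" for j D r
    using component_zero_mono[OF z assms(2), of j] that assms(3) by simp
  with z show ?thesis by (simp add: filtration_def)
qed

end

section \<open>Finite layers and completeness of Lambda\<close>

locale iwasawa_generators = iwasawa_algebra p \<Gamma>
  for p :: nat and \<Gamma> :: "('g, 'm) monoid_scheme" +
  fixes l :: nat and \<gamma> :: "nat \<Rightarrow> 'g"
  assumes generators: "topological_generators p \<Gamma> l \<gamma>"
begin

lemma \<gamma>_closed: "i \<in> {1..l} \<Longrightarrow> \<gamma> i \<in> carrier \<Gamma>"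
  using generators by (auto simp: topological_generators_def)

lemma generate_closed: "h \<in> generate \<Gamma> (\<gamma> ` {1..l}) \<Longrightarrow> h \<in> carrier \<Gamma>"
  using \<Gamma>.generate_in_carrier[of "\<gamma> ` {1..l}"] \<gamma>_closed by blast

lemma generators_dense:
  assumes "x \<in> carrier \<Gamma>"
  obtains n h where "n \<in> N m" "h \<in> generate \<Gamma> (\<gamma> ` {1..l})" "x = n \<otimes>\<^bsub>\<Gamma>\<^esub> h"
  using assms generators by (fastforce simp: topological_generators_def r_coset_def)

text \<open>By density the cosets of the gamma_i generate the layer, and each has order dividing
  p^m. The products of their powers with exponents below p^m exhaust it.\<close>

lemma finite_layer: "finite (carrier (G m))"
proof -
  let ?g = "\<lambda>i. coset m (\<gamma> i)"
  let ?P = "p ^ m"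
  define f where "f n = (\<Otimes>\<^bsub>G m\<^esub>i\<in>{1..l}. ?g i [^]\<^bsub>G m\<^esub> (n i :: nat))" for n
  have g: "?g i \<in> carrier (G m)" if "i \<in> {1..l}" for i using that by (intro coset_closed \<gamma>_closed)
  have "?g i [^]\<^bsub>G m\<^esub> ?P = \<one>\<^bsub>G m\<^esub>" if "i \<in> {1..l}" for i
  proof -
    interpret h: group_hom \<Gamma> "G m" "coset m"
      by (intro group_hom.intro group_hom_axioms.intro \<Gamma>.is_group G.is_group coset_hom)
    have "?g i [^]\<^bsub>G m\<^esub> ?P = coset m (\<gamma> i [^]\<^bsub>\<Gamma>\<^esub> ?P)"
      using \<gamma>_closed[OF that] by (simp add: h.hom_nat_pow)
    also have "\<dots> = \<one>\<^bsub>G m\<^esub>" by (intro coset_powers powers_pow \<gamma>_closed that)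
    finally show ?thesis .
  qed
  note order = this
  have red: "?g i [^]\<^bsub>G m\<^esub> n = ?g i [^]\<^bsub>G m\<^esub> (n mod ?P)" if i: "i \<in> {1..l}" for i n
  proof -
    have "?g i [^]\<^bsub>G m\<^esub> n = ?g i [^]\<^bsub>G m\<^esub> (?P * (n div ?P) + n mod ?P)" by simp
    also have "\<dots> = ?g i [^]\<^bsub>G m\<^esub> (?P * (n div ?P)) \<otimes>\<^bsub>G m\<^esub> ?g i [^]\<^bsub>G m\<^esub> (n mod ?P)"
      by (rule G.nat_pow_mult[OF g[OF i], symmetric])
    also have "?g i [^]\<^bsub>G m\<^esub> (?P * (n div ?P)) = (?g i [^]\<^bsub>G m\<^esub> ?P) [^]\<^bsub>G m\<^esub> (n div ?P)"
      by (rule G.nat_pow_pow[OF g[OF i], symmetric])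
    also have "\<dots> = \<one>\<^bsub>G m\<^esub>" unfolding order[OF i] by (rule G.nat_pow_one)
    finally show ?thesis using G.nat_pow_closed[OF g[OF i]] by (simp only: G.l_one)
  qed
  have fin: "finite (f ` ({1..l} \<rightarrow>\<^sub>E {..<?P}))" by (intro finite_imageI finite_PiE) auto
  have P0: "?P > 0" using prime_gt_0_nat[OF prime_p] by simp
  have one: "f (\<lambda>i. if j = i then k else 0) = ?g j [^]\<^bsub>G m\<^esub> k" if "j \<in> {1..l}" for j k
  proof -
    have "f (\<lambda>i. if j = i then k else 0) =
        (\<Otimes>\<^bsub>G m\<^esub>i\<in>{1..l}. if j = i then ?g i [^]\<^bsub>G m\<^esub> k else \<one>\<^bsub>G m\<^esub>)"
      unfolding f_def using g by (intro G.finprod_cong') auto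
    also have "\<dots> = ?g j [^]\<^bsub>G m\<^esub> k" using that g by (intro G.finprod_singleton) auto
    finally show ?thesis .
  qed
  have gen: "coset m h \<in> range f" if "h \<in> generate \<Gamma> (\<gamma> ` {1..l})" for h
    using that
  proof (induction rule: generate.induct)
    case one
    have "coset m \<one>\<^bsub>\<Gamma>\<^esub> = f (\<lambda>_. 0)" by (simp add: f_def coset_one)
    then show ?case by (metis rangeI)
  next
    case (incl h)
    then obtain j where j: "j \<in> {1..l}" "h = \<gamma> j" by auto
    then have "coset m h = f (\<lambda>i. if j = i then 1 else 0)"
      using one[of j 1] g[of j] by simp
    then show ?case by (metis rangeI)
  next
    case (inv h)
    then obtain j where j: "j \<in> {1..l}" "h = \<gamma> j" by auto
    have gj: "?g j \<in> carrier (G m)" using g j by simp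
    \<comment> \<open>The inverse of an element whose order divides p^m is its power with exponent
      p^m - 1, so exponents in the natural numbers suffice.\<close>
    have "?g j \<otimes>\<^bsub>G m\<^esub> ?g j [^]\<^bsub>G m\<^esub> (?P - 1) = ?g j [^]\<^bsub>G m\<^esub> Suc (?P - 1)"
      using gj by (simp add: G.m_comm del: One_nat_def)
    also have "\<dots> = \<one>\<^bsub>G m\<^esub>"
      using P0 order[OF j(1)] by (simp del: G.nat_pow_Suc)
    finally have "inv\<^bsub>G m\<^esub> (?g j) = ?g j [^]\<^bsub>G m\<^esub> (?P - 1)"
      using gj by (intro G.comm_inv_char) auto
    moreover have "coset m (inv\<^bsub>\<Gamma>\<^esub> h) = inv\<^bsub>G m\<^esub> (?g j)"
    proof -
      interpret h: group_hom \<Gamma> "G m" "coset m"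
        by (intro group_hom.intro group_hom_axioms.intro \<Gamma>.is_group G.is_group coset_hom)
      show ?thesis using j \<gamma>_closed by simp
    qed
    ultimately have "coset m (inv\<^bsub>\<Gamma>\<^esub> h) = f (\<lambda>i. if j = i then ?P - 1 else 0)"
      using one[OF j(1), of "?P - 1"] by simp
    then show ?case by (metis rangeI)
  next
    case (eng h k)
    then obtain n n' where n: "coset m h = f n" "coset m k = f n'" by auto
    have "coset m (h \<otimes>\<^bsub>\<Gamma>\<^esub> k) = f n \<otimes>\<^bsub>G m\<^esub> f n'"
      using eng generate_closed by (simp add: coset_mult n)
    also have "\<dots> = (\<Otimes>\<^bsub>G m\<^esub>i\<in>{1..l}. ?g i [^]\<^bsub>G m\<^esub> n i \<otimes>\<^bsub>G m\<^esub> ?g i [^]\<^bsub>G m\<^esub> n' i)"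
      unfolding f_def using g by (intro G.finprod_multf[symmetric]) auto
    also have "\<dots> = f (\<lambda>i. n i + n' i)"
      unfolding f_def using g by (intro G.finprod_cong') (auto simp: G.nat_pow_mult)
    finally show ?case by (metis rangeI)
  qed
  have "carrier (G m) \<subseteq> f ` ({1..l} \<rightarrow>\<^sub>E {..<?P})"
  proof
    fix D assume "D \<in> carrier (G m)"
    then obtain x where x: "x \<in> carrier \<Gamma>" "D = coset m x" by (auto simp: carrier_layer)
    obtain y h where h: "y \<in> N m" "h \<in> generate \<Gamma> (\<gamma> ` {1..l})" "x = y \<otimes>\<^bsub>\<Gamma>\<^esub> h"
      by (rule generators_dense[OF x(1)])
    then have "D = coset m h"
      using subgroup.mem_carrier[OF subgroup_powers h(1)] generate_closed[OF h(2)]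
      by (simp add: x coset_mult coset_powers coset_closed)
    then obtain n where n: "D = f n" using gen[OF h(2)] by auto
    \<comment> \<open>Exponents are reduced modulo p^m; the restriction makes the exponent function
      extensional, hence a member of a finite function space.\<close>
    also have "\<dots> = f (restrict (\<lambda>i. n i mod ?P) {1..l})"
      unfolding f_def
    proof (rule G.finprod_cong'[OF refl])
      show "(\<lambda>i. ?g i [^]\<^bsub>G m\<^esub> restrict (\<lambda>i. n i mod ?P) {1..l} i) \<in> {1..l} \<rightarrow> carrier (G m)"
        using g by auto
      fix i assume i: "i \<in> {1..l}"
      show "?g i [^]\<^bsub>G m\<^esub> n i = ?g i [^]\<^bsub>G m\<^esub> restrict (\<lambda>i. n i mod ?P) {1..l} i"
        unfolding restrict_apply'[OF i] by (rule red[OF i])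
    qed
    finally have "D = f (restrict (\<lambda>i. n i mod ?P) {1..l})" .
    moreover have "restrict (\<lambda>i. n i mod ?P) {1..l} \<in> {1..l} \<rightarrow>\<^sub>E {..<?P}" using P0 by auto
    ultimately show "D \<in> f ` ({1..l} \<rightarrow>\<^sub>E {..<?P})" by (metis imageI)
  qed
  with fin show ?thesis by (rule finite_subset[rotated])
qed

text \<open>A coefficient of a pushforward is a sum over a fibre, and at a fixed precision it sees
  only residues at that precision. The limit constructed below thereby inherits compatibility
  between layers.\<close>

lemma pushforward_coefficient_cong:
  assumes f: "f \<in> carrier (A (Suc j))" and g: "g \<in> carrier (A (Suc j))" and eq: "\<And>D. f D r = g D r"
  shows "pushforward K (carrier (G j)) (transition j) f D r = pushforward K (carrier (G j)) (transition j) g D r"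
proof -
  have *: "pushforward K (carrier (G j)) (transition j) h D r =
    (\<Sum>E\<in>{E \<in> carrier (G (Suc j)). transition j E = D}. h E r) mod int p ^ Suc r"
    if h: "h \<in> carrier (A (Suc j))" for h
  proof -
    have h': "h \<in> carrier (free_module K (carrier (G (Suc j))))" using h by simp
    have "pushforward K (carrier (G j)) (transition j) h D = (\<Oplus>\<^bsub>K\<^esub>E\<in>{E. h E \<noteq> \<zero>\<^bsub>K\<^esub> \<and> transition j E = D}. h E)"
      by (rule K.pushforward_apply[OF transition_funcset h'])
    \<comment> \<open>The support depends on the function, the fibre does not. As layers are finite,
      the sum can be taken over the whole fibre, the same for \<open>f\<close> and
      \<open>g\<close>.\<close>
    also have "\<dots> = (\<Oplus>\<^bsub>K\<^esub>E\<in>{E \<in> carrier (G (Suc j)). transition j E = D}. h E)"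
    proof (rule K.add.finprod_mono_neutral_cong_left)
      show "{E. h E \<noteq> \<zero>\<^bsub>K\<^esub> \<and> transition j E = D} \<subseteq> {E \<in> carrier (G (Suc j)). transition j E = D}"
        using h' by (auto simp: free_module_carrier)
      show "h \<in> {E \<in> carrier (G (Suc j)). transition j E = D} \<rightarrow> carrier K"
        using K.free_module_closed[OF h'] by auto
    qed (use finite_layer[of "Suc j"] in auto)
    finally show ?thesis
      using finite_layer[of "Suc j"] K.free_module_closed[OF h'] by (simp add: finsum_Zp_apply[OF prime_p] del: power_Suc)
  qed
  show ?thesis unfolding *[OF f] *[OF g] eq ..
qed

text \<open>The residue at layer j and precision r no longer changes once t exceeds j + r, so the
  limit can be written down residue by residue.\<close>

lemma filtration_complete:
  assumes W: "\<And>t. W t \<in> carrier L"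
    and step: "\<And>t. \<exists>w\<in>filtration t. W (Suc t) = W t \<oplus>\<^bsub>L\<^esub> w"
  obtains y where "y \<in> carrier L" "\<And>t. y \<ominus>\<^bsub>L\<^esub> W t \<in> filtration t"
proof -
  have stable: "W (t + k) j D r = W t j D r" if "j + r < t" for t k j D r
  proof (induction k)
    case (Suc k)
    obtain w where w: "w \<in> filtration (t + k)" "W (Suc (t + k)) = W (t + k) \<oplus>\<^bsub>L\<^esub> w" using step by blast
    then have "w j D r = 0" using that by (simp add: filtration_def)
    then show ?case
      using Suc Zp_mod[OF coefficient_closed[OF W], of "t + k" j D r] by (simp only: add_Suc_right w(2) L_add_apply add_0_right)
  qed simp
  \<comment> \<open>The index \<open>Suc (j + r)\<close> is the first one from which this residue is
    stable.\<close>
  define y where "y = (\<lambda>j D r. W (Suc (j + r)) j D r)"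
  have y: "y j D r = W t j D r" if "j + r < t" for t j D r
    using stable[of j r "Suc (j + r)" "t - Suc (j + r)" D] that by (simp add: y_def)
  have "y j \<in> carrier (A j)" for j
  proof -
    have "y j D \<in> carrier K" for D
      unfolding Zp_carrier
    proof (intro conjI allI)
      fix r
      show "0 \<le> y j D r" "y j D r < int p ^ Suc r"
        using coefficient_closed[OF W, of "Suc (j + r)" j D] by (simp_all add: y_def Zp_carrier del: power_Suc)
      have "y j D (Suc r) = W (Suc (Suc (j + r))) j D (Suc r)" "y j D r = W (Suc (Suc (j + r))) j D r"
        by (intro y; simp)+
      then show "y j D (Suc r) mod int p ^ Suc r = y j D r"
        using coefficient_closed[OF W, of "Suc (Suc (j + r))" j D] by (simp add: Zp_carrier del: power_Suc)
    qed
    moreover have "y j D = \<zero>\<^bsub>K\<^esub>" if "D \<notin> carrier (G j)" for D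
      using component_closed'[OF W] that by (auto simp: y_def free_module_carrier)
    \<comment> \<open>A limit of functions with finite support has finite support because the layer
      itself is finite.\<close>
    moreover from this have "finite {D. y j D \<noteq> \<zero>\<^bsub>K\<^esub>}"
      by (intro finite_subset[OF _ finite_layer[of j]]) auto
    ultimately show ?thesis by (simp add: free_module_carrier)
  qed
  moreover have "pushforward K (carrier (G j)) (transition j) (y (Suc j)) = y j" for j
  proof (intro ext)
    fix D r
    \<comment> \<open>An index at which the residues at precision \<open>r\<close> are stable both
      in layer j + 1 and in layer j.\<close>
    let ?t = "Suc (Suc (j + r))"
    have "pushforward K (carrier (G j)) (transition j) (y (Suc j)) D r =
        pushforward K (carrier (G j)) (transition j) (W ?t (Suc j)) D r"
      by (rule pushforward_coefficient_cong) (use calculation component_closed[OF W] in \<open>auto intro!: y\<close>)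
    also have "\<dots> = W ?t j D r" using W[of ?t] by (simp add: L_carrier)
    also have "\<dots> = y j D r" by (rule y[symmetric]) simp
    finally show "pushforward K (carrier (G j)) (transition j) (y (Suc j)) D r = y j D r" .
  qed
  ultimately have "y \<in> carrier L" by (simp add: L_carrier)
  with that[of y] show thesis using filtration_diffI[OF _ W] y by blast
qed

section \<open>The ideals generated by the omega_m(T_i)\<close>

text \<open>Under gamma_i = 1 + T_i this is omega_m(T_i), and T_i itself for m = 0; the group form
  makes its component in each layer visible.\<close>

definition aug :: "nat \<Rightarrow> nat \<Rightarrow> nat \<Rightarrow> 'g set \<Rightarrow> nat \<Rightarrow> int" where
  "aug m i = group_like (\<gamma> i [^]\<^bsub>\<Gamma>\<^esub> (p ^ m)) \<ominus>\<^bsub>L\<^esub> \<one>\<^bsub>L\<^esub>"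

lemma aug_closed: "i \<in> {1..l} \<Longrightarrow> aug m i \<in> carrier L"
  unfolding aug_def by (intro L.minus_closed group_like_closed \<Gamma>.nat_pow_closed \<gamma>_closed L.one_closed)

lemma aug_component_zero:
  assumes "i \<in> {1..l}" shows "aug m i m = \<zero>\<^bsub>A m\<^esub>"
proof -
  note g = \<gamma>_closed[OF assms]
  have "group_like (\<gamma> i [^]\<^bsub>\<Gamma>\<^esub> (p ^ m)) m = \<one>\<^bsub>A m\<^esub>"
    using g by (simp add: group_like_component coset_powers powers_pow)
  then show ?thesis
    unfolding aug_def using component_minus[OF group_like_closed[OF \<Gamma>.nat_pow_closed[OF g]] L.one_closed, of "p ^ m" m]
    by (simp add: A.r_neg a_minus_def[of "A m"] del: group_ring_simps)
qed

text \<open>The ideal is presented by coefficient families because the approximation in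
  \<open>component_kernel\<close> takes limits of the coefficients, not merely of the
  combinations.\<close>

definition aug_ideal :: "nat \<Rightarrow> (nat \<Rightarrow> 'g set \<Rightarrow> nat \<Rightarrow> int) set" where
  "aug_ideal m = {\<Oplus>\<^bsub>L\<^esub>i\<in>{1..l}. u i \<otimes>\<^bsub>L\<^esub> aug m i | u. u \<in> {1..l} \<rightarrow> carrier L}"

lemma aug_ideal_submodule: "submodule (aug_ideal m) L (self_module L)"
  using module.finite_combinations_submodule[OF module_L, of "aug m" "{1..l}"] aug_closed
  by (simp add: aug_ideal_def Pi_def)

lemma aug_ideal_closed: "z \<in> aug_ideal m \<Longrightarrow> z \<in> carrier L"
  using module.submoduleE(1)[OF module_L aug_ideal_submodule] by auto

lemma aug_ideal_add: "z \<in> aug_ideal m \<Longrightarrow> w \<in> aug_ideal m \<Longrightarrow> z \<oplus>\<^bsub>L\<^esub> w \<in> aug_ideal m"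
  using module.submoduleE(5)[OF module_L aug_ideal_submodule] by simp

lemma aug_ideal_mult: "a \<in> carrier L \<Longrightarrow> z \<in> aug_ideal m \<Longrightarrow> a \<otimes>\<^bsub>L\<^esub> z \<in> aug_ideal m"
  using module.submoduleE(4)[OF module_L aug_ideal_submodule] by simp

lemma aug_ideal_uminus: "z \<in> aug_ideal m \<Longrightarrow> \<ominus>\<^bsub>L\<^esub> z \<in> aug_ideal m"
  using module.submoduleE(3)[OF module_L aug_ideal_submodule] by simp

lemma aug_ideal_zero: "\<zero>\<^bsub>L\<^esub> \<in> aug_ideal m"
  using subgroup.one_closed[OF submodule.axioms(1)[OF aug_ideal_submodule]] by simp

lemma aug_in_aug_ideal: "i \<in> {1..l} \<Longrightarrow> aug m i \<in> aug_ideal m"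
  using module.finite_combination_member[OF module_L, of "aug m" "{1..l}" i] aug_closed
  by (simp add: aug_ideal_def Pi_def)

text \<open>Gamma is abelian, so raising to the power p^m is multiplicative, and the rules for gh -
  1 and for inverses carry the claim from the generators to the subgroup they generate.\<close>

lemma aug_ideal_generated:
  assumes "h \<in> generate \<Gamma> (\<gamma> ` {1..l})"
  shows "group_like (h [^]\<^bsub>\<Gamma>\<^esub> (p ^ m)) \<ominus>\<^bsub>L\<^esub> \<one>\<^bsub>L\<^esub> \<in> aug_ideal m"
  using assms
proof (induction rule: generate.induct)
  case one
  then show ?case by (simp add: group_like_one L.r_neg a_minus_def aug_ideal_zero del: L_simps)
next
  case (incl h)
  then show ?case using aug_in_aug_ideal by (auto simp: aug_def)
next
  case (inv h)
  then obtain i where i: "i \<in> {1..l}" "h = \<gamma> i" by auto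
  let ?x = "h [^]\<^bsub>\<Gamma>\<^esub> (p ^ m)"
  have h: "h \<in> carrier \<Gamma>" using i \<gamma>_closed by simp
  have "group_like (inv\<^bsub>\<Gamma>\<^esub> ?x) \<otimes>\<^bsub>L\<^esub> group_like ?x = \<one>\<^bsub>L\<^esub>"
    using h by (simp add: group_like_mult[symmetric] group_like_one del: L_simps)
  then have "group_like (inv\<^bsub>\<Gamma>\<^esub> ?x) \<ominus>\<^bsub>L\<^esub> \<one>\<^bsub>L\<^esub> = \<ominus>\<^bsub>L\<^esub> (group_like (inv\<^bsub>\<Gamma>\<^esub> ?x) \<otimes>\<^bsub>L\<^esub> aug m i)"
    using h i by (simp add: L.inverse_minus_one[of "group_like ?x"] aug_def del: L_simps)
  then show ?case
    using h i by (simp add: \<Gamma>.nat_pow_inv aug_ideal_uminus aug_ideal_mult aug_in_aug_ideal del: L_simps)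
next
  case (eng h k)
  have hk: "h \<in> carrier \<Gamma>" "k \<in> carrier \<Gamma>" using eng generate_closed by auto
  then show ?case
    using eng
    by (simp add: \<Gamma>.nat_pow_distrib group_like_mult L.mult_minus_one aug_ideal_add aug_ideal_mult del: L_simps)
qed

text \<open>The quotient of \<open>x\<close> by \<open>y\<close> is some w^(p^k). Approximating w
  modulo Gamma^p by an element h of the dense subgroup changes the power by a factor in
  Gamma^(p^(k+1)), which layer k + 1 does not see. There \<open>x\<close> becomes h^(p^k) y, and the
  difference to \<open>y\<close> is a multiple of h^(p^k) - 1.\<close>

lemma same_coset_in_aug_ideal:
  assumes x: "x \<in> carrier \<Gamma>" and y: "y \<in> carrier \<Gamma>" and eq: "coset k x = coset k y"
  shows "\<exists>s\<in>aug_ideal k. single K (coset (Suc k) x) = s (Suc k) \<oplus>\<^bsub>A (Suc k)\<^esub> single K (coset (Suc k) y)"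
proof -
  obtain n where n: "n \<in> N k" "x = n \<otimes>\<^bsub>\<Gamma>\<^esub> y" by (rule coset_eqD[OF x y eq])
  then obtain w where w: "w \<in> carrier \<Gamma>" "n = w [^]\<^bsub>\<Gamma>\<^esub> (p ^ k)" by (auto simp: powers_def)
  obtain v h where v: "v \<in> N 1" "h \<in> generate \<Gamma> (\<gamma> ` {1..l})" "w = v \<otimes>\<^bsub>\<Gamma>\<^esub> h"
    \<comment> \<open>Level 1 is enough: the error \<open>v\<close> is a p-th power, and the
      exponent p^k lifts it to a p^(k+1)-th power.\<close>
    by (rule generators_dense[OF w(1)])
  then obtain u where u: "u \<in> carrier \<Gamma>" "v = u [^]\<^bsub>\<Gamma>\<^esub> p" by (auto simp: powers_def)
  have h: "h \<in> carrier \<Gamma>" using v generate_closed by simp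
  let ?h = "h [^]\<^bsub>\<Gamma>\<^esub> (p ^ k)"
  have "x = u [^]\<^bsub>\<Gamma>\<^esub> (p ^ Suc k) \<otimes>\<^bsub>\<Gamma>\<^esub> (?h \<otimes>\<^bsub>\<Gamma>\<^esub> y)"
    using u h y by (simp add: n w v \<Gamma>.nat_pow_distrib \<Gamma>.nat_pow_pow \<Gamma>.m_assoc)
  then have "coset (Suc k) x = coset (Suc k) (u [^]\<^bsub>\<Gamma>\<^esub> (p ^ Suc k)) \<otimes>\<^bsub>G (Suc k)\<^esub> coset (Suc k) (?h \<otimes>\<^bsub>\<Gamma>\<^esub> y)"
    using u h y by (simp only: coset_mult \<Gamma>.nat_pow_closed \<Gamma>.m_closed)
  also have "\<dots> = coset (Suc k) (?h \<otimes>\<^bsub>\<Gamma>\<^esub> y)"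
    using u h y by (simp only: coset_powers powers_pow coset_closed G.l_one \<Gamma>.m_closed \<Gamma>.nat_pow_closed)
  finally have "single K (coset (Suc k) x) = (group_like ?h \<otimes>\<^bsub>L\<^esub> group_like y) (Suc k)"
    using h y by (simp add: group_like_component group_like_mult[symmetric] del: L_simps power_Suc)
  also have "group_like ?h \<otimes>\<^bsub>L\<^esub> group_like y = group_like y \<otimes>\<^bsub>L\<^esub> (group_like ?h \<ominus>\<^bsub>L\<^esub> \<one>\<^bsub>L\<^esub>) \<oplus>\<^bsub>L\<^esub> group_like y"
  proof -
    have *: "a \<otimes>\<^bsub>L\<^esub> b = b \<otimes>\<^bsub>L\<^esub> (a \<ominus>\<^bsub>L\<^esub> \<one>\<^bsub>L\<^esub>) \<oplus>\<^bsub>L\<^esub> b" if "a \<in> carrier L" "b \<in> carrier L" for a b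
      using that by (simp add: a_minus_def L.r_distr L.r_minus L.a_assoc L.l_neg L.m_comm del: L_simps)
    show ?thesis using h y by (intro *) auto
  qed
  finally show ?thesis
    using aug_ideal_generated[OF v(2), of k] y
    by (intro bexI[where x = "group_like y \<otimes>\<^bsub>L\<^esub> (group_like ?h \<ominus>\<^bsub>L\<^esub> \<one>\<^bsub>L\<^esub>)"] aug_ideal_mult)
       (auto simp: group_like_component simp del: group_ring_simps)
qed

text \<open>The element a times 1 of Z_p[Gamma] is mapped to Lambda. It acts as the scalar
  \<open>a\<close> in all layers at once and so lets the ideals of Lambda absorb
  Z_p-scalars.\<close>

lemma scalar_mult:
  assumes a: "a \<in> carrier K"
  obtains c where "c \<in> carrier L"
    and "\<And>f m. f \<in> carrier (A m) \<Longrightarrow> c m \<otimes>\<^bsub>A m\<^esub> f = (\<lambda>D. a \<otimes>\<^bsub>K\<^esub> f D)"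
proof
  let ?r = "\<lambda>x. a \<otimes>\<^bsub>K\<^esub> single K \<one>\<^bsub>\<Gamma>\<^esub> x"
  have r: "?r \<in> carrier (group_ring K \<Gamma>)"
    unfolding group_ring_simps by (intro K.free_module_smult K.free_module_single a \<Gamma>.one_closed)
  then show "toL ?r \<in> carrier L" by (rule to_Iwasawa_closed)
  fix f m assume f: "f \<in> carrier (A m)"
  then have f': "f \<in> carrier (free_module K (carrier (G m)))" by simp
  interpret GR: group_ring_setup K "G m" by (rule group_ring_setup_layer)
  have c: "toL ?r m = (\<lambda>D. a \<otimes>\<^bsub>K\<^esub> single K \<one>\<^bsub>G m\<^esub> D)"
    using linear_mapsD(3)[OF K.pushforward_linear[OF coset_funcset], of a "single K \<one>\<^bsub>\<Gamma>\<^esub>"] a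
    by (simp add: to_Iwasawa_component[OF r] K.free_module_single K.pushforward_single[OF coset_funcset] coset_one
        del: Zp_simps)
  have c': "(\<lambda>D. a \<otimes>\<^bsub>K\<^esub> single K \<one>\<^bsub>G m\<^esub> D) \<in> carrier (free_module K (carrier (G m)))"
    by (intro K.free_module_smult K.free_module_single a G.one_closed)
  let ?conv = "convolution K (carrier (G m)) (mult (G m))"
  have convolution_unit: "?conv (single K \<one>\<^bsub>G m\<^esub>) f = f"
    by (rule K.convolution_one[where G = "carrier (G m)"]) (use f' in auto)
  have convolution_smult: "?conv (\<lambda>D. a \<otimes>\<^bsub>K\<^esub> single K \<one>\<^bsub>G m\<^esub> D) f =
      (\<lambda>D. a \<otimes>\<^bsub>K\<^esub> ?conv (single K \<one>\<^bsub>G m\<^esub>) f D)"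
    using linear_mapsD(3)[OF K.convolution_linear_left[where G = "carrier (G m)" and B = "carrier (G m)"
        and act = "mult (G m)", OF GR.mult_funcset f'] a K.free_module_single[OF G.one_closed]]
    by (simp del: Zp_simps)
  show "toL ?r m \<otimes>\<^bsub>A m\<^esub> f = (\<lambda>D. a \<otimes>\<^bsub>K\<^esub> f D)"
    unfolding c GR.group_ring_mult[OF c' f']
    unfolding convolution_smult convolution_unit ..
qed

text \<open>An element \<open>f\<close> is congruent modulo the ideal to its pushforward along a map that factors through
  the transition map, and this pushforward vanishes when \<open>f\<close> lies in the kernel.\<close>

lemma kernel_transition:
  assumes f: "f \<in> carrier (A (Suc k))"
    and ker: "pushforward K (carrier (G k)) (transition k) f = \<zero>\<^bsub>A k\<^esub>"
  shows "\<exists>s\<in>aug_ideal k. s (Suc k) = f"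
proof -
  \<comment> \<open>A set-theoretic section of the transition map: it selects one coset modulo
    Gamma^(p^(k+1)) inside each coset modulo Gamma^(p^k). No multiplicativity is claimed for
    it.\<close>
  define rep where "rep E = coset (Suc k) (SOME x. x \<in> carrier \<Gamma> \<and> coset k x = E)" for E
  have rep: "\<exists>y\<in>carrier \<Gamma>. rep (coset k x) = coset (Suc k) y \<and> coset k y = coset k x"
    if "x \<in> carrier \<Gamma>" for x
    unfolding rep_def using someI[of "\<lambda>y. y \<in> carrier \<Gamma> \<and> coset k y = coset k x" x] that by blast
  have rep_funcset: "rep \<in> carrier (G k) \<rightarrow> carrier (G (Suc k))"
  proof
    fix E assume "E \<in> carrier (G k)"
    then obtain x where "x \<in> carrier \<Gamma>" "E = coset k x" by (auto simp: carrier_layer)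
    moreover from this obtain y where "y \<in> carrier \<Gamma>" "rep (coset k x) = coset (Suc k) y"
      using rep[of x] by blast
    ultimately show "rep E \<in> carrier (G (Suc k))" by (simp only: coset_closed)
  qed
  let ?\<sigma> = "\<lambda>D. rep (transition k D)"
  have \<sigma>: "?\<sigma> \<in> carrier (G (Suc k)) \<rightarrow> carrier (G (Suc k))"
    using transition_funcset rep_funcset by (auto simp: Pi_iff simp del: power_Suc)
  let ?push = "pushforward K (carrier (G (Suc k))) ?\<sigma>"
  note lin = linear_mapsD[OF K.pushforward_linear[OF \<sigma>]]
  note comp_add = ring_hom_add[OF component_hom]
  have f': "f \<in> carrier (free_module K (carrier (G (Suc k))))" using f by simp
  then have "\<exists>s\<in>aug_ideal k. f = s (Suc k) \<oplus>\<^bsub>A (Suc k)\<^esub> ?push f"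
  proof (induction rule: K.free_module_induct)
    case zero
    have "?push \<zero>\<^bsub>A (Suc k)\<^esub> = \<zero>\<^bsub>A (Suc k)\<^esub>"
      using linear_maps_zero[OF K.module_free_module K.module_free_module K.pushforward_linear[OF \<sigma>]] by simp
    then show ?case
      by (intro bexI[OF _ aug_ideal_zero]) simp
  next
    case (add f g)
    then obtain s t where s: "s \<in> aug_ideal k" "f = s (Suc k) \<oplus>\<^bsub>A (Suc k)\<^esub> ?push f"
      and t: "t \<in> aug_ideal k" "g = t (Suc k) \<oplus>\<^bsub>A (Suc k)\<^esub> ?push g" by auto
    have cl: "s (Suc k) \<in> carrier (A (Suc k))" "t (Suc k) \<in> carrier (A (Suc k))"
      "?push f \<in> carrier (A (Suc k))" "?push g \<in> carrier (A (Suc k))"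
      using s t add by (auto intro!: component_closed' aug_ideal_closed lin(1))
    have "?push (f \<oplus>\<^bsub>A (Suc k)\<^esub> g) = ?push f \<oplus>\<^bsub>A (Suc k)\<^esub> ?push g"
      using lin(2)[OF add.hyps] by simp
    moreover have "f \<oplus>\<^bsub>A (Suc k)\<^esub> g =
       (s (Suc k) \<oplus>\<^bsub>A (Suc k)\<^esub> t (Suc k)) \<oplus>\<^bsub>A (Suc k)\<^esub> (?push f \<oplus>\<^bsub>A (Suc k)\<^esub> ?push g)"
      using A.add_pair_swap[OF cl(1,3,2,4)] by (simp only: s(2)[symmetric] t(2)[symmetric])
    ultimately have "f \<oplus>\<^bsub>A (Suc k)\<^esub> g = (s \<oplus>\<^bsub>L\<^esub> t) (Suc k) \<oplus>\<^bsub>A (Suc k)\<^esub> ?push (f \<oplus>\<^bsub>A (Suc k)\<^esub> g)"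
      by simp
    then show ?case using aug_ideal_add[OF s(1) t(1)] by auto
  next
    case (single a D)
    then obtain x where x: "x \<in> carrier \<Gamma>" "D = coset (Suc k) x" by (auto simp: carrier_layer)
    then have tD: "transition k D = coset k x" by (simp only: transition_coset)
    obtain y where y: "y \<in> carrier \<Gamma>" "?\<sigma> D = coset (Suc k) y" "coset k y = coset k x"
      using rep[OF x(1)] by (auto simp only: tD)
    obtain s where s: "s \<in> aug_ideal k" "single K D = s (Suc k) \<oplus>\<^bsub>A (Suc k)\<^esub> single K (?\<sigma> D)"
      using same_coset_in_aug_ideal[OF x(1) y(1) y(3)[symmetric]] unfolding x(2)[symmetric] y(2)[symmetric] by blast
    obtain c where c: "c \<in> carrier L" "\<And>f m. f \<in> carrier (A m) \<Longrightarrow> c m \<otimes>\<^bsub>A m\<^esub> f = (\<lambda>D. a \<otimes>\<^bsub>K\<^esub> f D)"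
      using scalar_mult[OF single(1)] by blast
    have sD: "single K D \<in> carrier (A (Suc k))" "single K (?\<sigma> D) \<in> carrier (A (Suc k))"
      using K.free_module_single[OF single(2)] K.free_module_single[OF funcset_mem[OF \<sigma> single(2)]] by auto
    have "?push (\<lambda>E. a \<otimes>\<^bsub>K\<^esub> single K D E) = (\<lambda>E. a \<otimes>\<^bsub>K\<^esub> single K (?\<sigma> D) E)"
      using lin(3)[OF single(1), of "single K D"] single(2)
      by (simp add: K.free_module_single K.pushforward_single[OF \<sigma>] del: Zp_simps)
    also have "\<dots> = c (Suc k) \<otimes>\<^bsub>A (Suc k)\<^esub> single K (?\<sigma> D)" using c(2)[OF sD(2)] by simp
    finally have push: "?push (\<lambda>E. a \<otimes>\<^bsub>K\<^esub> single K D E) = c (Suc k) \<otimes>\<^bsub>A (Suc k)\<^esub> single K (?\<sigma> D)" .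
    have "(\<lambda>E. a \<otimes>\<^bsub>K\<^esub> single K D E) = c (Suc k) \<otimes>\<^bsub>A (Suc k)\<^esub> (s (Suc k) \<oplus>\<^bsub>A (Suc k)\<^esub> single K (?\<sigma> D))"
      using c(2)[OF sD(1)] s(2) by simp
    also have "\<dots> = (c \<otimes>\<^bsub>L\<^esub> s) (Suc k) \<oplus>\<^bsub>A (Suc k)\<^esub> c (Suc k) \<otimes>\<^bsub>A (Suc k)\<^esub> single K (?\<sigma> D)"
      using sD component_closed[OF c(1)] component_closed[OF aug_ideal_closed[OF s(1)]]
      by (simp add: A.r_distr del: group_ring_simps)
    finally show ?case using aug_ideal_mult[OF c(1) s(1)] unfolding push by blast
  qed
  then obtain s where s: "s \<in> aug_ideal k" "f = s (Suc k) \<oplus>\<^bsub>A (Suc k)\<^esub> ?push f" by blast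
  have "?push f = pushforward K (carrier (G (Suc k))) rep (pushforward K (carrier (G k)) (transition k) f)"
    by (rule K.pushforward_compose[OF transition_funcset rep_funcset f', symmetric])
  also have "\<dots> = \<zero>\<^bsub>A (Suc k)\<^esub>"
    unfolding ker
    using linear_maps_zero[OF K.module_free_module K.module_free_module K.pushforward_linear[OF rep_funcset]] by simp
  finally have "f = s (Suc k)"
    using s component_closed[OF aug_ideal_closed[OF s(1)], of "Suc k"] by (simp del: group_ring_simps)
  with s(1) show ?thesis by blast
qed

text \<open>One correction step: subtracting an element of the ideal of level k pushes the vanishing
  of \<open>z\<close> one layer up.\<close>

lemma kernel_step:
  assumes z: "z \<in> carrier L" and zero: "z k = \<zero>\<^bsub>A k\<^esub>"
  shows "\<exists>s\<in>aug_ideal k. (z \<ominus>\<^bsub>L\<^esub> s) (Suc k) = \<zero>\<^bsub>A (Suc k)\<^esub>"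
proof -
  have "pushforward K (carrier (G k)) (transition k) (z (Suc k)) = \<zero>\<^bsub>A k\<^esub>"
    using z zero L_carrier by simp
  from kernel_transition[OF component_closed[OF z] this]
  obtain s where s: "s \<in> aug_ideal k" "s (Suc k) = z (Suc k)" by blast
  then show ?thesis
    using z component_closed[OF z] aug_ideal_closed[OF s(1)]
    by (intro bexI[OF _ s(1)]) (simp add: component_minus A.r_neg a_minus_def[of "A (Suc k)"] del: group_ring_simps)
qed

text \<open>The factor is \<open>1 + x + \<dots> + x\<^sup>n\<^sup>-\<^sup>1\<close>, which acts as \<open>n\<close> on every layer in which \<open>x\<close> becomes trivial.\<close>

lemma geometric_factor:
  assumes x: "x \<in> carrier \<Gamma>"
  shows "\<exists>\<phi>\<in>carrier L. group_like (x [^]\<^bsub>\<Gamma>\<^esub> n) \<ominus>\<^bsub>L\<^esub> \<one>\<^bsub>L\<^esub> = \<phi> \<otimes>\<^bsub>L\<^esub> (group_like x \<ominus>\<^bsub>L\<^esub> \<one>\<^bsub>L\<^esub>) \<and>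
    (\<forall>z\<in>carrier L. \<forall>j. coset j x = \<one>\<^bsub>G j\<^esub> \<longrightarrow>
       (\<forall>D r. (\<phi> \<otimes>\<^bsub>L\<^esub> z) j D r = int n * z j D r mod int p ^ Suc r))"
proof (induction n)
  case 0
  have "group_like (x [^]\<^bsub>\<Gamma>\<^esub> (0::nat)) \<ominus>\<^bsub>L\<^esub> \<one>\<^bsub>L\<^esub> = \<zero>\<^bsub>L\<^esub> \<otimes>\<^bsub>L\<^esub> (group_like x \<ominus>\<^bsub>L\<^esub> \<one>\<^bsub>L\<^esub>)"
    using x by (simp add: group_like_one a_minus_def[of L] L.r_neg del: L_simps)
  moreover have "(\<zero>\<^bsub>L\<^esub> \<otimes>\<^bsub>L\<^esub> z) j D r = 0" if "z \<in> carrier L" for z j D r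
    using L.l_null[OF that] by simp
  ultimately show ?case
    by (intro bexI[OF _ L.zero_closed] conjI ballI allI impI) (simp_all only: of_nat_0 mult_zero_left mod_0)
next
  case (Suc n)
  then obtain \<phi> where \<phi>: "\<phi> \<in> carrier L"
      "group_like (x [^]\<^bsub>\<Gamma>\<^esub> n) \<ominus>\<^bsub>L\<^esub> \<one>\<^bsub>L\<^esub> = \<phi> \<otimes>\<^bsub>L\<^esub> (group_like x \<ominus>\<^bsub>L\<^esub> \<one>\<^bsub>L\<^esub>)"
      "\<And>z j D r. z \<in> carrier L \<Longrightarrow> coset j x = \<one>\<^bsub>G j\<^esub> \<Longrightarrow> (\<phi> \<otimes>\<^bsub>L\<^esub> z) j D r = int n * z j D r mod int p ^ Suc r"
    by blast
  let ?y = "group_like (x [^]\<^bsub>\<Gamma>\<^esub> n)"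
  have y: "?y \<in> carrier L" "group_like x \<in> carrier L" using x by auto
  have "group_like (x [^]\<^bsub>\<Gamma>\<^esub> Suc n) \<ominus>\<^bsub>L\<^esub> \<one>\<^bsub>L\<^esub> = ?y \<otimes>\<^bsub>L\<^esub> group_like x \<ominus>\<^bsub>L\<^esub> \<one>\<^bsub>L\<^esub>"
    using x by (simp add: group_like_mult del: L_simps)
  \<comment> \<open>The geometric sum is extended by its next term x^n.\<close>
  also have "\<dots> = (?y \<oplus>\<^bsub>L\<^esub> \<phi>) \<otimes>\<^bsub>L\<^esub> (group_like x \<ominus>\<^bsub>L\<^esub> \<one>\<^bsub>L\<^esub>)"
    unfolding L.mult_minus_one[OF y] \<phi>(2) using y \<phi>(1)
    by (simp add: L.l_distr del: L_simps)
  finally have eq: "group_like (x [^]\<^bsub>\<Gamma>\<^esub> Suc n) \<ominus>\<^bsub>L\<^esub> \<one>\<^bsub>L\<^esub> = (?y \<oplus>\<^bsub>L\<^esub> \<phi>) \<otimes>\<^bsub>L\<^esub> (group_like x \<ominus>\<^bsub>L\<^esub> \<one>\<^bsub>L\<^esub>)" .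
  have "((?y \<oplus>\<^bsub>L\<^esub> \<phi>) \<otimes>\<^bsub>L\<^esub> z) j D r = int (Suc n) * z j D r mod int p ^ Suc r"
    if z: "z \<in> carrier L" and j: "coset j x = \<one>\<^bsub>G j\<^esub>" for z j D r
  proof -
    have "coset j (x [^]\<^bsub>\<Gamma>\<^esub> n) = \<one>\<^bsub>G j\<^esub>"
      by (induction n) (use x j in \<open>simp_all add: coset_one coset_mult\<close>)
    then have "(?y \<otimes>\<^bsub>L\<^esub> z) j = \<one>\<^bsub>A j\<^esub> \<otimes>\<^bsub>A j\<^esub> z j"
      using x by (simp add: group_like_component)
    also have "\<dots> = z j" by (rule A.l_one[OF component_closed[OF z]])
    finally have 1: "(?y \<otimes>\<^bsub>L\<^esub> z) j D r = z j D r" by simp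
    have "(?y \<oplus>\<^bsub>L\<^esub> \<phi>) \<otimes>\<^bsub>L\<^esub> z = ?y \<otimes>\<^bsub>L\<^esub> z \<oplus>\<^bsub>L\<^esub> \<phi> \<otimes>\<^bsub>L\<^esub> z"
      by (rule L.l_distr[OF y(1) \<phi>(1) z])
    then have "((?y \<oplus>\<^bsub>L\<^esub> \<phi>) \<otimes>\<^bsub>L\<^esub> z) j D r =
        ((?y \<otimes>\<^bsub>L\<^esub> z) j D r + (\<phi> \<otimes>\<^bsub>L\<^esub> z) j D r) mod int p ^ Suc r"
      by (simp only: L_add_apply)
    also have "\<dots> = (z j D r + int n * z j D r) mod int p ^ Suc r"
      unfolding 1 \<phi>(3)[OF z j] by (rule mod_add_right_eq)
    finally show ?thesis by (simp add: algebra_simps)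
  qed
  with eq y \<phi>(1) show ?case
    by (intro bexI[of _ "?y \<oplus>\<^bsub>L\<^esub> \<phi>"] conjI ballI allI impI) (auto simp del: L_simps power_Suc)
qed

text \<open>Passing from t to t + 1 multiplies the cofactor by 1 + x + ... + x^(p-1) with x =
  gamma_i^(p^(m+t)). In every layer j with j at most m + t the element x is trivial, the sum acts as
  p, and one more p-adic digit vanishes.\<close>

lemma aug_factor:
  assumes i: "i \<in> {1..l}"
  shows "\<exists>\<nu>\<in>filtration t. aug (m + t) i = \<nu> \<otimes>\<^bsub>L\<^esub> aug m i"
proof (induction t)
  case 0
  show ?case
    using aug_closed[OF i, of m]
    by (intro bexI[of _ "\<one>\<^bsub>L\<^esub>"]) (simp_all add: filtration_def del: L_simps)
next
  case (Suc t)
  then obtain \<nu> where \<nu>: "\<nu> \<in> filtration t" "aug (m + t) i = \<nu> \<otimes>\<^bsub>L\<^esub> aug m i" by blast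
  let ?x = "\<gamma> i [^]\<^bsub>\<Gamma>\<^esub> (p ^ (m + t))"
  have x: "?x \<in> carrier \<Gamma>" using \<gamma>_closed[OF i] by simp
  obtain \<phi> where \<phi>: "\<phi> \<in> carrier L"
      "group_like (?x [^]\<^bsub>\<Gamma>\<^esub> p) \<ominus>\<^bsub>L\<^esub> \<one>\<^bsub>L\<^esub> = \<phi> \<otimes>\<^bsub>L\<^esub> (group_like ?x \<ominus>\<^bsub>L\<^esub> \<one>\<^bsub>L\<^esub>)"
      "\<And>z j D r. z \<in> carrier L \<Longrightarrow> coset j ?x = \<one>\<^bsub>G j\<^esub> \<Longrightarrow> (\<phi> \<otimes>\<^bsub>L\<^esub> z) j D r = int p * z j D r mod int p ^ Suc r"
    using geometric_factor[OF x, of p] by blast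
  have \<nu>L: "\<nu> \<in> carrier L" by (rule filtration_closed[OF \<nu>(1)])
  have "?x [^]\<^bsub>\<Gamma>\<^esub> p = \<gamma> i [^]\<^bsub>\<Gamma>\<^esub> (p ^ (m + Suc t))"
    using \<gamma>_closed[OF i] by (simp add: \<Gamma>.nat_pow_pow mult.commute)
  then have "aug (m + Suc t) i = \<phi> \<otimes>\<^bsub>L\<^esub> aug (m + t) i" using \<phi>(2) by (simp only: aug_def)
  also have "\<dots> = (\<phi> \<otimes>\<^bsub>L\<^esub> \<nu>) \<otimes>\<^bsub>L\<^esub> aug m i"
    unfolding \<nu>(2) by (rule L.m_assoc[OF \<phi>(1) \<nu>L aug_closed[OF i], symmetric])
  finally have eq: "aug (m + Suc t) i = (\<phi> \<otimes>\<^bsub>L\<^esub> \<nu>) \<otimes>\<^bsub>L\<^esub> aug m i" .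
  have "(\<phi> \<otimes>\<^bsub>L\<^esub> \<nu>) j D r = 0" if jr: "j + r < Suc t" for j D r
  proof -
    \<comment> \<open>The bound j + r < t + 1 forces j to be at most t, so \<open>?x\<close> is a
      p^j-th power and trivial in layer j.\<close>
    have "m + t = j + (m + t - j)" using jr by simp
    then have "?x = (\<gamma> i [^]\<^bsub>\<Gamma>\<^esub> (p ^ (m + t - j))) [^]\<^bsub>\<Gamma>\<^esub> (p ^ j)"
      using \<gamma>_closed[OF i] by (metis \<Gamma>.nat_pow_pow mult.commute power_add)
    then have "coset j ?x = \<one>\<^bsub>G j\<^esub>"
      using \<gamma>_closed[OF i] by (metis coset_powers powers_pow \<Gamma>.nat_pow_closed)
    from \<phi>(3)[OF \<nu>L this]
    have "(\<phi> \<otimes>\<^bsub>L\<^esub> \<nu>) j D r = int p * \<nu> j D r mod int p ^ Suc r" .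
    also have "int p ^ Suc r dvd int p * \<nu> j D r"
    \<comment> \<open>For r = 0 the new factor p suffices by itself. Otherwise \<nu> already
      vanishes at precision r - 1, its residue at precision r is divisible by p^r, and the factor p
      completes p^(r+1).\<close>
    proof (cases r)
      case (Suc r')
      have "\<nu> j D (Suc r') mod int p ^ Suc r' = \<nu> j D r'"
        using coefficient_closed[OF \<nu>L, of j D] by (simp add: Zp_carrier del: power_Suc)
      also have "\<dots> = 0" using \<nu>(1) jr Suc by (simp add: filtration_def)
      finally have "int p ^ Suc r' dvd \<nu> j D r" unfolding Suc by (simp add: mod_eq_0_iff_dvd del: power_Suc)
      then show ?thesis unfolding Suc by (subst power_Suc) (intro mult_dvd_mono dvd_refl)
    qed simp
    then have "int p * \<nu> j D r mod int p ^ Suc r = 0" by (rule dvd_imp_mod_0)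
    finally show ?thesis .
  qed
  then have "\<phi> \<otimes>\<^bsub>L\<^esub> \<nu> \<in> filtration (Suc t)"
    using L.m_closed[OF \<phi>(1) \<nu>L] unfolding filtration_def by blast
  with eq show ?case by blast
qed

text \<open>Corrections found at level m + t are rewritten over the fixed generators of level m,
  with coefficients that become small as t grows.\<close>

lemma aug_ideal_factor:
  assumes "s \<in> aug_ideal (m + t)"
  obtains w where "\<And>i. i \<in> {1..l} \<Longrightarrow> w i \<in> filtration t"
    and "s = (\<Oplus>\<^bsub>L\<^esub>i\<in>{1..l}. w i \<otimes>\<^bsub>L\<^esub> aug m i)"
proof -
  obtain u where u: "u \<in> {1..l} \<rightarrow> carrier L" "s = (\<Oplus>\<^bsub>L\<^esub>i\<in>{1..l}. u i \<otimes>\<^bsub>L\<^esub> aug (m + t) i)"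
    using assms by (auto simp: aug_ideal_def)
  obtain \<nu> where \<nu>: "\<And>i. i \<in> {1..l} \<Longrightarrow> \<nu> i \<in> filtration t"
      "\<And>i. i \<in> {1..l} \<Longrightarrow> aug (m + t) i = \<nu> i \<otimes>\<^bsub>L\<^esub> aug m i"
    using aug_factor[of _ t m] by metis
  have ui: "u i \<in> carrier L" if "i \<in> {1..l}" for i using u(1) that by auto
  have "s = (\<Oplus>\<^bsub>L\<^esub>i\<in>{1..l}. (u i \<otimes>\<^bsub>L\<^esub> \<nu> i) \<otimes>\<^bsub>L\<^esub> aug m i)"
    unfolding u(2)
  proof (rule L.finsum_cong'[OF refl])
    show "(\<lambda>i. (u i \<otimes>\<^bsub>L\<^esub> \<nu> i) \<otimes>\<^bsub>L\<^esub> aug m i) \<in> {1..l} \<rightarrow> carrier L"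
      by (intro funcsetI L.m_closed ui filtration_closed[OF \<nu>(1)] aug_closed)
    fix i assume i: "i \<in> {1..l}"
    show "u i \<otimes>\<^bsub>L\<^esub> aug (m + t) i = (u i \<otimes>\<^bsub>L\<^esub> \<nu> i) \<otimes>\<^bsub>L\<^esub> aug m i"
      unfolding \<nu>(2)[OF i] by (rule L.m_assoc[OF ui[OF i] filtration_closed[OF \<nu>(1)[OF i]] aug_closed[OF i], symmetric])
  qed
  with that[of "\<lambda>i. u i \<otimes>\<^bsub>L\<^esub> \<nu> i"] filtration_mult[OF ui \<nu>(1)] show thesis by blast
qed

text \<open>Successive approximation of \<open>z\<close> by combinations of the generators. Limits
  are taken in each of the \<open>l\<close> coefficients separately, so the limit is again a
  combination of the same generators and no closedness of the ideal has to be known.\<close>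

theorem component_kernel:
  assumes z: "z \<in> carrier L" and zero: "z m = \<zero>\<^bsub>A m\<^esub>"
  shows "z \<in> aug_ideal m"
proof -
  let ?comb = "\<lambda>W. \<Oplus>\<^bsub>L\<^esub>i\<in>{1..l}. W i \<otimes>\<^bsub>L\<^esub> aug m i"
  have comb_closed: "?comb W \<in> carrier L" if "W \<in> {1..l} \<rightarrow> carrier L" for W
    using that by (intro L.finsum_closed funcsetI L.m_closed aug_closed) auto
  have comb_add: "?comb (\<lambda>i. W i \<oplus>\<^bsub>L\<^esub> w i) = ?comb W \<oplus>\<^bsub>L\<^esub> ?comb w"
    if W: "W \<in> {1..l} \<rightarrow> carrier L" and w: "w \<in> {1..l} \<rightarrow> carrier L" for W w
  proof -
    have "?comb (\<lambda>i. W i \<oplus>\<^bsub>L\<^esub> w i) = (\<Oplus>\<^bsub>L\<^esub>i\<in>{1..l}. W i \<otimes>\<^bsub>L\<^esub> aug m i \<oplus>\<^bsub>L\<^esub> w i \<otimes>\<^bsub>L\<^esub> aug m i)"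
      using funcset_mem[OF W] funcset_mem[OF w] aug_closed
      by (intro L.finsum_cong' refl funcsetI) (auto simp: L.l_distr simp del: L_simps)
    also have "\<dots> = ?comb W \<oplus>\<^bsub>L\<^esub> ?comb w"
      using funcset_mem[OF W] funcset_mem[OF w] aug_closed
      by (intro L.finsum_addf funcsetI L.m_closed) auto
    finally show ?thesis .
  qed
  \<comment> \<open>\<open>?P\<close> keeps the remainder zero in layer m + t. \<open>?Q\<close>
    makes the coefficients a Cauchy sequence by allowing the step from t to t + 1 to change them
    only within \<open>filtration t\<close>.\<close>
  let ?P = "\<lambda>t W. W \<in> {1..l} \<rightarrow> carrier L \<and> (z \<ominus>\<^bsub>L\<^esub> ?comb W) (m + t) = \<zero>\<^bsub>A (m + t)\<^esub>"
  let ?Q = "\<lambda>t W W'. \<forall>i\<in>{1..l}. \<exists>w\<in>filtration t. W' i = W i \<oplus>\<^bsub>L\<^esub> w"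
  have "\<exists>W. \<forall>t. ?P t (W t) \<and> ?Q t (W t) (W (Suc t))"
  proof (rule dependent_nat_choice)
    have "?comb (\<lambda>_. \<zero>\<^bsub>L\<^esub>) = (\<Oplus>\<^bsub>L\<^esub>i\<in>{1..l}. \<zero>\<^bsub>L\<^esub>)"
      using aug_closed by (intro L.finsum_cong') (auto simp del: L_simps)
    then have "?comb (\<lambda>_. \<zero>\<^bsub>L\<^esub>) = \<zero>\<^bsub>L\<^esub>" by (simp only: L.finsum_zero)
    then have "z \<ominus>\<^bsub>L\<^esub> ?comb (\<lambda>_. \<zero>\<^bsub>L\<^esub>) = z"
      using z by (simp only: a_minus_def[of L] L.minus_zero L.r_zero)
    then have "?P 0 (\<lambda>_. \<zero>\<^bsub>L\<^esub>)" using zero by (auto simp del: L_simps)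
    then show "\<exists>W. ?P 0 W" by blast
  next
    fix W t assume "?P t W"
    then have W: "W \<in> {1..l} \<rightarrow> carrier L" and zW: "(z \<ominus>\<^bsub>L\<^esub> ?comb W) (m + t) = \<zero>\<^bsub>A (m + t)\<^esub>" by auto
    obtain s where s: "s \<in> aug_ideal (m + t)"
        "(z \<ominus>\<^bsub>L\<^esub> ?comb W \<ominus>\<^bsub>L\<^esub> s) (Suc (m + t)) = \<zero>\<^bsub>A (Suc (m + t))\<^esub>"
      using kernel_step[OF L.minus_closed[OF z comb_closed[OF W]] zW] by blast
    obtain w where w: "\<And>i. i \<in> {1..l} \<Longrightarrow> w i \<in> filtration t" "s = ?comb w"
      by (rule aug_ideal_factor[OF s(1)]) blast
    have w': "w \<in> {1..l} \<rightarrow> carrier L" using w(1) filtration_closed by blast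
    have "z \<ominus>\<^bsub>L\<^esub> ?comb (\<lambda>i. W i \<oplus>\<^bsub>L\<^esub> w i) = z \<ominus>\<^bsub>L\<^esub> ?comb W \<ominus>\<^bsub>L\<^esub> s"
      unfolding comb_add[OF W w'] w(2) by (rule L.diff_diff_sum[OF z comb_closed[OF W] comb_closed[OF w']])
    moreover have "(\<lambda>i. W i \<oplus>\<^bsub>L\<^esub> w i) \<in> {1..l} \<rightarrow> carrier L"
      using funcset_mem[OF W] funcset_mem[OF w'] by (intro funcsetI L.a_closed)
    ultimately have "?P (Suc t) (\<lambda>i. W i \<oplus>\<^bsub>L\<^esub> w i)" using s(2) by (simp only: add_Suc_right simp_thms)
    moreover have "?Q t W (\<lambda>i. W i \<oplus>\<^bsub>L\<^esub> w i)" using w(1) by blast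
    ultimately show "\<exists>W'. ?P (Suc t) W' \<and> ?Q t W W'" by blast
  qed
  then obtain W where W: "\<And>t. W t \<in> {1..l} \<rightarrow> carrier L"
      "\<And>t. (z \<ominus>\<^bsub>L\<^esub> ?comb (W t)) (m + t) = \<zero>\<^bsub>A (m + t)\<^esub>"
      "\<And>t i. i \<in> {1..l} \<Longrightarrow> \<exists>w\<in>filtration t. W (Suc t) i = W t i \<oplus>\<^bsub>L\<^esub> w" by blast
  have "\<exists>y\<in>carrier L. \<forall>t. y \<ominus>\<^bsub>L\<^esub> W t i \<in> filtration t" if "i \<in> {1..l}" for i
    by (rule filtration_complete[of "\<lambda>t. W t i", OF funcset_mem[OF W(1) that] W(3)[OF that]]) blast
  then obtain y where y: "\<And>i. i \<in> {1..l} \<Longrightarrow> y i \<in> carrier L"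
    "\<And>i t. i \<in> {1..l} \<Longrightarrow> y i \<ominus>\<^bsub>L\<^esub> W t i \<in> filtration t" by metis
  have y': "y \<in> {1..l} \<rightarrow> carrier L" using y(1) by blast
  have "z \<ominus>\<^bsub>L\<^esub> ?comb y \<in> filtration t" for t
  proof -
    let ?d = "\<lambda>i. y i \<ominus>\<^bsub>L\<^esub> W t i"
    have d: "?d \<in> {1..l} \<rightarrow> carrier L" using filtration_closed[OF y(2)] by blast
    have "?comb y = ?comb (\<lambda>i. ?d i \<oplus>\<^bsub>L\<^esub> W t i)"
    proof (rule L.finsum_cong'[OF refl])
      show "(\<lambda>i. (?d i \<oplus>\<^bsub>L\<^esub> W t i) \<otimes>\<^bsub>L\<^esub> aug m i) \<in> {1..l} \<rightarrow> carrier L"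
        by (intro funcsetI L.m_closed L.a_closed funcset_mem[OF d] funcset_mem[OF W(1)] aug_closed)
      fix i assume i: "i \<in> {1..l}"
      show "y i \<otimes>\<^bsub>L\<^esub> aug m i = (?d i \<oplus>\<^bsub>L\<^esub> W t i) \<otimes>\<^bsub>L\<^esub> aug m i"
        unfolding L.diff_add_eq[OF y(1)[OF i] funcset_mem[OF W(1) i]] ..
    qed
    also have "\<dots> = ?comb ?d \<oplus>\<^bsub>L\<^esub> ?comb (W t)" by (rule comb_add[OF d W(1)])
    also have "\<dots> = ?comb (W t) \<oplus>\<^bsub>L\<^esub> ?comb ?d" by (rule L.a_comm[OF comb_closed[OF d] comb_closed[OF W(1)]])
    finally have "z \<ominus>\<^bsub>L\<^esub> ?comb y = (z \<ominus>\<^bsub>L\<^esub> ?comb (W t)) \<ominus>\<^bsub>L\<^esub> ?comb ?d"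
      using L.diff_diff_sum[OF z comb_closed[OF W(1)] comb_closed[OF d]] by simp
    \<comment> \<open>Both parts of the remainder are small: this one since it vanishes in layer m +
      t, the next one since its coefficients are limits minus approximants.\<close>
    moreover have "z \<ominus>\<^bsub>L\<^esub> ?comb (W t) \<in> filtration t"
      by (rule filtration_zeroI[OF L.minus_closed[OF z comb_closed[OF W(1)]] W(2)]) simp
    moreover have "?comb ?d \<in> filtration t"
      by (intro filtration_finsum funcsetI filtration_mult' aug_closed y(2))
    ultimately show ?thesis using filtration_minus by simp
  qed
  then have "z \<ominus>\<^bsub>L\<^esub> ?comb y = \<zero>\<^bsub>L\<^esub>"
    by (intro filtration_separated L.minus_closed z comb_closed[OF y'])
  then have "z = ?comb y" by (rule L.minus_eq_zeroD[OF z comb_closed[OF y']])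
  then show ?thesis unfolding aug_ideal_def using y' by blast
qed

end

section \<open>Laplacians of the layers\<close>

text \<open>The canonical map from the integers to Z_p. Degrees and edge counts are compared in the
  integers and then mapped.\<close>

definition zp_int :: "nat \<Rightarrow> int \<Rightarrow> nat \<Rightarrow> int" where
  "zp_int p k = (\<lambda>r. k mod int p ^ Suc r)"

section \<open>Integers inside the p-adic integers\<close>

context iwasawa_algebra
begin

abbreviation "\<iota> \<equiv> zp_int p"

lemma zp_int_closed: "\<iota> k \<in> carrier K"
proof -
  have "0 < int p" using prime_gt_0_nat[OF prime_p] by simp
  then have p0: "0 < int p ^ Suc r" for r by (intro zero_less_power)
  have "int p ^ Suc r dvd int p ^ Suc (Suc r)" for r by (intro le_imp_power_dvd) simp
  then show ?thesis
    using pos_mod_sign[OF p0] pos_mod_bound[OF p0]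
    by (simp add: Zp_carrier zp_int_def mod_mod_cancel del: power_Suc)
qed

lemma zp_int_add: "\<iota> a \<oplus>\<^bsub>K\<^esub> \<iota> b = \<iota> (a + b)"
  by (simp add: zp_int_def mod_add_eq del: power_Suc)

lemma zp_int_zero: "\<iota> 0 = \<zero>\<^bsub>K\<^esub>"
  by (simp add: zp_int_def)

lemma zp_int_one: "\<iota> 1 = \<one>\<^bsub>K\<^esub>"
proof -
  have "1 < int p ^ Suc r" for r
    using prime_gt_1_nat[OF prime_p] by (intro one_less_power) auto
  then show ?thesis by (simp add: zp_int_def del: power_Suc)
qed

lemma zp_int_uminus: "\<ominus>\<^bsub>K\<^esub> \<iota> a = \<iota> (- a)"
  by (rule K.minus_equality) (auto simp: zp_int_add zp_int_zero zp_int_closed simp del: Zp_simps)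

lemma zp_int_minus: "\<iota> a \<ominus>\<^bsub>K\<^esub> \<iota> b = \<iota> (a - b)"
  by (simp add: a_minus_def zp_int_uminus zp_int_add del: Zp_simps)

lemma add_pow_nat_one: "add_pow K (k :: nat) \<one>\<^bsub>K\<^esub> = \<iota> (int k)"
proof (induction k)
  case (Suc k)
  have "add_pow K (Suc k) \<one>\<^bsub>K\<^esub> = add_pow K k \<one>\<^bsub>K\<^esub> \<oplus>\<^bsub>K\<^esub> \<one>\<^bsub>K\<^esub>"
    by (rule K.add.nat_pow_Suc)
  also have "\<dots> = \<iota> (int k) \<oplus>\<^bsub>K\<^esub> \<iota> 1" by (simp only: Suc zp_int_one)
  also have "\<dots> = \<iota> (int (Suc k))" by (simp only: zp_int_add of_nat_Suc add.commute)
  finally show ?case .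
qed (simp add: zp_int_zero del: Zp_simps)

lemma add_pow_int_one: "add_pow K (k :: int) \<one>\<^bsub>K\<^esub> = \<iota> k"
proof (cases k rule: int_cases2)
  case (nonneg n)
  then show ?thesis using add_pow_nat_one[of n] by (simp add: add_pow_def int_pow_int)
next
  case (nonpos n)
  then show ?thesis
    using K.add.int_pow_neg[of "\<one>\<^bsub>K\<^esub>" "int n"] add_pow_nat_one[of n] zp_int_uminus[of "int n"]
    by (simp add: add_pow_def int_pow_int del: Zp_simps)
qed

lemma finsum_zp_int: "(\<Oplus>\<^bsub>K\<^esub>i\<in>I. \<iota> (f i)) = \<iota> (sum f I)"
proof (induction I rule: infinite_finite_induct)
  case (insert i I)
  then show ?case by (subst K.finsum_insert) (auto simp: zp_int_closed zp_int_add simp del: Zp_simps)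
qed (simp_all add: zp_int_zero K.finsum_infinite del: Zp_simps)

lemma single_zp_int: "single K a b = \<iota> (if b = a then 1 else 0)"
  by (simp add: single_def zp_int_one zp_int_zero del: Zp_simps)

text \<open>Finite sums use only zero and addition, which a group ring shares with the underlying
  free module.\<close>

lemma finsum_group_ring [simp]: "finsum (group_ring R H) f I = finsum (free_module R (carrier H)) f I"
  by (simp add: finsum_def finprod_def)

lemma finsum_free_module_apply:
  assumes "F \<in> I \<rightarrow> carrier (free_module K B)"
  shows "finsum (free_module K B) F I b = (\<Oplus>\<^bsub>K\<^esub>i\<in>I. F i b)"
  using linear_maps_finsum[OF K.module_free_module module_self_module[OF K.is_cring] K.evaluation_linear assms]
  by simp

end

section \<open>Local structure of the layers\<close>

locale voltage_graph = iwasawa_generators p \<Gamma> l \<gamma> + X: fin_digraph X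
  for p :: nat and \<Gamma> :: "('g, 'm) monoid_scheme" and l :: nat and \<gamma> :: "nat \<Rightarrow> 'g"
    and X :: "('v, 'e) pre_digraph" +
  fixes \<alpha> :: "'e \<Rightarrow> 'g" and n :: nat and v :: "nat \<Rightarrow> 'v"
  assumes voltage: "\<alpha> \<in> arcs X \<rightarrow> carrier \<Gamma>" and numbering: "bij_betw v {1..n} (verts X)"
begin

abbreviation "Y m \<equiv> X_layer p \<Gamma> X \<alpha> m"

text \<open>Both orientations are counted, so for \<open>u = w\<close> each loop occurs twice. This
  is how the case distinctions for loops in \<open>A_entry\<close> and \<open>principal\<close>
  merge into one formula.\<close>

definition edges_between :: "'v \<Rightarrow> 'v \<Rightarrow> ('e \<times> bool) set" where
  "edges_between u w = {d \<in> directed_edges X. dsource X d = u \<and> dtarget X d = w}"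

lemma voltage_closed: "e \<in> arcs X \<Longrightarrow> \<alpha> e \<in> carrier \<Gamma>"
  using voltage by auto

lemma dvoltage_closed: "d \<in> directed_edges X \<Longrightarrow> dvoltage \<Gamma> \<alpha> d \<in> carrier \<Gamma>"
  by (cases d) (auto simp: directed_edges_def voltage_closed)

lemma finite_directed_edges: "finite (directed_edges X)"
  by (simp add: directed_edges_def)

lemma finite_edges_between: "finite (edges_between u w)"
  unfolding edges_between_def by (rule finite_subset[OF _ finite_directed_edges]) auto

lemma Y_simps [simp]:
  "verts (Y m) = verts X \<times> carrier (G m)" "arcs (Y m) = arcs X \<times> carrier (G m)"
  "tail (Y m) (e, g) = (tail X e, g)" "head (Y m) (e, g) = (head X e, g \<otimes>\<^bsub>G m\<^esub> coset m (\<alpha> e))"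
  by (simp_all add: X_layer_def derived_graph_def)

lemma coset_inv: "x \<in> carrier \<Gamma> \<Longrightarrow> coset m (inv\<^bsub>\<Gamma>\<^esub> x) = inv\<^bsub>G m\<^esub> (coset m x)"
proof -
  interpret h: group_hom \<Gamma> "G m" "coset m"
    by (intro group_hom.intro group_hom_axioms.intro \<Gamma>.is_group G.is_group coset_hom)
  show "x \<in> carrier \<Gamma> \<Longrightarrow> ?thesis" by simp
qed

text \<open>The projection of a layer to the base graph is bijective on the arcs leaving and on the
  arcs entering a given vertex.\<close>

lemma mdegree_layer:
  assumes "g \<in> carrier (G m)" shows "mdegree (Y m) (u, g) = mdegree X u"
proof -
  note c = coset_closed[OF voltage_closed]
  have "out_arcs (Y m) (u, g) = (\<lambda>e. (e, g)) ` out_arcs X u"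
    using assms by (auto simp: out_arcs_def)
  then have "out_degree (Y m) (u, g) = out_degree X u"
    by (simp add: out_degree_def card_image inj_on_def)
  \<comment> \<open>An arc of the layer carries the label of its tail, so the arc over
    \<open>e\<close> that ends on sheet g is labelled by g times the inverse of the voltage.\<close>
  moreover have "in_arcs (Y m) (u, g) = (\<lambda>e. (e, g \<otimes>\<^bsub>G m\<^esub> inv\<^bsub>G m\<^esub> (coset m (\<alpha> e)))) ` in_arcs X u"
    using assms c by (auto simp: in_arcs_def image_iff G.m_assoc)
  then have "in_degree (Y m) (u, g) = in_degree X u"
    by (simp add: in_degree_def card_image inj_on_def)
  ultimately show ?thesis by (simp add: mdegree_def)
qed

text \<open>One formula for both cases in the definition of \<open>principal\<close>: lifted to
  sheet \<open>g\<close>, a directed edge ends on the sheet given by \<open>g\<close> times its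
  voltage, and the edges ending at (w, h) are counted.\<close>

lemma principal_layer:
  assumes g: "g \<in> carrier (G m)" and h: "h \<in> carrier (G m)"
  shows "principal K (Y m) (u, g) (w, h) =
    \<iota> ((if u = w \<and> g = h then int (mdegree X u) else 0)
       - int (card {d \<in> edges_between u w. g \<otimes>\<^bsub>G m\<^esub> coset m (dvoltage \<Gamma> \<alpha> d) = h}))"
proof (cases "u = w \<and> g = h")
  case True
  let ?L = "{e \<in> loops_at X u. coset m (\<alpha> e) = \<one>\<^bsub>G m\<^esub>}"
  have c: "coset m (\<alpha> e) \<in> carrier (G m)" "\<alpha> e \<in> carrier \<Gamma>" if "e \<in> loops_at X u" for e
    using that by (auto simp: loops_at_def intro: coset_closed voltage_closed)
  have inv1: "inv\<^bsub>G m\<^esub> x = \<one>\<^bsub>G m\<^esub> \<longleftrightarrow> x = \<one>\<^bsub>G m\<^esub>" if "x \<in> carrier (G m)" for x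
    using that by (metis G.inv_inv G.inv_one)
  have "loops_at (Y m) (u, g) = (\<lambda>e. (e, g)) ` ?L"
    using g by (auto simp: loops_at_def coset_closed voltage_closed)
  then have "card (loops_at (Y m) (u, g)) = card ?L"
    by (simp add: card_image inj_on_def)
  \<comment> \<open>A loop of the base lifts to a loop exactly when its voltage is trivial in the
    layer; its two orientations give the factor 2 in front of the number of loops.\<close>
  moreover have "{d \<in> edges_between u u. g \<otimes>\<^bsub>G m\<^esub> coset m (dvoltage \<Gamma> \<alpha> d) = g} = ?L \<times> UNIV"
    using g c by (auto simp: edges_between_def directed_edges_def loops_at_def coset_inv inv1 split: if_splits)
  ultimately show ?thesis
    using True by (simp add: principal_def mdegree_layer[OF h] add_pow_int_one card_cartesian_product mult.commute del: Zp_simps)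
next
  case False
  let ?E = "{d \<in> edges_between u w. g \<otimes>\<^bsub>G m\<^esub> coset m (dvoltage \<Gamma> \<alpha> d) = h}"
  let ?F = "{a \<in> arcs (Y m). tail (Y m) a = (u, g) \<and> head (Y m) a = (w, h) \<or>
      tail (Y m) a = (w, h) \<and> head (Y m) a = (u, g)}"
  have c: "coset m (\<alpha> e) \<in> carrier (G m)" "\<alpha> e \<in> carrier \<Gamma>" if "e \<in> arcs X" for e
    using that by (auto intro: coset_closed voltage_closed)
  have inv: "g \<otimes>\<^bsub>G m\<^esub> inv\<^bsub>G m\<^esub> x = h \<longleftrightarrow> h \<otimes>\<^bsub>G m\<^esub> x = g" if "x \<in> carrier (G m)" for x
    using G.inv_solve_right[OF h g that] by (simp add: eq_commute)
  \<comment> \<open>The arc under a directed edge is labelled by the sheet of its tail: this is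
    \<open>g\<close> for a forward edge, and \<open>h\<close> for an edge traversed
    backwards.\<close>
  let ?f = "\<lambda>d. (fst d, if snd d then g else h)"
  have "bij_betw ?f ?E ?F"
  proof (rule bij_betw_imageI)
    show "inj_on ?f ?E"
    proof (rule inj_onI)
      \<comment> \<open>Opposite orientations of one edge could give the same arc only if both u = w
        and g = h, which is excluded.\<close>
      fix d d' assume "d \<in> ?E" "d' \<in> ?E" "?f d = ?f d'"
      moreover obtain e b e' b' where "d = (e, b)" "d' = (e', b')" by (metis surj_pair)
      ultimately show "d = d'"
        using False by (cases b; cases b') (auto simp: edges_between_def)
    qed
    show "?f ` ?E = ?F"
    proof (intro equalityI subsetI)
      fix a assume "a \<in> ?f ` ?E"
      then obtain e b where e: "(e, b) \<in> ?E" "a = (e, if b then g else h)" by auto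
      then have "e \<in> arcs X" by (simp add: edges_between_def directed_edges_def)
      note ce = c[OF this]
      from e show "a \<in> ?F"
        using g h \<open>e \<in> arcs X\<close> by (cases b) (auto simp: edges_between_def coset_inv[OF ce(2)] inv[OF ce(1)])
    next
      fix a assume a: "a \<in> ?F"
      obtain e k where ek: "a = (e, k)" by force
      from a consider "e \<in> arcs X" "tail X e = u" "k = g" "head X e = w" "g \<otimes>\<^bsub>G m\<^esub> coset m (\<alpha> e) = h"
        | "e \<in> arcs X" "tail X e = w" "k = h" "head X e = u" "h \<otimes>\<^bsub>G m\<^esub> coset m (\<alpha> e) = g"
        by (auto simp: ek)
      then show "a \<in> ?f ` ?E"
      proof cases
        case 1
        then show ?thesis
          by (intro image_eqI[where x = "(e, True)"]) (auto simp: ek edges_between_def directed_edges_def)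
      next
        case 2
        note ce = c[OF 2(1)]
        from 2 show ?thesis
          by (intro image_eqI[where x = "(e, False)"])
             (auto simp: ek edges_between_def directed_edges_def coset_inv[OF ce(2)] inv[OF ce(1)])
      qed
    qed
  qed
  then have "card ?E = card ?F" by (rule bij_betw_same_card)
  with False show ?thesis
    by (auto simp: principal_def edge_mult_def add_pow_int_one simp del: Zp_simps)
qed

text \<open>Row i of the Laplacian, reduced to layer m, lists the coefficients of the principal
  divisor at the vertex over v_i on the identity sheet. Reduction is a ring homomorphism, so degree
  part and adjacency part are computed separately.\<close>

lemma Laplacian_layer:
  assumes i: "i \<in> {1..n}" and j: "j \<in> {1..n}"
  shows "Laplacian_infty p \<Gamma> X \<alpha> v i j \<in> carrier (group_ring K \<Gamma>)"
    and "D \<in> carrier (G m) \<Longrightarrow>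
       toL (Laplacian_infty p \<Gamma> X \<alpha> v i j) m D = principal K (Y m) (v i, \<one>\<^bsub>G m\<^esub>) (v j, D)"
proof -
  let ?R = "group_ring K \<Gamma>"
  interpret R: cring ?R by (rule group_ring_setup.cring_group_ring[OF group_ring_setup_\<Gamma>])
  interpret h: ring_hom_cring ?R "A m" "\<lambda>r. toL r m"
  proof (intro ring_hom_cring.intro ring_hom_cring_axioms.intro R.is_cring A.is_cring)
    show "(\<lambda>r. toL r m) \<in> ring_hom ?R (A m)"
      using ring_hom_trans[OF to_Iwasawa_hom component_hom] by (simp add: comp_def)
  qed
  have inj: "v i = v j \<longleftrightarrow> i = j" by (rule inj_on_eq_iff[OF bij_betw_imp_inj_on[OF numbering] i j])
  have sing: "toL (single K x) m = single K (coset m x)" if "x \<in> carrier \<Gamma>" for x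
    using group_like_component[OF that] by (simp add: group_like_def)
  have D_closed: "D_entry p \<Gamma> X v i j \<in> carrier ?R"
    unfolding D_entry_def Let_def by (simp del: group_ring_simps)
  have D_apply: "toL (D_entry p \<Gamma> X v i j) m D = \<iota> (if i = j \<and> D = \<one>\<^bsub>G m\<^esub> then int (mdegree X (v i)) else 0)" for D
  proof -
    have "toL (add_pow ?R (k :: nat) \<one>\<^bsub>?R\<^esub>) m D = \<iota> (if D = \<one>\<^bsub>G m\<^esub> then int k else 0)" for k
    proof (induction k)
      case 0
      have "toL (add_pow ?R (0 :: nat) \<one>\<^bsub>?R\<^esub>) m = \<zero>\<^bsub>A m\<^esub>" using h.hom_zero by (simp del: group_ring_simps)
      then show ?case by (simp add: zp_int_zero)
    next
      case (Suc k)
      have "add_pow ?R (Suc k) \<one>\<^bsub>?R\<^esub> = add_pow ?R k \<one>\<^bsub>?R\<^esub> \<oplus>\<^bsub>?R\<^esub> \<one>\<^bsub>?R\<^esub>" by (rule R.add.nat_pow_Suc)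
      then have "toL (add_pow ?R (Suc k) \<one>\<^bsub>?R\<^esub>) m = toL (add_pow ?R k \<one>\<^bsub>?R\<^esub>) m \<oplus>\<^bsub>A m\<^esub> \<one>\<^bsub>A m\<^esub>"
        by (simp del: group_ring_simps)
      then have "toL (add_pow ?R (Suc k) \<one>\<^bsub>?R\<^esub>) m D =
          toL (add_pow ?R k \<one>\<^bsub>?R\<^esub>) m D \<oplus>\<^bsub>K\<^esub> single K \<one>\<^bsub>G m\<^esub> D"
        by (simp only: group_ring_simps)
      also have "\<dots> = \<iota> ((if D = \<one>\<^bsub>G m\<^esub> then int k else 0) + (if D = \<one>\<^bsub>G m\<^esub> then 1 else 0))"
        by (simp only: Suc single_zp_int zp_int_add)
      finally show ?case by (simp add: add.commute)
    qed
    moreover have "toL \<zero>\<^bsub>?R\<^esub> m D = \<iota> 0" using h.hom_zero by (simp add: zp_int_zero)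
    ultimately show ?thesis
      unfolding D_entry_def Let_def by (cases "i = j") (simp_all only: simp_thms if_True if_False)
  qed
  \<comment> \<open>For i = j the two summands of each loop are the contributions of its two
    orientations.\<close>
  have A_sum: "A_entry p \<Gamma> X \<alpha> v i j = (\<Oplus>\<^bsub>?R\<^esub>d\<in>edges_between (v i) (v j). single K (dvoltage \<Gamma> \<alpha> d))"
  proof (cases "i = j")
    case True
    have fin: "finite (loops_at X (v i))" by (rule finite_subset[OF _ X.finite_arcs]) (auto simp: loops_at_def)
    have \<alpha>: "\<alpha> e \<in> carrier \<Gamma>" if "e \<in> loops_at X (v i)" for e
      using that voltage_closed by (auto simp: loops_at_def)
    have E: "edges_between (v i) (v j) = (\<lambda>e. (e, True)) ` loops_at X (v i) \<union> (\<lambda>e. (e, False)) ` loops_at X (v i)"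
      using True by (auto simp: edges_between_def directed_edges_def loops_at_def image_iff split: if_splits)
    have "(\<Oplus>\<^bsub>?R\<^esub>d\<in>edges_between (v i) (v j). single K (dvoltage \<Gamma> \<alpha> d)) =
      (\<Oplus>\<^bsub>?R\<^esub>d\<in>(\<lambda>e. (e, True)) ` loops_at X (v i). single K (dvoltage \<Gamma> \<alpha> d)) \<oplus>\<^bsub>?R\<^esub>
      (\<Oplus>\<^bsub>?R\<^esub>d\<in>(\<lambda>e. (e, False)) ` loops_at X (v i). single K (dvoltage \<Gamma> \<alpha> d))"
      unfolding E using \<alpha> fin single_closed
      by (intro R.finsum_Un_disjoint) (auto simp del: group_ring_simps)
    also have "\<dots> = (\<Oplus>\<^bsub>?R\<^esub>e\<in>loops_at X (v i). single K (\<alpha> e)) \<oplus>\<^bsub>?R\<^esub>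
        (\<Oplus>\<^bsub>?R\<^esub>e\<in>loops_at X (v i). single K (inv\<^bsub>\<Gamma>\<^esub> (\<alpha> e)))"
      using \<alpha> single_closed
      by (subst (1 2) R.finsum_reindex) (auto simp: inj_on_def simp del: group_ring_simps finsum_group_ring)
    also have "\<dots> = (\<Oplus>\<^bsub>?R\<^esub>e\<in>loops_at X (v i). single K (\<alpha> e) \<oplus>\<^bsub>?R\<^esub> single K (inv\<^bsub>\<Gamma>\<^esub> (\<alpha> e)))"
      using \<alpha> single_closed by (intro R.finsum_addf[symmetric]) (auto simp del: group_ring_simps)
    finally show ?thesis using True by (simp add: A_entry_def Let_def)
  qed (simp add: A_entry_def Let_def edges_between_def)
  have Es: "single K (dvoltage \<Gamma> \<alpha> d) \<in> carrier ?R" if "d \<in> edges_between (v i) (v j)" for d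
    using that by (intro single_closed dvoltage_closed) (simp add: edges_between_def)
  have A_closed: "A_entry p \<Gamma> X \<alpha> v i j \<in> carrier ?R"
    unfolding A_sum by (rule R.finsum_closed) (use Es in blast)
  have A_apply: "toL (A_entry p \<Gamma> X \<alpha> v i j) m D =
      \<iota> (int (card {d \<in> edges_between (v i) (v j). coset m (dvoltage \<Gamma> \<alpha> d) = D}))" for D
  proof -
    have dc: "dvoltage \<Gamma> \<alpha> d \<in> carrier \<Gamma>" if "d \<in> edges_between (v i) (v j)" for d
      using that by (intro dvoltage_closed) (simp add: edges_between_def)
    have "toL (A_entry p \<Gamma> X \<alpha> v i j) m =
        (\<Oplus>\<^bsub>A m\<^esub>d\<in>edges_between (v i) (v j). toL (single K (dvoltage \<Gamma> \<alpha> d)) m)"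
      unfolding A_sum using h.hom_finsum[of "\<lambda>d. single K (dvoltage \<Gamma> \<alpha> d)"] Es
      by (simp add: comp_def Pi_iff del: group_ring_simps finsum_group_ring)
    also have "\<dots> = (\<Oplus>\<^bsub>A m\<^esub>d\<in>edges_between (v i) (v j). single K (coset m (dvoltage \<Gamma> \<alpha> d)))"
      using dc by (intro A.finsum_cong' refl funcsetI) (auto simp: sing intro!: K.free_module_single coset_closed)
    finally have "toL (A_entry p \<Gamma> X \<alpha> v i j) m D =
        (\<Oplus>\<^bsub>K\<^esub>d\<in>edges_between (v i) (v j). single K (coset m (dvoltage \<Gamma> \<alpha> d)) D)"
      using dc by (simp add: finsum_free_module_apply Pi_iff K.free_module_single coset_closed)
    also have "\<dots> = \<iota> (\<Sum>d\<in>edges_between (v i) (v j). if D = coset m (dvoltage \<Gamma> \<alpha> d) then 1 else 0)"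
      unfolding single_zp_int finsum_zp_int ..
    also have "(\<Sum>d\<in>edges_between (v i) (v j). if D = coset m (dvoltage \<Gamma> \<alpha> d) then 1 else 0) =
        int (card {d \<in> edges_between (v i) (v j). coset m (dvoltage \<Gamma> \<alpha> d) = D})"
      using finite_edges_between by (simp add: sum.If_cases Int_def eq_commute[of D])
    finally show ?thesis .
  qed
  show "Laplacian_infty p \<Gamma> X \<alpha> v i j \<in> carrier ?R"
    unfolding Laplacian_infty_def by (rule R.minus_closed[OF D_closed A_closed])
  assume D: "D \<in> carrier (G m)"
  \<comment> \<open>Negation depends only on the additive structure, so it is the pointwise one of
    the free module.\<close>
  have minus: "(f \<ominus>\<^bsub>A m\<^esub> g) D = f D \<ominus>\<^bsub>K\<^esub> g D" if "f \<in> carrier (A m)" "g \<in> carrier (A m)" for f g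
    using that K.free_module_minus[of f "carrier (G m)" g]
    by (simp add: a_minus_def a_inv_def m_inv_def)
  have "toL (Laplacian_infty p \<Gamma> X \<alpha> v i j) m D =
     (toL (D_entry p \<Gamma> X v i j) m \<ominus>\<^bsub>A m\<^esub> toL (A_entry p \<Gamma> X \<alpha> v i j) m) D"
    unfolding Laplacian_infty_def using D_closed A_closed
    by (simp add: a_minus_def del: group_ring_simps)
  also have "\<dots> = toL (D_entry p \<Gamma> X v i j) m D \<ominus>\<^bsub>K\<^esub> toL (A_entry p \<Gamma> X \<alpha> v i j) m D"
    by (intro minus h.hom_closed D_closed A_closed)
  also have "\<dots> = principal K (Y m) (v i, \<one>\<^bsub>G m\<^esub>) (v j, D)"
  proof -
    have "{d \<in> edges_between (v i) (v j). \<one>\<^bsub>G m\<^esub> \<otimes>\<^bsub>G m\<^esub> coset m (dvoltage \<Gamma> \<alpha> d) = D} =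
        {d \<in> edges_between (v i) (v j). coset m (dvoltage \<Gamma> \<alpha> d) = D}"
      using dvoltage_closed by (auto simp: edges_between_def coset_closed)
    then show ?thesis
      unfolding D_apply A_apply zp_int_minus principal_layer[OF G.one_closed D] inj by (simp add: eq_commute)
  qed
  finally show "toL (Laplacian_infty p \<Gamma> X \<alpha> v i j) m D = principal K (Y m) (v i, \<one>\<^bsub>G m\<^esub>) (v j, D)" .
qed

end

section \<open>Evaluation on the layers\<close>

lemma with_action_simps [simp]:
  "carrier (with_action M a) = carrier M" "zero (with_action M a) = zero M"
  "add (with_action M a) = add M" "smult (with_action M a) = a"
  by (simp_all add: with_action_def)

lemma finsum_with_action [simp]: "finsum (with_action M a) f I = finsum M f I"
  by (simp add: finsum_def finprod_def)

lemma module_restrict_scalars: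
  assumes "cring R" "module S (with_action M a)" "h \<in> ring_hom R S"
  shows "module R (with_action M (\<lambda>r. a (h r)))"
proof -
  interpret R: cring R by fact
  interpret M: module S "with_action M a" by fact
  note h = ring_hom_closed[OF assms(3)] ring_hom_add[OF assms(3)] ring_hom_mult[OF assms(3)] ring_hom_one[OF assms(3)]
  show ?thesis
  proof (intro moduleI abelian_groupI R.is_cring)
    fix x assume "x \<in> carrier (with_action M (\<lambda>r. a (h r)))"
    then show "\<exists>y\<in>carrier (with_action M (\<lambda>r. a (h r))).
        y \<oplus>\<^bsub>with_action M (\<lambda>r. a (h r))\<^esub> x = \<zero>\<^bsub>with_action M (\<lambda>r. a (h r))\<^esub>"
      using M.M.l_neg[of x] M.M.a_inv_closed[of x] by auto
  qed (use M.M.a_assoc M.M.a_comm M.M.l_zero M.M.zero_closed M.M.a_closed M.smult_closed M.smult_l_distr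
         M.smult_r_distr M.smult_assoc1 M.smult_one h in auto)
qed

context voltage_graph
begin

abbreviation "layer_divisors m \<equiv> verts X \<times> carrier (G m)"
abbreviation "FX m \<equiv> free_module K (verts X \<times> carrier (G m))"
abbreviation "Div_layer m \<equiv> with_action (Div K (Y m)) (\<lambda>z. divisor_action K (G m) (z m))"
abbreviation "R\<^sub>\<Gamma> \<equiv> group_ring K \<Gamma>"
abbreviation "Dinf \<equiv> Div_infty p \<Gamma> X \<alpha>"
abbreviation "DL \<equiv> Div_Lambda p \<Gamma> X \<alpha>"
abbreviation "bv \<equiv> base_vertex p \<Gamma> X \<alpha> v"
abbreviation "bp \<equiv> base_principal p \<Gamma> X \<alpha> n v"
abbreviation "t1 \<equiv> tensor_one (group_ring K \<Gamma>) L toL Dinf"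

lemma Div_layer_eq: "Div_layer m = with_action (FX m) (\<lambda>z. divisor_action K (G m) (z m))"
  by (simp add: Div_def)

lemma module_Div_layer: "module L (Div_layer m)"
  unfolding Div_layer_eq
  by (rule module_restrict_scalars[OF L.is_cring group_ring_setup.module_divisor_action[OF group_ring_setup_layer]
        component_hom])

sublocale N: module L "Div_layer m" for m by (rule module_Div_layer)

lemma Dinf_eq: "Dinf = with_action (free_module K (verts X \<times> carrier \<Gamma>)) (divisor_action K \<Gamma>)"
  by (simp add: Div_infty_def Div_def derived_graph_def)

lemma module_Dinf: "module R\<^sub>\<Gamma> Dinf"
  unfolding Dinf_eq by (rule group_ring_setup.module_divisor_action[OF group_ring_setup_\<Gamma>])

lemma toL_funcset: "toL \<in> carrier R\<^sub>\<Gamma> \<rightarrow> carrier L"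
  by (intro funcsetI to_Iwasawa_closed)

lemma module_DL: "module L DL"
  unfolding Div_Lambda_def by (rule module_base_change[OF module_Dinf L.is_cring toL_funcset])

sublocale DL: module L DL by (rule module_DL)

lemma t1_closed: "x \<in> carrier Dinf \<Longrightarrow> t1 x \<in> carrier DL"
  unfolding Div_Lambda_def by (rule tensor_one_closed[OF module_Dinf L.is_cring toL_funcset])

lemma t1_add: "x \<in> carrier Dinf \<Longrightarrow> y \<in> carrier Dinf \<Longrightarrow> t1 (x \<oplus>\<^bsub>Dinf\<^esub> y) = t1 x \<oplus>\<^bsub>DL\<^esub> t1 y"
  unfolding Div_Lambda_def by (rule tensor_one_add[OF module_Dinf L.is_cring toL_funcset])

lemma t1_smult: "r \<in> carrier R\<^sub>\<Gamma> \<Longrightarrow> x \<in> carrier Dinf \<Longrightarrow> t1 (r \<odot>\<^bsub>Dinf\<^esub> x) = toL r \<odot>\<^bsub>DL\<^esub> t1 x"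
  unfolding Div_Lambda_def by (rule tensor_one_smult[OF module_Dinf L.is_cring toL_funcset])

lemma v_closed: "i \<in> {1..n} \<Longrightarrow> v i \<in> verts X"
  using numbering by (auto simp: bij_betw_def)

lemma v_cases:
  assumes "u \<in> verts X" obtains i where "i \<in> {1..n}" "u = v i"
  using numbering assms unfolding bij_betw_def by (metis imageE)

lemma bv_eq: "bv i = t1 (single K (v i, \<one>\<^bsub>\<Gamma>\<^esub>))"
  by (simp add: base_vertex_def)

lemma single_Dinf: "i \<in> {1..n} \<Longrightarrow> single K (v i, \<one>\<^bsub>\<Gamma>\<^esub>) \<in> carrier Dinf"
  unfolding Dinf_eq using v_closed by (auto intro!: K.free_module_single)

lemma bv_closed: "i \<in> {1..n} \<Longrightarrow> bv i \<in> carrier DL"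
  unfolding bv_eq by (intro t1_closed single_Dinf)

lemma bv_funcset: "bv \<in> {1..n} \<rightarrow> carrier DL"
  by (intro funcsetI bv_closed)

lemma divisor_action_single_scaled:
  assumes S: "group_ring_setup K H" and a: "a \<in> carrier K" and g: "g \<in> carrier H" and u: "u \<in> V" and h: "h \<in> carrier H"
  shows "divisor_action K H (\<lambda>x. a \<otimes>\<^bsub>K\<^esub> single K g x) (single K (u, h)) = (\<lambda>x. a \<otimes>\<^bsub>K\<^esub> single K (u, g \<otimes>\<^bsub>H\<^esub> h) x)"
proof -
  interpret S: group_ring_setup K H by (rule S)
  have act: "S.translate x \<in> V \<times> carrier H \<rightarrow> V \<times> carrier H" if "x \<in> carrier H" for x
    using that by (rule S.translate_funcset)
  have s: "single K (u, h) \<in> carrier (free_module K (V \<times> carrier H))"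
    using u h by (intro K.free_module_single) auto
  have r: "(\<lambda>x. a \<otimes>\<^bsub>K\<^esub> single K g x) \<in> carrier (free_module K (carrier H))"
    by (intro K.free_module_smult K.free_module_single a g)
  have "convolution K (V \<times> carrier H) S.translate (single K g) (single K (u, h)) = single K (u, g \<otimes>\<^bsub>H\<^esub> h)"
    using K.convolution_single[where G = "carrier H" and act = S.translate, OF act g, of "(u, h)"] u h by simp
  then show ?thesis
    unfolding S.divisor_action_convolution[OF r s]
    using linear_mapsD(3)[OF K.convolution_linear_left[where G = "carrier H" and act = S.translate,
        OF act s] a K.free_module_single[OF g]]
    by (simp del: Zp_simps)
qed

text \<open>The vertex (v_i, g) is the translate by g of (v_i, 1), hence its image in Div_Lambda is
  a Lambda-multiple of the i-th base vertex; such images generate.\<close>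

lemma DL_combination:
  assumes "x \<in> carrier DL"
  obtains z where "z \<in> {1..n} \<rightarrow> carrier L" "x = (\<Oplus>\<^bsub>DL\<^esub>i\<in>{1..n}. z i \<odot>\<^bsub>DL\<^esub> bv i)"
proof -
  let ?S = "{\<Oplus>\<^bsub>DL\<^esub>i\<in>{1..n}. z i \<odot>\<^bsub>DL\<^esub> bv i | z. z \<in> {1..n} \<rightarrow> carrier L}"
  have S: "submodule ?S L DL" by (rule DL.finite_combinations_submodule[OF bv_funcset]) simp
  have "t1 x \<in> ?S" if "x \<in> carrier Dinf" for x
  proof -
    have "x \<in> carrier (free_module K (verts X \<times> carrier \<Gamma>))" using that by (simp add: Dinf_eq)
    then show ?thesis
    proof (induction rule: K.free_module_induct)
      case zero
      interpret D: module R\<^sub>\<Gamma> Dinf by (rule module_Dinf)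
      \<comment> \<open>The map \<open>t1\<close> is known to be additive but is no member of
        \<open>linear_maps\<close>; that it preserves zero follows by cancelling in 0 + 0 =
        0.\<close>
      have "t1 (\<zero>\<^bsub>Dinf\<^esub> \<oplus>\<^bsub>Dinf\<^esub> \<zero>\<^bsub>Dinf\<^esub>) = t1 \<zero>\<^bsub>Dinf\<^esub> \<oplus>\<^bsub>DL\<^esub> t1 \<zero>\<^bsub>Dinf\<^esub>"
        by (intro t1_add D.M.zero_closed)
      then have "t1 \<zero>\<^bsub>Dinf\<^esub> = t1 \<zero>\<^bsub>Dinf\<^esub> \<oplus>\<^bsub>DL\<^esub> t1 \<zero>\<^bsub>Dinf\<^esub>"
        by (simp only: D.M.l_zero D.M.zero_closed)
      then have "t1 \<zero>\<^bsub>Dinf\<^esub> = \<zero>\<^bsub>DL\<^esub>"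
        using DL.M.add.r_cancel_one'[OF t1_closed[OF D.M.zero_closed] t1_closed[OF D.M.zero_closed]] by simp
      moreover have "\<zero>\<^bsub>DL\<^esub> \<in> ?S" using subgroup.one_closed[OF submodule.axioms(1)[OF S]] by simp
      ultimately show ?case by (simp add: Dinf_eq)
    next
      case (add f g)
      then have "f \<in> carrier Dinf" "g \<in> carrier Dinf" by (simp_all add: Dinf_eq)
      from t1_add[OF this] have "t1 (\<lambda>b. f b \<oplus>\<^bsub>K\<^esub> g b) = t1 f \<oplus>\<^bsub>DL\<^esub> t1 g"
        by (simp add: Dinf_eq)
      with add DL.submoduleE(5)[OF S] show ?case by simp
    next
      case (single a b)
      then obtain i g where b: "i \<in> {1..n}" "g \<in> carrier \<Gamma>" "b = (v i, g)" by (auto elim: v_cases)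
      \<comment> \<open>The group ring element a g, which carries the base vertex to a times (v_i,
        g).\<close>
      let ?r = "\<lambda>x. a \<otimes>\<^bsub>K\<^esub> single K g x"
      have r: "?r \<in> carrier R\<^sub>\<Gamma>"
        unfolding group_ring_simps by (intro K.free_module_smult K.free_module_single single b)
      have "?r \<odot>\<^bsub>Dinf\<^esub> single K (v i, \<one>\<^bsub>\<Gamma>\<^esub>) = (\<lambda>x. a \<otimes>\<^bsub>K\<^esub> single K b x)"
        using divisor_action_single_scaled[OF group_ring_setup_\<Gamma> single(1) b(2) v_closed[OF b(1)] \<Gamma>.one_closed] b
        by (simp add: Dinf_eq del: Zp_simps)
      then have "t1 (\<lambda>x. a \<otimes>\<^bsub>K\<^esub> single K b x) = toL ?r \<odot>\<^bsub>DL\<^esub> bv i"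
        using t1_smult[OF r single_Dinf[OF b(1)]] by (simp add: bv_eq del: Zp_simps)
      also have "\<dots> \<in> ?S"
        by (rule DL.submoduleE(4)[OF S to_Iwasawa_closed[OF r] DL.finite_combination_member[OF bv_funcset _ b(1)]]) simp
      finally show ?case .
    qed
  qed
  from base_change_generated[OF module_Dinf L.is_cring toL_funcset S[unfolded Div_Lambda_def] this[unfolded Div_Lambda_def]]
  have "carrier DL = ?S" by (simp only: Div_Lambda_def)
  with assms that show thesis by blast
qed

text \<open>Elements of Div_Lambda are cosets of formal combinations, so no direct formula on
  elements is at hand; the map comes from the universal property and is selected by its values on
  pure tensors.\<close>

definition ev :: "nat \<Rightarrow> ('v, 'g) div_lambda \<Rightarrow> 'v \<times> 'g set \<Rightarrow> nat \<Rightarrow> int" where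
  "ev m = (SOME g. g \<in> linear_maps L DL (Div_layer m) \<and>
     (\<forall>x\<in>carrier Dinf. g (t1 x) = pushforward K (layer_divisors m) (\<lambda>(u, g). (u, coset m g)) x))"

text \<open>Existence rests on equivariance: reducing the second coordinate modulo Gamma^(p^m) turns
  translation by an element of Gamma into translation by its coset.\<close>

lemma ev_spec:
  "ev m \<in> linear_maps L DL (Div_layer m)"
  "x \<in> carrier Dinf \<Longrightarrow> ev m (t1 x) = pushforward K (layer_divisors m) (\<lambda>(u, g). (u, coset m g)) x"
proof -
  let ?\<psi> = "\<lambda>(u, g). (u, coset m g)"
  let ?\<pi> = "pushforward K (layer_divisors m) ?\<psi>"
  have \<psi>: "?\<psi> \<in> verts X \<times> carrier \<Gamma> \<rightarrow> layer_divisors m" by (auto simp: coset_closed)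
  interpret S: group_ring_setup K \<Gamma> by (rule group_ring_setup_\<Gamma>)
  interpret Sm: group_ring_setup K "G m" by (rule group_ring_setup_layer)
  note lin = linear_mapsD[OF K.pushforward_linear[OF \<psi>]]
  have "\<exists>g. g \<in> linear_maps L DL (Div_layer m) \<and> (\<forall>x\<in>carrier Dinf. g (t1 x) = ?\<pi> x)"
  proof (rule base_change_lift[OF module_Dinf L.is_cring toL_funcset module_Div_layer, where h = ?\<pi>])
    show "?\<pi> \<in> carrier Dinf \<rightarrow> carrier (Div_layer m)"
      using lin(1) by (simp add: Dinf_eq Div_def)
    show "?\<pi> (x \<oplus>\<^bsub>Dinf\<^esub> y) = ?\<pi> x \<oplus>\<^bsub>Div_layer m\<^esub> ?\<pi> y" if "x \<in> carrier Dinf" "y \<in> carrier Dinf" for x y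
      using lin(2)[of x y] that by (simp add: Dinf_eq Div_def)
    show "?\<pi> (r \<odot>\<^bsub>Dinf\<^esub> x) = toL r \<odot>\<^bsub>Div_layer m\<^esub> ?\<pi> x" if r: "r \<in> carrier R\<^sub>\<Gamma>" and x: "x \<in> carrier Dinf" for r x
    proof -
      have r': "r \<in> carrier (free_module K (carrier \<Gamma>))" and x': "x \<in> carrier (free_module K (verts X \<times> carrier \<Gamma>))"
        using r x by (simp_all add: Dinf_eq)
      have "?\<pi> (convolution K (verts X \<times> carrier \<Gamma>) S.translate r x) =
        convolution K (layer_divisors m) Sm.translate (pushforward K (carrier (G m)) (coset m) r) (?\<pi> x)"
        by (rule K.convolution_pushforward[OF S.translate_funcset Sm.translate_funcset coset_funcset \<psi> _ r' x'])
           (auto simp: coset_mult)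
      then show ?thesis
        by (simp add: Dinf_eq S.divisor_action_convolution[OF r' x'] to_Iwasawa_component[OF r]
            Sm.divisor_action_convolution[OF K.pushforward_closed[OF coset_funcset r'] lin(1)[OF x']])
    qed
  qed (auto simp: Div_Lambda_def)
  from someI_ex[OF this]
  show "ev m \<in> linear_maps L DL (Div_layer m)" "x \<in> carrier Dinf \<Longrightarrow> ev m (t1 x) = ?\<pi> x"
    unfolding ev_def by auto
qed

lemmas ev = linear_mapsD[OF ev_spec(1)]

lemma ev_bv:
  assumes i: "i \<in> {1..n}" shows "ev m (bv i) = single K (v i, \<one>\<^bsub>G m\<^esub>)"
proof -
  have \<psi>: "(\<lambda>(u, g). (u, coset m g)) \<in> verts X \<times> carrier \<Gamma> \<rightarrow> layer_divisors m" by (auto simp: coset_closed)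
  show ?thesis
    using K.pushforward_single[OF \<psi>, of "(v i, \<one>\<^bsub>\<Gamma>\<^esub>)"] v_closed[OF i]
    by (simp add: bv_eq ev_spec(2)[OF single_Dinf[OF i]] coset_one)
qed

lemma vertex_closed: "i \<in> {1..n} \<Longrightarrow> D \<in> carrier (G m) \<Longrightarrow> single K (v i, D) \<in> carrier (FX m)"
  using v_closed by (intro K.free_module_single) auto

text \<open>Acting on a base vertex spreads the coefficients of \<open>f\<close> over the fibre
  above v_i and leaves the other fibres empty.\<close>

lemma divisor_action_vertex:
  assumes f: "f \<in> carrier (A m)" and i: "i \<in> {1..n}" and j: "j \<in> {1..n}" and D: "D \<in> carrier (G m)"
  shows "divisor_action K (G m) f (single K (v i, \<one>\<^bsub>G m\<^esub>)) (v j, D) = (if i = j then f D else \<zero>\<^bsub>K\<^esub>)"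
proof -
  interpret Sm: group_ring_setup K "G m" by (rule group_ring_setup_layer)
  have f': "f \<in> carrier (free_module K (carrier (G m)))" using f by simp
  have inj: "v i = v j \<longleftrightarrow> i = j" by (rule inj_on_eq_iff[OF bij_betw_imp_inj_on[OF numbering] i j])
  note s = vertex_closed[OF i G.one_closed]
  have "(if i = j then f D else \<zero>\<^bsub>K\<^esub>) = divisor_action K (G m) f (single K (v i, \<one>\<^bsub>G m\<^esub>)) (v j, D)"
    unfolding Sm.divisor_action_convolution[OF f' s]
  proof (rule K.linear_maps_eqI[OF _ linear_maps_compose[OF K.convolution_linear_left[where G = "carrier (G m)" and act = Sm.translate, OF Sm.translate_funcset s]
          K.evaluation_linear] module_self_module[OF K.is_cring] _ f'])
    show "(\<lambda>f. if i = j then f D else \<zero>\<^bsub>K\<^esub>) \<in> linear_maps K (free_module K (carrier (G m))) (self_module K)"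
      by (auto simp: linear_maps_def K.free_module_closed simp del: Zp_simps)
    fix E assume E: "E \<in> carrier (G m)"
    have "convolution K (layer_divisors m) Sm.translate (single K E) (single K (v i, \<one>\<^bsub>G m\<^esub>)) = single K (v i, E)"
      using divisor_action_single_scaled[OF group_ring_setup_layer K.one_closed E v_closed[OF i] G.one_closed[of m]]
        Sm.divisor_action_convolution[OF K.free_module_single[OF E] s] E
      by (simp add: K.free_module_closed[OF K.free_module_single[OF E]]
         K.free_module_closed[OF vertex_closed[OF i E]] del: Zp_simps)
    then show "(if i = j then single K E D else \<zero>\<^bsub>K\<^esub>) =
        convolution K (layer_divisors m) Sm.translate (single K E) (single K (v i, \<one>\<^bsub>G m\<^esub>)) (v j, D)"
      using inj by (auto simp: single_def simp del: Zp_simps)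
  qed
  then show ?thesis by simp
qed

lemma ev_combination_eq:
  assumes z: "z \<in> {1..n} \<rightarrow> carrier L"
  shows "ev m (\<Oplus>\<^bsub>DL\<^esub>i\<in>{1..n}. z i \<odot>\<^bsub>DL\<^esub> bv i) =
    (\<Oplus>\<^bsub>FX m\<^esub>i\<in>{1..n}. divisor_action K (G m) (z i m) (single K (v i, \<one>\<^bsub>G m\<^esub>)))"
    (is "_ = finsum _ ?F _")
    and "(\<lambda>i. divisor_action K (G m) (z i m) (single K (v i, \<one>\<^bsub>G m\<^esub>))) \<in> {1..n} \<rightarrow> carrier (FX m)"
proof -
  have zi: "z i \<in> carrier L" if "i \<in> {1..n}" for i using z that by auto
  have F: "ev m (z i \<odot>\<^bsub>DL\<^esub> bv i) = ?F i" if "i \<in> {1..n}" for i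
    using ev(3)[OF zi[OF that] bv_closed[OF that], of m] by (simp add: ev_bv[OF that])
  have "ev m (z i \<odot>\<^bsub>DL\<^esub> bv i) \<in> carrier (FX m)" if "i \<in> {1..n}" for i
    using ev(1)[OF DL.smult_closed[OF zi[OF that] bv_closed[OF that]], of m] by (simp add: Div_def)
  then show F': "?F \<in> {1..n} \<rightarrow> carrier (FX m)" using F by auto
  have "ev m (\<Oplus>\<^bsub>DL\<^esub>i\<in>{1..n}. z i \<odot>\<^bsub>DL\<^esub> bv i) = (\<Oplus>\<^bsub>Div_layer m\<^esub>i\<in>{1..n}. ev m (z i \<odot>\<^bsub>DL\<^esub> bv i))"
    by (rule linear_maps_finsum[OF module_DL module_Div_layer ev_spec(1)]) (use zi bv_closed in auto)
  also have "\<dots> = finsum (Div_layer m) ?F {1..n}"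
    by (rule N.finsum_cong_closed) (use F F' in \<open>auto simp: Div_def\<close>)
  finally show "ev m (\<Oplus>\<^bsub>DL\<^esub>i\<in>{1..n}. z i \<odot>\<^bsub>DL\<^esub> bv i) = finsum (FX m) ?F {1..n}" by (simp add: Div_def)
qed

text \<open>Only the j-th summand lives on the fibre over v_j. The layer therefore displays the m-th
  components of all coefficients side by side, which also shows that they do not depend on the
  chosen representation.\<close>

lemma ev_combination:
  assumes z: "z \<in> {1..n} \<rightarrow> carrier L" and j: "j \<in> {1..n}" and D: "D \<in> carrier (G m)"
  shows "ev m (\<Oplus>\<^bsub>DL\<^esub>i\<in>{1..n}. z i \<odot>\<^bsub>DL\<^esub> bv i) (v j, D) = z j m D"
proof -
  have zi: "z i \<in> carrier L" if "i \<in> {1..n}" for i using z that by auto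
  have "ev m (\<Oplus>\<^bsub>DL\<^esub>i\<in>{1..n}. z i \<odot>\<^bsub>DL\<^esub> bv i) (v j, D) =
     (\<Oplus>\<^bsub>K\<^esub>i\<in>{1..n}. divisor_action K (G m) (z i m) (single K (v i, \<one>\<^bsub>G m\<^esub>)) (v j, D))"
    unfolding ev_combination_eq(1)[OF z] by (rule finsum_free_module_apply[OF ev_combination_eq(2)[OF z]])
  also have "\<dots> = (\<Oplus>\<^bsub>K\<^esub>i\<in>{1..n}. if j = i then z i m D else \<zero>\<^bsub>K\<^esub>)"
    using divisor_action_vertex[OF component_closed[OF zi] _ j D] coefficient_closed[OF zi]
    by (intro K.finsum_cong' refl) (auto simp del: Zp_simps)
  also have "\<dots> = z j m D"
    using coefficient_closed[OF zi] j by (intro K.finsum_singleton) auto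
  finally show ?thesis .
qed

lemma layer_divisor_eqI:
  assumes "f \<in> carrier (FX m)" "g \<in> carrier (FX m)"
    and "\<And>i D. i \<in> {1..n} \<Longrightarrow> D \<in> carrier (G m) \<Longrightarrow> f (v i, D) = g (v i, D)"
  shows "f = g"
proof
  fix x :: "'v \<times> 'g set"
  obtain u D where x: "x = (u, D)" by force
  show "f x = g x"
  proof (cases "x \<in> layer_divisors m")
    case True
    then show ?thesis using assms(3) by (auto simp: x elim: v_cases)
  next
    case False
    then show ?thesis using assms(1,2) unfolding free_module_carrier by metis
  qed
qed

end

lemma linear_maps_image_submodule:
  assumes M: "module K M" and N: "module K N" and h: "h \<in> linear_maps K M N" and S: "submodule S K M"
  shows "submodule (h ` S) K N"
proof -
  interpret M: module K M by fact
  interpret N: module K N by fact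
  note E = M.submoduleE[OF S]
  note hD = linear_mapsD[OF h]
  have cl: "x \<in> carrier M" if "x \<in> S" for x using E(1) that by auto
  have img: "y \<in> h ` S" if "y = h x" "x \<in> S" for x y using that by simp
  show ?thesis
  proof (rule N.submoduleI)
    show "h ` S \<subseteq> carrier N" using cl hD(1) by blast
    have "\<zero>\<^bsub>M\<^esub> \<in> S" using subgroup.one_closed[OF submodule.axioms(1)[OF S]] by simp
    then show "\<zero>\<^bsub>N\<^esub> \<in> h ` S"
      by (rule img[OF linear_maps_zero[OF M N h, symmetric]])
  next
    fix a assume "a \<in> h ` S"
    then obtain x where x: "x \<in> S" "a = h x" by blast
    show "\<ominus>\<^bsub>N\<^esub> a \<in> h ` S"
      unfolding x(2) by (rule img[OF linear_maps_uminus[OF M N h cl[OF x(1)], symmetric] E(3)[OF x(1)]])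
  next
    fix a b assume "a \<in> h ` S" "b \<in> h ` S"
    then obtain x y where x: "x \<in> S" "a = h x" and y: "y \<in> S" "b = h y" by blast
    show "a \<oplus>\<^bsub>N\<^esub> b \<in> h ` S"
      unfolding x(2) y(2) by (rule img[OF hD(2)[OF cl[OF x(1)] cl[OF y(1)], symmetric] E(5)[OF x(1) y(1)]])
  next
    fix a y assume a: "a \<in> carrier K" and "y \<in> h ` S"
    then obtain x where x: "x \<in> S" "y = h x" by blast
    show "a \<odot>\<^bsub>N\<^esub> y \<in> h ` S"
      unfolding x(2) by (rule img[OF hD(3)[OF a cl[OF x(1)], symmetric] E(4)[OF a x(1)]])
  qed
qed

section \<open>Coefficient sums\<close>

context cring
begin

lemma free_module_generated:
  assumes S: "submodule S R (free_module R B)" and single: "\<And>b. b \<in> B \<Longrightarrow> single R b \<in> S"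
  shows "carrier (free_module R B) \<subseteq> S"
proof
  interpret F: module R "free_module R B" by (rule module_free_module)
  note E = F.submoduleE[OF S]
  fix f assume "f \<in> carrier (free_module R B)"
  then show "f \<in> S"
  proof (induction rule: free_module_induct)
    case zero
    then show ?case using subgroup.one_closed[OF submodule.axioms(1)[OF S]] by simp
  next
    case (add f g)
    then show ?case using E(5) by simp
  next
    case (single a b)
    then show ?case using E(4) assms(2) by simp
  qed
qed

text \<open>The degree of a divisor and the augmentation of a group ring element alike; as a linear
  combination of constant values it inherits linearity.\<close>

definition total :: "('x \<Rightarrow> 'a) \<Rightarrow> 'a" where
  "total f = lin_comb R (self_module R) f (\<lambda>_. \<one>)"

lemma total_linear: "total \<in> linear_maps R (free_module R B) (self_module R)"
proof -
  interpret S: module R "self_module R" by (rule module_self_module[OF is_cring])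
  have "(\<lambda>f. lin_comb R (self_module R) f (\<lambda>_. \<one>)) \<in> linear_maps R (free_module R B) (self_module R)"
    by (rule S.lin_comb_linear) simp
  then show ?thesis by (simp add: total_def[abs_def])
qed

lemma total_single: "total (single R b) = \<one>"
proof -
  interpret S: module R "self_module R" by (rule module_self_module[OF is_cring])
  show ?thesis unfolding total_def by (rule S.lin_comb_single[of b UNIV]) auto
qed

lemma total_eq:
  assumes "f \<in> carrier (free_module R B)"
  shows "total f = (\<Oplus>b\<in>{b. f b \<noteq> \<zero>}. f b)"
  using free_module_closed[OF assms] by (auto simp: total_def lin_comb_def intro!: finsum_cong')

lemma total_pushforward:
  assumes "\<phi> \<in> B \<rightarrow> C" "f \<in> carrier (free_module R B)"
  shows "total (pushforward R C \<phi> f) = total f"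
  by (rule linear_maps_eqI[OF linear_maps_compose[OF pushforward_linear[OF assms(1)] total_linear] total_linear
        module_self_module[OF is_cring] _ assms(2)])
     (simp add: pushforward_single[OF assms(1)] total_single)

text \<open>Each group element permutes or at least moves basis points and so preserves the
  coefficient sum; linearity in \<open>r\<close> then gives the product.\<close>

lemma total_convolution:
  assumes act: "\<And>g. g \<in> G \<Longrightarrow> act g \<in> B \<rightarrow> B"
    and r: "r \<in> carrier (free_module R G)" and d: "d \<in> carrier (free_module R B)"
  shows "total (convolution R B act r d) = total r \<otimes> total d"
proof -
  have td: "total d \<in> carrier R" using linear_mapsD(1)[OF total_linear d] by simp
  have "(\<lambda>a. a \<otimes> total d) \<in> linear_maps R (self_module R) (self_module R)"
    using td by (auto simp: linear_maps_def l_distr m_assoc)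
  note lin = linear_maps_compose[OF total_linear this]
  show ?thesis
    by (rule linear_maps_eqI[OF linear_maps_compose[OF convolution_linear_left[OF act d] total_linear] lin
          module_self_module[OF is_cring] _ r])
       (simp_all add: convolution_single_left[OF act _ d] total_pushforward[OF act d] total_single td)
qed

end

context voltage_graph
begin

lemma FX_Div: "Div K (Y m) = FX m"
  by (simp add: Div_def)

sublocale FX: module K "FX m" for m by (rule K.module_free_module)

lemma scalar_action:
  assumes a: "a \<in> carrier K"
  shows "\<exists>c\<in>carrier L. \<forall>y\<in>carrier (FX m). divisor_action K (G m) (c m) y = (\<lambda>x. a \<otimes>\<^bsub>K\<^esub> y x)"
proof -
  interpret Sm: group_ring_setup K "G m" by (rule group_ring_setup_layer)
  obtain c where c: "c \<in> carrier L" "\<And>f m. f \<in> carrier (A m) \<Longrightarrow> c m \<otimes>\<^bsub>A m\<^esub> f = (\<lambda>D. a \<otimes>\<^bsub>K\<^esub> f D)"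
    using scalar_mult[OF a] by blast
  have "c m = c m \<otimes>\<^bsub>A m\<^esub> \<one>\<^bsub>A m\<^esub>" using component_closed[OF c(1)] by (simp del: group_ring_simps)
  also have "\<dots> = (\<lambda>D. a \<otimes>\<^bsub>K\<^esub> single K \<one>\<^bsub>G m\<^esub> D)"
    using c(2)[OF A.one_closed] by simp
  finally have cm: "c m = (\<lambda>D. a \<otimes>\<^bsub>K\<^esub> single K \<one>\<^bsub>G m\<^esub> D)" .
  have "divisor_action K (G m) (c m) y = (\<lambda>x. a \<otimes>\<^bsub>K\<^esub> y x)" if y: "y \<in> carrier (FX m)" for y
  proof -
    have act: "Sm.translate g \<in> layer_divisors m \<rightarrow> layer_divisors m" if "g \<in> carrier (G m)" for g
      using that by (rule Sm.translate_funcset)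
    have "convolution K (layer_divisors m) Sm.translate (single K \<one>\<^bsub>G m\<^esub>) y = y"
      by (rule K.convolution_one[OF act G.one_closed _ y]) auto
    then show ?thesis
      unfolding Sm.divisor_action_convolution[OF component_closed'[OF c(1)] y]
      unfolding cm
      using linear_mapsD(3)[OF K.convolution_linear_left[where G = "carrier (G m)" and act = Sm.translate, OF act y] a
          K.free_module_single[OF G.one_closed]]
      by (simp del: Zp_simps)
  qed
  with c(1) show ?thesis by blast
qed

text \<open>Lambda contains elements acting as the p-adic scalars. This reconciles Pr(X_m), a
  Z_p-span, with images of Lambda-submodules.\<close>

lemma submodule_over_K:
  assumes S: "submodule S L (Div_layer m)"
  shows "submodule S K (FX m)"
proof -
  note E = N.submoduleE[OF S]
  have sub: "S \<subseteq> carrier (FX m)" using E(1) by (simp add: FX_Div)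
  have smult: "a \<odot>\<^bsub>FX m\<^esub> x \<in> S" if "a \<in> carrier K" "x \<in> S" for a x
  proof -
    obtain c where c: "c \<in> carrier L" "\<And>y. y \<in> carrier (FX m) \<Longrightarrow> divisor_action K (G m) (c m) y = (\<lambda>x. a \<otimes>\<^bsub>K\<^esub> y x)"
      using scalar_action[OF \<open>a \<in> carrier K\<close>] by blast
    then show ?thesis using E(4)[OF c(1) \<open>x \<in> S\<close>] sub \<open>x \<in> S\<close> by (auto simp: FX_Div simp del: Zp_simps)
  qed
  show ?thesis
  proof (rule FX.submoduleI[OF sub])
    show "\<zero>\<^bsub>FX m\<^esub> \<in> S" using subgroup.one_closed[OF submodule.axioms(1)[OF S]] by (simp add: FX_Div)
    show "\<And>a b. a \<in> S \<Longrightarrow> b \<in> S \<Longrightarrow> a \<oplus>\<^bsub>FX m\<^esub> b \<in> S" using E(5) by (simp add: FX_Div)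
    fix a assume a: "a \<in> S"
    then have "\<ominus>\<^bsub>FX m\<^esub> a = (\<ominus>\<^bsub>K\<^esub> \<one>\<^bsub>K\<^esub>) \<odot>\<^bsub>FX m\<^esub> a"
      using sub by (simp add: FX.smult_l_minus FX.smult_one subset_iff del: free_module_simps Zp_simps)
    then show "\<ominus>\<^bsub>FX m\<^esub> a \<in> S"
      using smult[OF K.a_inv_closed[OF K.one_closed] a] by (simp only:)
  qed (rule smult)
qed

lemma ev_closed: "x \<in> carrier DL \<Longrightarrow> ev m x \<in> carrier (FX m)"
  using ev(1)[of x m] by (simp add: FX_Div)

lemma ev_zero_iff:
  assumes z: "z \<in> {1..n} \<rightarrow> carrier L"
  shows "ev m (\<Oplus>\<^bsub>DL\<^esub>i\<in>{1..n}. z i \<odot>\<^bsub>DL\<^esub> bv i) = \<zero>\<^bsub>FX m\<^esub> \<longleftrightarrow> (\<forall>i\<in>{1..n}. z i m = \<zero>\<^bsub>A m\<^esub>)"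
    (is "ev m ?x = _ \<longleftrightarrow> _")
proof
  assume "ev m ?x = \<zero>\<^bsub>FX m\<^esub>"
  then have *: "z i m D = \<zero>\<^bsub>K\<^esub>" if "i \<in> {1..n}" "D \<in> carrier (G m)" for i D
    using ev_combination[OF z that, of ] by (simp del: Zp_simps)
  show "\<forall>i\<in>{1..n}. z i m = \<zero>\<^bsub>A m\<^esub>"
  proof
    fix i assume i: "i \<in> {1..n}"
    have zi: "z i m \<in> carrier (free_module K (carrier (G m)))" using z i by (intro component_closed') auto
    have "z i m D = \<zero>\<^bsub>K\<^esub>" for D
      using *[OF i, of D] zi unfolding free_module_carrier by metis
    then show "z i m = \<zero>\<^bsub>A m\<^esub>" by (simp add: fun_eq_iff)
  qed
next
  assume *: "\<forall>i\<in>{1..n}. z i m = \<zero>\<^bsub>A m\<^esub>"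
  have x: "?x \<in> carrier DL" using z bv_closed by (intro DL.M.finsum_closed) auto
  show "ev m ?x = \<zero>\<^bsub>FX m\<^esub>"
    by (rule layer_divisor_eqI[OF ev_closed[OF x] FX.M.zero_closed]) (simp_all only: ev_combination[OF z] bspec[OF *] group_ring_simps free_module_simps)
qed

section \<open>The kernel of evaluation\<close>

text \<open>One inclusion holds because the kernel of a ring homomorphism is an ideal containing the
  generators; the other is \<open>component_kernel\<close>.\<close>

lemma genideal_aug: "Idl\<^bsub>L\<^esub> (aug m ` {1..l}) = {a \<in> carrier L. a m = \<zero>\<^bsub>A m\<^esub>}"
proof
  have sub: "aug m ` {1..l} \<subseteq> carrier L" using aug_closed by auto
  have I: "ideal (Idl\<^bsub>L\<^esub> (aug m ` {1..l})) L" by (rule L.genideal_ideal[OF sub])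
  interpret h: ring_hom_ring L "A m" "\<lambda>z. z m"
    by (intro ring_hom_ringI2 L.ring_axioms A.ring_axioms component_hom)
  show "Idl\<^bsub>L\<^esub> (aug m ` {1..l}) \<subseteq> {a \<in> carrier L. a m = \<zero>\<^bsub>A m\<^esub>}"
  proof (rule L.genideal_minimal)
    show "ideal {a \<in> carrier L. a m = \<zero>\<^bsub>A m\<^esub>} L"
      using h.kernel_is_ideal unfolding a_kernel_def' .
    show "aug m ` {1..l} \<subseteq> {a \<in> carrier L. a m = \<zero>\<^bsub>A m\<^esub>}"
      using aug_closed aug_component_zero by blast
  qed
  show "{a \<in> carrier L. a m = \<zero>\<^bsub>A m\<^esub>} \<subseteq> Idl\<^bsub>L\<^esub> (aug m ` {1..l})"
  proof
    fix a assume "a \<in> {a \<in> carrier L. a m = \<zero>\<^bsub>A m\<^esub>}"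
    then have "a \<in> aug_ideal m" by (auto intro: component_kernel)
    then obtain u where u: "u \<in> {1..l} \<rightarrow> carrier L" "a = (\<Oplus>\<^bsub>L\<^esub>i\<in>{1..l}. u i \<otimes>\<^bsub>L\<^esub> aug m i)"
      by (auto simp: aug_ideal_def)
    interpret I: additive_subgroup "Idl\<^bsub>L\<^esub> (aug m ` {1..l})" L by (rule ideal.axioms(1)[OF I])
    have "submodule (Idl\<^bsub>L\<^esub> (aug m ` {1..l})) L (self_module L)"
    proof (rule module.submoduleI[OF module_L])
      show "Idl\<^bsub>L\<^esub> (aug m ` {1..l}) \<subseteq> carrier (self_module L)" using I.a_subset by (simp only: self_module_simps)
      show "\<zero>\<^bsub>self_module L\<^esub> \<in> Idl\<^bsub>L\<^esub> (aug m ` {1..l})" using I.zero_closed by (simp only: self_module_simps)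
    next
      fix a b assume "a \<in> Idl\<^bsub>L\<^esub> (aug m ` {1..l})" "b \<in> Idl\<^bsub>L\<^esub> (aug m ` {1..l})"
      then show "a \<oplus>\<^bsub>self_module L\<^esub> b \<in> Idl\<^bsub>L\<^esub> (aug m ` {1..l})"
        unfolding self_module_simps by (rule I.a_closed)
    next
      fix a assume "a \<in> Idl\<^bsub>L\<^esub> (aug m ` {1..l})"
      then show "\<ominus>\<^bsub>self_module L\<^esub> a \<in> Idl\<^bsub>L\<^esub> (aug m ` {1..l})"
        unfolding a_inv_self_module by (rule I.a_inv_closed)
    next
      fix a x assume "a \<in> carrier L" "x \<in> Idl\<^bsub>L\<^esub> (aug m ` {1..l})"
      then show "a \<odot>\<^bsub>self_module L\<^esub> x \<in> Idl\<^bsub>L\<^esub> (aug m ` {1..l})"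
        unfolding self_module_simps using ideal.I_l_closed[OF I] by blast
    qed
    moreover have "(\<lambda>i. u i \<otimes>\<^bsub>L\<^esub> aug m i) \<in> {1..l} \<rightarrow> Idl\<^bsub>L\<^esub> (aug m ` {1..l})"
    proof
      fix i assume i: "i \<in> {1..l}"
      have "aug m i \<in> Idl\<^bsub>L\<^esub> (aug m ` {1..l})" using L.genideal_self[OF sub] i by blast
      then show "u i \<otimes>\<^bsub>L\<^esub> aug m i \<in> Idl\<^bsub>L\<^esub> (aug m ` {1..l})"
        using ideal.I_l_closed[OF I] funcset_mem[OF u(1) i] by blast
    qed
    ultimately have "(\<Oplus>\<^bsub>self_module L\<^esub>i\<in>{1..l}. u i \<otimes>\<^bsub>L\<^esub> aug m i) \<in> Idl\<^bsub>L\<^esub> (aug m ` {1..l})"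
      by (rule submodule_finsum[OF module_L])
    then show "a \<in> Idl\<^bsub>L\<^esub> (aug m ` {1..l})" by (simp only: u(2) finsum_self_module)
  qed
qed

text \<open>An element of the kernel, expanded in base vertices, has all its coefficients in the
  ideal by \<open>ev_zero_iff\<close>, so each term of the expansion is itself one of the generating
  products.\<close>

lemma ideal_smult_aug: "ideal_smult L (Idl\<^bsub>L\<^esub> (aug m ` {1..l})) DL = {x \<in> carrier DL. ev m x = \<zero>\<^bsub>FX m\<^esub>}"
  unfolding ideal_smult_def genideal_aug
proof
  let ?G = "{a \<odot>\<^bsub>DL\<^esub> x |a x. a \<in> {a \<in> carrier L. a m = \<zero>\<^bsub>A m\<^esub>} \<and> x \<in> carrier DL}"
  have sub: "?G \<subseteq> carrier DL" by auto
  have "ev m (a \<odot>\<^bsub>DL\<^esub> x) = \<zero>\<^bsub>FX m\<^esub>" if "a \<in> carrier L" "a m = \<zero>\<^bsub>A m\<^esub>" "x \<in> carrier DL" for a x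
  proof -
    have "ev m (a \<odot>\<^bsub>DL\<^esub> x) = divisor_action K (G m) (a m) (ev m x)"
      using ev(3)[OF that(1,3)] by simp
    also have "a m = \<zero>\<^bsub>L\<^esub> m" using that by simp
    also have "divisor_action K (G m) (\<zero>\<^bsub>L\<^esub> m) (ev m x) = \<zero>\<^bsub>Div_layer m\<^esub>"
      using N.smult_l_null[OF ev(1)[OF that(3)]] by (simp del: L_simps)
    finally show ?thesis by (simp add: FX_Div)
  qed
  then show "mod_span L DL ?G \<subseteq> {x \<in> carrier DL. ev m x = \<zero>\<^bsub>FX m\<^esub>}"
    using linear_maps_kernel_submodule[OF module_DL module_Div_layer ev_spec(1), of m]
    by (intro mod_span_minimal) (auto simp: FX_Div)
  show "{x \<in> carrier DL. ev m x = \<zero>\<^bsub>FX m\<^esub>} \<subseteq> mod_span L DL ?G"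
  proof
    fix x assume x: "x \<in> {x \<in> carrier DL. ev m x = \<zero>\<^bsub>FX m\<^esub>}"
    then obtain z where z: "z \<in> {1..n} \<rightarrow> carrier L" "x = (\<Oplus>\<^bsub>DL\<^esub>i\<in>{1..n}. z i \<odot>\<^bsub>DL\<^esub> bv i)"
      using DL_combination by blast
    have "z i m = \<zero>\<^bsub>A m\<^esub>" if "i \<in> {1..n}" for i
      using x that ev_zero_iff[OF z(1), of m] unfolding z(2) by blast
    then have "z i \<odot>\<^bsub>DL\<^esub> bv i \<in> ?G" if "i \<in> {1..n}" for i using that z(1) bv_closed by blast
    then have "(\<lambda>i. z i \<odot>\<^bsub>DL\<^esub> bv i) \<in> {1..n} \<rightarrow> mod_span L DL ?G"
      using mod_span_superset[of ?G L DL] by blast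
    then show "x \<in> mod_span L DL ?G"
      unfolding z(2) by (rule submodule_finsum[OF module_DL mod_span_submodule[OF module_DL sub]])
  qed
qed

section \<open>Principal divisors of the layers\<close>

lemma finite_vertices: "finite (layer_divisors m)"
  by (intro finite_cartesian_product X.finite_verts finite_layer)

lemma principal_closed:
  assumes u: "u \<in> verts X" and g: "g \<in> carrier (G m)"
  shows "principal K (Y m) (u, g) \<in> carrier (FX m)"
proof -
  have "principal K (Y m) (u, g) (w, h) = \<zero>\<^bsub>K\<^esub>" if "(w, h) \<notin> layer_divisors m" for w h
  proof -
    \<comment> \<open>No arc of the layer has an end outside its vertex set, so the multiplicity
      there is zero.\<close>
    have e: "{a \<in> arcs (Y m). tail (Y m) a = (u, g) \<and> head (Y m) a = (w, h) \<or>
        tail (Y m) a = (w, h) \<and> head (Y m) a = (u, g)} = {}"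
      using that X.tail_in_verts X.head_in_verts coset_closed[OF voltage_closed, of _ m]
      by (auto intro: G.m_closed)
    have "(w, h) \<noteq> (u, g)" using that u g by auto
    then show ?thesis
      unfolding principal_def if_not_P[OF \<open>(w, h) \<noteq> (u, g)\<close>] edge_mult_def e by (simp add: add_pow_int_one zp_int_zero del: Zp_simps)
  qed
  then have zero: "principal K (Y m) (u, g) x = \<zero>\<^bsub>K\<^esub>" if "x \<notin> layer_divisors m" for x
    using that by (cases x) blast
  have "principal K (Y m) (u, g) x \<in> carrier K" for x
    by (simp add: principal_def add_pow_int_one zp_int_closed del: Zp_simps)
  moreover have "finite {x. principal K (Y m) (u, g) x \<noteq> \<zero>\<^bsub>K\<^esub>}"
    by (rule finite_subset[OF _ finite_vertices[of m]]) (use zero in blast)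
  ultimately show ?thesis using zero by (simp add: free_module_carrier del: Zp_simps)
qed

lemma K_one_not_zero: "\<one>\<^bsub>K\<^esub> \<noteq> \<zero>\<^bsub>K\<^esub>"
  by (simp add: fun_eq_iff)

text \<open>The group acts on the layer by graph automorphisms: voltages multiply sheets on the
  right in the derived graph, the action multiplies on the left.\<close>

lemma principal_translate:
  assumes i: "i \<in> {1..n}" and g: "g \<in> carrier (G m)" and h: "h \<in> carrier (G m)"
  shows "divisor_action K (G m) (single K g) (principal K (Y m) (v i, h)) = principal K (Y m) (v i, g \<otimes>\<^bsub>G m\<^esub> h)"
proof (rule layer_divisor_eqI)
  interpret Sm: group_ring_setup K "G m" by (rule group_ring_setup_layer)
  note pc = principal_closed[OF v_closed[OF i]]
  show "principal K (Y m) (v i, g \<otimes>\<^bsub>G m\<^esub> h) \<in> carrier (FX m)" using pc g h by simp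
  show "divisor_action K (G m) (single K g) (principal K (Y m) (v i, h)) \<in> carrier (FX m)"
    unfolding Sm.divisor_action_convolution[OF K.free_module_single[OF g] pc[OF h]]
    by (rule K.convolution_closed[OF Sm.translate_funcset K.free_module_single[OF g] pc[OF h]])
  fix j D assume j: "j \<in> {1..n}" and D: "D \<in> carrier (G m)"
  have "{h \<in> carrier (G m). single K g h \<noteq> \<zero>\<^bsub>K\<^esub>} = {g}"
    using g K_one_not_zero by (auto simp: single_def simp del: Zp_simps)
  then have "divisor_action K (G m) (single K g) (principal K (Y m) (v i, h)) (v j, D) =
      principal K (Y m) (v i, h) (v j, inv\<^bsub>G m\<^esub> g \<otimes>\<^bsub>G m\<^esub> D)"
    using D g K.free_module_closed[OF pc[OF h]]
    by (simp add: divisor_action_def single_def K.finsum_insert del: Zp_simps)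
  also have "\<dots> = principal K (Y m) (v i, g \<otimes>\<^bsub>G m\<^esub> h) (v j, D)"
  proof -
    have eq: "h \<otimes>\<^bsub>G m\<^esub> x = inv\<^bsub>G m\<^esub> g \<otimes>\<^bsub>G m\<^esub> D \<longleftrightarrow> (g \<otimes>\<^bsub>G m\<^esub> h) \<otimes>\<^bsub>G m\<^esub> x = D" if "x \<in> carrier (G m)" for x
      using G.inv_solve_left[OF G.m_closed[OF h that] g D] that g h D by (auto simp: G.m_assoc)
    have eq': "h = inv\<^bsub>G m\<^esub> g \<otimes>\<^bsub>G m\<^esub> D \<longleftrightarrow> g \<otimes>\<^bsub>G m\<^esub> h = D"
      using eq[OF G.one_closed] g h by simp
    have "{d \<in> edges_between (v i) (v j). h \<otimes>\<^bsub>G m\<^esub> coset m (dvoltage \<Gamma> \<alpha> d) = inv\<^bsub>G m\<^esub> g \<otimes>\<^bsub>G m\<^esub> D} =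
        {d \<in> edges_between (v i) (v j). (g \<otimes>\<^bsub>G m\<^esub> h) \<otimes>\<^bsub>G m\<^esub> coset m (dvoltage \<Gamma> \<alpha> d) = D}"
      by (intro Collect_cong conj_cong refl eq coset_closed dvoltage_closed) (simp add: edges_between_def)
    then show ?thesis
      using g h D by (simp only: principal_layer G.m_closed G.inv_closed eq')
  qed
  finally show "divisor_action K (G m) (single K g) (principal K (Y m) (v i, h)) (v j, D) =
      principal K (Y m) (v i, g \<otimes>\<^bsub>G m\<^esub> h) (v j, D)" .
qed

lemma Laplacian_funcset:
  "i \<in> {1..n} \<Longrightarrow> (\<lambda>j. toL (Laplacian_infty p \<Gamma> X \<alpha> v i j)) \<in> {1..n} \<rightarrow> carrier L"
  by (intro funcsetI to_Iwasawa_closed Laplacian_layer(1))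

lemma bp_closed: "i \<in> {1..n} \<Longrightarrow> bp i \<in> carrier DL"
  unfolding base_principal_def using Laplacian_funcset bv_closed
  by (intro DL.M.finsum_closed funcsetI DL.smult_closed) (auto simp: Pi_iff)

lemma ev_bp:
  assumes i: "i \<in> {1..n}" shows "ev m (bp i) = principal K (Y m) (v i, \<one>\<^bsub>G m\<^esub>)"
proof (rule layer_divisor_eqI)
  show "ev m (bp i) \<in> carrier (FX m)" by (rule ev_closed[OF bp_closed[OF i]])
  show "principal K (Y m) (v i, \<one>\<^bsub>G m\<^esub>) \<in> carrier (FX m)" by (rule principal_closed[OF v_closed[OF i] G.one_closed])
  fix j D assume j: "j \<in> {1..n}" and D: "D \<in> carrier (G m)"
  show "ev m (bp i) (v j, D) = principal K (Y m) (v i, \<one>\<^bsub>G m\<^esub>) (v j, D)"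
    unfolding base_principal_def ev_combination[OF Laplacian_funcset[OF i] j D] by (rule Laplacian_layer(2)[OF i j D])
qed

lemma Pr_eq: "Pr K (Y m) = mod_span K (FX m) (principal K (Y m) ` layer_divisors m)"
  by (simp add: Pr_def FX_Div)

lemma principal_subset: "principal K (Y m) ` layer_divisors m \<subseteq> carrier (FX m)"
  using principal_closed by auto

lemma Pr_submodule_K: "submodule (Pr K (Y m)) K (FX m)"
  unfolding Pr_eq by (rule mod_span_submodule[OF K.module_free_module principal_subset])

lemma principal_in_Pr: "i \<in> {1..n} \<Longrightarrow> g \<in> carrier (G m) \<Longrightarrow> principal K (Y m) (v i, g) \<in> Pr K (Y m)"
  unfolding Pr_eq using v_closed by (intro subsetD[OF mod_span_superset] imageI) auto

text \<open>The group permutes the generating principal divisors, so their Z_p-span is stable under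
  it and then under the whole group ring.\<close>

lemma Pr_submodule: "submodule (Pr K (Y m)) L (Div_layer m)"
proof -
  interpret Sm: group_ring_setup K "G m" by (rule group_ring_setup_layer)
  note E = FX.submoduleE[OF Pr_submodule_K[of m]]
  let ?conv = "convolution K (layer_divisors m) Sm.translate"
  have act: "Sm.translate g \<in> layer_divisors m \<rightarrow> layer_divisors m" if "g \<in> carrier (G m)" for g
    using that by (rule Sm.translate_funcset)
  have single: "?conv (single K g) y \<in> Pr K (Y m)" if y: "y \<in> Pr K (Y m)" and g: "g \<in> carrier (G m)" for g y
  proof -
    note gs = K.free_module_single[OF g]
    have "submodule {y \<in> carrier (FX m). ?conv (single K g) y \<in> Pr K (Y m)} K (FX m)"
      by (rule linear_maps_vimage_submodule[OF K.module_free_module K.module_free_module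
            K.convolution_linear_right[where G = "carrier (G m)" and act = Sm.translate, OF act gs] Pr_submodule_K])
    moreover have "principal K (Y m) ` layer_divisors m \<subseteq> {y \<in> carrier (FX m). ?conv (single K g) y \<in> Pr K (Y m)}"
    proof
      fix y assume "y \<in> principal K (Y m) ` layer_divisors m"
      then obtain i h where ih: "i \<in> {1..n}" "h \<in> carrier (G m)" "y = principal K (Y m) (v i, h)"
        by (auto elim!: v_cases)
      then show "y \<in> {y \<in> carrier (FX m). ?conv (single K g) y \<in> Pr K (Y m)}"
        using principal_translate[OF ih(1) g ih(2)] principal_closed[OF v_closed[OF ih(1)] ih(2)]
          principal_in_Pr[OF ih(1) G.m_closed[OF g ih(2)]]
        by (simp add: Sm.divisor_action_convolution[OF gs principal_closed[OF v_closed[OF ih(1)] ih(2)]])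
    qed
    ultimately have "Pr K (Y m) \<subseteq> {y \<in> carrier (FX m). ?conv (single K g) y \<in> Pr K (Y m)}"
      unfolding Pr_eq by (rule mod_span_minimal)
    with y show ?thesis by blast
  qed
  \<comment> \<open>With \<open>y\<close> fixed, the elements of the group ring that map it into Pr
    form a Z_p-submodule containing the group elements.\<close>
  have smult: "?conv f y \<in> Pr K (Y m)" if y: "y \<in> Pr K (Y m)" and f: "f \<in> carrier (free_module K (carrier (G m)))" for f y
  proof -
    have "submodule {f \<in> carrier (free_module K (carrier (G m))). ?conv f y \<in> Pr K (Y m)} K (free_module K (carrier (G m)))"
      using E(1) y
      by (intro linear_maps_vimage_submodule[OF K.module_free_module K.module_free_module
            K.convolution_linear_left Pr_submodule_K]) (auto simp: act)
    then have "carrier (free_module K (carrier (G m))) \<subseteq>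
        {f \<in> carrier (free_module K (carrier (G m))). ?conv f y \<in> Pr K (Y m)}"
      by (rule K.free_module_generated) (simp add: single[OF y] K.free_module_single)
    with f show ?thesis by blast
  qed
  show ?thesis
  proof (rule N.submoduleI)
    show "Pr K (Y m) \<subseteq> carrier (Div_layer m)" using E(1) by (simp add: FX_Div)
    show "\<zero>\<^bsub>Div_layer m\<^esub> \<in> Pr K (Y m)"
      using subgroup.one_closed[OF submodule.axioms(1)[OF Pr_submodule_K, of m]] by (simp add: FX_Div)
    show "\<And>a b. a \<in> Pr K (Y m) \<Longrightarrow> b \<in> Pr K (Y m) \<Longrightarrow> a \<oplus>\<^bsub>Div_layer m\<^esub> b \<in> Pr K (Y m)"
      using E(5) by (simp add: FX_Div)
    show smult': "a \<odot>\<^bsub>Div_layer m\<^esub> x \<in> Pr K (Y m)" if "a \<in> carrier L" "x \<in> Pr K (Y m)" for a x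
      using smult[OF that(2) component_closed'[OF that(1)]] E(1) that
      by (auto simp: Sm.divisor_action_convolution[OF component_closed'[OF that(1)]])
    fix a assume a: "a \<in> Pr K (Y m)"
    then have "a \<in> carrier (Div_layer m)" using E(1) by (auto simp: FX_Div)
    then have "\<ominus>\<^bsub>Div_layer m\<^esub> a = (\<ominus>\<^bsub>L\<^esub> \<one>\<^bsub>L\<^esub>) \<odot>\<^bsub>Div_layer m\<^esub> a"
      by (simp only: N.smult_l_minus[OF L.one_closed] N.smult_one)
    then show "\<ominus>\<^bsub>Div_layer m\<^esub> a \<in> Pr K (Y m)" using smult'[OF L.a_inv_closed[OF L.one_closed] a] by simp
  qed
qed

lemma group_like_action:
  assumes x: "x \<in> carrier \<Gamma>"
  shows "group_like x \<odot>\<^bsub>Div_layer m\<^esub> y = divisor_action K (G m) (single K (coset m x)) y"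
  by (simp add: group_like_component[OF x])

lemma Pr_Lambda_submodule: "submodule (Pr_Lambda p \<Gamma> X \<alpha> n v) L DL"
  unfolding Pr_Lambda_def using bp_closed by (intro mod_span_submodule module_DL) auto

text \<open>The p_(i,0) produce only the principal divisors on the identity sheet. The other sheets
  are reached since each coset lifts to Gamma and acts through its image in Lambda.\<close>

lemma ev_Pr_Lambda: "ev m ` Pr_Lambda p \<Gamma> X \<alpha> n v = Pr K (Y m)"
proof
  have "Pr_Lambda p \<Gamma> X \<alpha> n v \<subseteq> {x \<in> carrier DL. ev m x \<in> Pr K (Y m)}"
    unfolding Pr_Lambda_def
    using bp_closed principal_in_Pr[OF _ G.one_closed]
    by (intro mod_span_minimal linear_maps_vimage_submodule[OF module_DL module_Div_layer ev_spec(1) Pr_submodule])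
       (auto simp: ev_bp)
  then show "ev m ` Pr_Lambda p \<Gamma> X \<alpha> n v \<subseteq> Pr K (Y m)" by auto
  have S: "submodule (ev m ` Pr_Lambda p \<Gamma> X \<alpha> n v) L (Div_layer m)"
    by (rule linear_maps_image_submodule[OF module_DL module_Div_layer ev_spec(1) Pr_Lambda_submodule])
  have "principal K (Y m) ` layer_divisors m \<subseteq> ev m ` Pr_Lambda p \<Gamma> X \<alpha> n v"
  proof
    fix y assume "y \<in> principal K (Y m) ` layer_divisors m"
    then obtain i h where ih: "i \<in> {1..n}" "h \<in> carrier (G m)" "y = principal K (Y m) (v i, h)"
      by (auto elim!: v_cases)
    obtain x where x: "x \<in> carrier \<Gamma>" "h = coset m x" using ih(2) by (auto simp: carrier_layer)
    have "bp i \<in> Pr_Lambda p \<Gamma> X \<alpha> n v"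
      unfolding Pr_Lambda_def using ih(1) by (intro subsetD[OF mod_span_superset] imageI)
    then have "ev m (bp i) \<in> ev m ` Pr_Lambda p \<Gamma> X \<alpha> n v" by (rule imageI)
    from N.submoduleE(4)[OF S group_like_closed[OF x(1)] this]
    show "y \<in> ev m ` Pr_Lambda p \<Gamma> X \<alpha> n v"
      unfolding group_like_action[OF x(1)] ev_bp[OF ih(1)]
      using principal_translate[OF ih(1) ih(2) G.one_closed] ih(2) by (simp add: ih(3) x(2)[symmetric])
  qed
  then show "Pr K (Y m) \<subseteq> ev m ` Pr_Lambda p \<Gamma> X \<alpha> n v"
    unfolding Pr_eq by (intro mod_span_minimal submodule_over_K S)
qed

text \<open>A vertex of the layer is the image of a base vertex multiplied by a lift of its sheet to
  Gamma.\<close>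

lemma ev_surj: "carrier (Div_layer m) \<subseteq> ev m ` carrier DL"
proof -
  have S: "submodule (ev m ` carrier DL) L (Div_layer m)"
    by (rule linear_maps_image_submodule[OF module_DL module_Div_layer ev_spec(1) DL.carrier_is_submodule])
  have "single K b \<in> ev m ` carrier DL" if "b \<in> layer_divisors m" for b
  proof -
    from that obtain i h where ih: "i \<in> {1..n}" "h \<in> carrier (G m)" "b = (v i, h)" by (auto elim!: v_cases)
    obtain x where x: "x \<in> carrier \<Gamma>" "h = coset m x" using ih(2) by (auto simp: carrier_layer)
    have "ev m (group_like x \<odot>\<^bsub>DL\<^esub> bv i) = divisor_action K (G m) (single K h) (single K (v i, \<one>\<^bsub>G m\<^esub>))"
      using ev(3)[OF group_like_closed[OF x(1)] bv_closed[OF ih(1)], of m]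
      unfolding group_like_action[OF x(1)] ev_bv[OF ih(1)] x(2)[symmetric] .
    also have "\<dots> = single K b"
      using divisor_action_single_scaled[OF group_ring_setup_layer K.one_closed ih(2) v_closed[OF ih(1)] G.one_closed[of m]]
        ih(2) K.free_module_closed[OF K.free_module_single[of h "carrier (G m)"]]
        K.free_module_closed[OF vertex_closed[OF ih(1,2)]]
      by (simp add: ih(3) del: Zp_simps)
    finally show ?thesis using DL.smult_closed[OF group_like_closed[OF x(1)] bv_closed[OF ih(1)]] by (metis imageI)
  qed
  from K.free_module_generated[OF submodule_over_K[OF S] this]
  show ?thesis by (simp add: FX_Div)
qed

section \<open>Divisors of degree zero\<close>

lemma total_closed: "f \<in> carrier (free_module K B) \<Longrightarrow> K.total f \<in> carrier K"
  using linear_mapsD(1)[OF K.total_linear] by simp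

text \<open>The sum is the degree of v_i minus the number of directed edges that leave v_i. These
  agree, a loop counting twice on both sides.\<close>

lemma total_principal:
  assumes i: "i \<in> {1..n}"
  shows "K.total (principal K (Y m) (v i, \<one>\<^bsub>G m\<^esub>)) = \<zero>\<^bsub>K\<^esub>"
proof -
  let ?P = "principal K (Y m) (v i, \<one>\<^bsub>G m\<^esub>)"
  let ?c = "\<lambda>d. coset m (dvoltage \<Gamma> \<alpha> d)"
  let ?O = "{d \<in> directed_edges X. dsource X d = v i}"
  let ?end = "\<lambda>d. (dtarget X d, ?c d)"
  note P = principal_closed[OF v_closed[OF i] G.one_closed, of m]
  have finO: "finite ?O" by (rule finite_subset[OF _ finite_directed_edges]) auto
  have cc: "?c d \<in> carrier (G m)" if "d \<in> directed_edges X" for d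
    using that by (intro coset_closed dvoltage_closed)
  have "K.total ?P = (\<Oplus>\<^bsub>K\<^esub>x\<in>layer_divisors m. ?P x)"
    unfolding K.total_eq[OF P]
    using P finite_vertices[of m] K.free_module_closed[OF P]
    by (intro K.add.finprod_mono_neutral_cong_left) (auto simp: free_module_carrier simp del: Zp_simps)
  also have "\<dots> = (\<Oplus>\<^bsub>K\<^esub>x\<in>layer_divisors m.
      \<iota> ((if x = (v i, \<one>\<^bsub>G m\<^esub>) then int (mdegree X (v i)) else 0) - int (card {d \<in> ?O. ?end d = x})))"
  proof (rule K.finsum_cong'[OF refl])
    fix x assume "x \<in> layer_divisors m"
    then obtain w h where x: "x = (w, h)" "h \<in> carrier (G m)" by auto
    have "{d \<in> edges_between (v i) w. \<one>\<^bsub>G m\<^esub> \<otimes>\<^bsub>G m\<^esub> ?c d = h} = {d \<in> ?O. ?end d = x}"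
      using cc by (auto simp: edges_between_def x)
    then show "?P x = \<iota> ((if x = (v i, \<one>\<^bsub>G m\<^esub>) then int (mdegree X (v i)) else 0) - int (card {d \<in> ?O. ?end d = x}))"
      unfolding x(1) principal_layer[OF G.one_closed x(2)] by (auto simp: eq_commute)
  qed (simp add: zp_int_closed)
  also have "\<dots> = \<iota> (\<Sum>x\<in>layer_divisors m.
      (if x = (v i, \<one>\<^bsub>G m\<^esub>) then int (mdegree X (v i)) else 0) - int (card {d \<in> ?O. ?end d = x}))"
    by (rule finsum_zp_int)
  also have "(\<Sum>x\<in>layer_divisors m.
      (if x = (v i, \<one>\<^bsub>G m\<^esub>) then int (mdegree X (v i)) else 0) - int (card {d \<in> ?O. ?end d = x})) = 0"
  proof -
    have "(\<Sum>x\<in>layer_divisors m. (if x = (v i, \<one>\<^bsub>G m\<^esub>) then int (mdegree X (v i)) else 0)) = int (mdegree X (v i))"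
      using finite_vertices[of m] v_closed[OF i] by (simp add: sum.delta)
    moreover have "(\<Sum>x\<in>layer_divisors m. int (card {d \<in> ?O. ?end d = x})) = int (card ?O)"
    proof -
      \<comment> \<open>The outgoing directed edges are grouped by the vertex of the layer at which
        their lifts end.\<close>
      have end_closed: "?end ` ?O \<subseteq> layer_divisors m"
        using cc X.head_in_verts X.tail_in_verts by (force simp: directed_edges_def split: if_splits)
      have "(\<Sum>x\<in>layer_divisors m. \<Sum>d\<in>{d \<in> ?O. ?end d = x}. 1) = (\<Sum>d\<in>?O. (1 :: int))"
        by (rule sum.group[OF finO finite_vertices end_closed])
      then show ?thesis by simp
    qed
    moreover have "card ?O = mdegree X (v i)"
    proof -
      \<comment> \<open>An edge leaving v_i in the directed sense is an arc out of v_i or an arc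
        into v_i traversed backwards.\<close>
      have "?O = (\<lambda>e. (e, True)) ` out_arcs X (v i) \<union> (\<lambda>e. (e, False)) ` in_arcs X (v i)"
        by (auto simp: directed_edges_def out_arcs_def in_arcs_def image_iff split: if_splits)
      also have "card \<dots> = card (out_arcs X (v i)) + card (in_arcs X (v i))"
        using X.finite_out_arcs X.finite_in_arcs
        by (subst card_Un_disjoint) (auto simp: card_image inj_on_def)
      finally show ?thesis by (simp add: mdegree_def out_degree_def in_degree_def)
    qed
    ultimately show ?thesis by (simp add: sum_subtractf)
  qed
  finally show ?thesis unfolding zp_int_zero .
qed

lemma Div0_eq: "Div0 K (Y m) = {d \<in> carrier (FX m). K.total d = \<zero>\<^bsub>K\<^esub>}"
proof -
  have "(\<Oplus>\<^bsub>K\<^esub>x\<in>{x \<in> verts (Y m). d x \<noteq> \<zero>\<^bsub>K\<^esub>}. d x) = K.total d" if d: "d \<in> carrier (FX m)" for d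
  proof -
    have "{x \<in> verts (Y m). d x \<noteq> \<zero>\<^bsub>K\<^esub>} = {x. d x \<noteq> \<zero>\<^bsub>K\<^esub>}"
      using d by (auto simp: free_module_carrier simp del: Zp_simps)
    then show ?thesis by (simp only: K.total_eq[OF d])
  qed
  then show ?thesis unfolding Div0_def FX_Div by auto
qed

lemma total_action:
  assumes z: "z \<in> carrier L" and d: "d \<in> carrier (FX m)"
  shows "K.total (divisor_action K (G m) (z m) d) = K.total (z m) \<otimes>\<^bsub>K\<^esub> K.total d"
proof -
  interpret Sm: group_ring_setup K "G m" by (rule group_ring_setup_layer)
  have act: "Sm.translate g \<in> layer_divisors m \<rightarrow> layer_divisors m" if "g \<in> carrier (G m)" for g
    using that by (rule Sm.translate_funcset)
  show ?thesis
    unfolding Sm.divisor_action_convolution[OF component_closed'[OF z] d]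
    by (rule K.total_convolution[OF act component_closed'[OF z] d])
qed

text \<open>Transition maps are pushforwards and preserve the coefficient sum, so the augmentation
  of an element of Lambda is visible already in layer 0.\<close>

lemma total_component:
  assumes z: "z \<in> carrier L" shows "K.total (z m) = K.total (z 0)"
proof (induction m)
  case (Suc m)
  have "z m = pushforward K (carrier (G m)) (transition m) (z (Suc m))" using z by (simp add: L_carrier)
  then have "K.total (z m) = K.total (z (Suc m))"
    using K.total_pushforward[OF transition_funcset component_closed'[OF z, of "Suc m"]] by simp
  with Suc show ?case by simp
qed simp

lemma Div0_submodule: "submodule (Div0 K (Y m)) L (Div_layer m)"
proof -
  note lin = K.total_linear[of "layer_divisors m"]
  have S: "submodule (Div0 K (Y m)) K (FX m)"
    using linear_maps_kernel_submodule[OF K.module_free_module module_self_module[OF K.is_cring] lin]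
    unfolding Div0_eq self_module_simps .
  note E = FX.submoduleE[OF S]
  show ?thesis
  proof (rule N.submoduleI)
    show "Div0 K (Y m) \<subseteq> carrier (Div_layer m)" using E(1) by (simp add: FX_Div)
    show "\<zero>\<^bsub>Div_layer m\<^esub> \<in> Div0 K (Y m)"
      using subgroup.one_closed[OF submodule.axioms(1)[OF S]] by (simp add: FX_Div)
    show "\<And>a b. a \<in> Div0 K (Y m) \<Longrightarrow> b \<in> Div0 K (Y m) \<Longrightarrow> a \<oplus>\<^bsub>Div_layer m\<^esub> b \<in> Div0 K (Y m)"
      using E(5) by (simp add: FX_Div)
    show smult: "a \<odot>\<^bsub>Div_layer m\<^esub> x \<in> Div0 K (Y m)" if a: "a \<in> carrier L" and x: "x \<in> Div0 K (Y m)" for a x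
    proof -
      have x': "x \<in> carrier (FX m)" "K.total x = \<zero>\<^bsub>K\<^esub>" using x by (auto simp: Div0_eq)
      have "a \<odot>\<^bsub>Div_layer m\<^esub> x \<in> carrier (FX m)"
        using N.smult_closed[OF a, of x m] x' by (simp add: FX_Div)
      then show ?thesis
        using total_action[OF a x'(1)] K.r_null[OF total_closed[OF component_closed'[OF a]]] x'(2)
        by (simp add: Div0_eq del: Zp_simps)
    qed
    fix a assume a: "a \<in> Div0 K (Y m)"
    then have "a \<in> carrier (Div_layer m)" using E(1) by (auto simp: FX_Div)
    then have "\<ominus>\<^bsub>Div_layer m\<^esub> a = (\<ominus>\<^bsub>L\<^esub> \<one>\<^bsub>L\<^esub>) \<odot>\<^bsub>Div_layer m\<^esub> a"
      by (simp only: N.smult_l_minus[OF L.one_closed] N.smult_one)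
    then show "\<ominus>\<^bsub>Div_layer m\<^esub> a \<in> Div0 K (Y m)" using smult[OF L.a_inv_closed[OF L.one_closed] a] by simp
  qed
qed

lemma principal_in_Div0: "i \<in> {1..n} \<Longrightarrow> principal K (Y m) (v i, \<one>\<^bsub>G m\<^esub>) \<in> Div0 K (Y m)"
  unfolding Div0_eq using principal_closed[OF v_closed G.one_closed] total_principal by blast

text \<open>The coefficient sum was computed on the identity sheet only. Passing through
  \<open>Pr_Lambda\<close> covers the other sheets, since Div^0 is stable under Lambda.\<close>

lemma Pr_subset_Div0: "Pr K (Y m) \<subseteq> Div0 K (Y m)"
proof -
  have "Pr_Lambda p \<Gamma> X \<alpha> n v \<subseteq> {x \<in> carrier DL. ev m x \<in> Div0 K (Y m)}"
    unfolding Pr_Lambda_def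
    using bp_closed principal_in_Div0
    by (intro mod_span_minimal linear_maps_vimage_submodule[OF module_DL module_Div_layer ev_spec(1) Div0_submodule])
       (auto simp: ev_bp)
  then show ?thesis unfolding ev_Pr_Lambda[symmetric] by blast
qed

text \<open>A base vertex has degree one, so every coefficient contributes its augmentation. The
  right-hand side is free of \<open>m\<close>, which is what makes one module serve all
  layers.\<close>

lemma total_ev:
  assumes z: "z \<in> {1..n} \<rightarrow> carrier L"
  shows "K.total (ev m (\<Oplus>\<^bsub>DL\<^esub>i\<in>{1..n}. z i \<odot>\<^bsub>DL\<^esub> bv i)) = (\<Oplus>\<^bsub>K\<^esub>i\<in>{1..n}. K.total (z i 0))"
proof -
  have zi: "z i \<in> carrier L" if "i \<in> {1..n}" for i using z that by auto
  have "K.total (ev m (\<Oplus>\<^bsub>DL\<^esub>i\<in>{1..n}. z i \<odot>\<^bsub>DL\<^esub> bv i)) =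
     (\<Oplus>\<^bsub>K\<^esub>i\<in>{1..n}. K.total (divisor_action K (G m) (z i m) (single K (v i, \<one>\<^bsub>G m\<^esub>))))"
    unfolding ev_combination_eq(1)[OF z]
    using linear_maps_finsum[OF K.module_free_module module_self_module[OF K.is_cring] K.total_linear
        ev_combination_eq(2)[OF z]] by (simp only: finsum_self_module)
  also have "\<dots> = (\<Oplus>\<^bsub>K\<^esub>i\<in>{1..n}. K.total (z i 0))"
  proof (rule K.finsum_cong'[OF refl])
    show "(\<lambda>i. K.total (z i 0)) \<in> {1..n} \<rightarrow> carrier K"
      by (intro funcsetI) (rule total_closed[OF component_closed'[OF zi]])
    fix i assume i: "i \<in> {1..n}"
    show "K.total (divisor_action K (G m) (z i m) (single K (v i, \<one>\<^bsub>G m\<^esub>))) = K.total (z i 0)"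
      unfolding total_action[OF zi[OF i] vertex_closed[OF i G.one_closed]] K.total_single total_component[OF zi[OF i], of m]
      by (rule K.r_one[OF total_closed[OF component_closed'[OF zi[OF i]]]])
  qed
  finally show ?thesis .
qed

text \<open>Every x is its own p^0-th power, so layer 0 has the trivial group, its group ring has a
  single coefficient, and the coefficient sum is that coefficient.\<close>

lemma total_layer_zero:
  assumes f: "f \<in> carrier (A 0)" and "K.total f = \<zero>\<^bsub>K\<^esub>" shows "f = \<zero>\<^bsub>A 0\<^esub>"
proof -
  have f': "f \<in> carrier (free_module K (carrier (G 0)))" using f by simp
  have "carrier (G 0) = {\<one>\<^bsub>G 0\<^esub>}"
  proof -
    have "coset 0 x = \<one>\<^bsub>G 0\<^esub>" if "x \<in> carrier \<Gamma>" for x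
      using powers_pow[OF that, of 1] that by (intro coset_powers) simp
    then show ?thesis by (auto simp only: carrier_layer intro: \<Gamma>.one_closed)
  qed
  then have f0: "f D = \<zero>\<^bsub>K\<^esub>" if "D \<noteq> \<one>\<^bsub>G 0\<^esub>" for D
    using f' that unfolding free_module_carrier by blast
  have "K.total f = (\<Oplus>\<^bsub>K\<^esub>D\<in>{\<one>\<^bsub>G 0\<^esub>}. f D)"
    unfolding K.total_eq[OF f']
    by (rule K.add.finprod_mono_neutral_cong_left) (use f0 K.free_module_closed[OF f'] in blast)+
  also have "\<dots> = f \<one>\<^bsub>G 0\<^esub>"
    by (subst K.finsum_insert) (simp_all add: K.free_module_closed[OF f'] del: Zp_simps)
  finally have "f \<one>\<^bsub>G 0\<^esub> = \<zero>\<^bsub>K\<^esub>" using assms(2) by (rule trans[OF sym])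
  then have "f D = \<zero>\<^bsub>K\<^esub>" for D using f0[of D] by blast
  then show ?thesis by (simp add: fun_eq_iff)
qed

section \<open>The module \<open>M_Lambda\<close> and its relations\<close>

lemma Tvar_eq: "i \<in> {1..l} \<Longrightarrow> Tvar p \<Gamma> \<gamma> i = aug 0 i"
  using \<gamma>_closed by (simp add: Tvar_def aug_def group_like_def del: L_simps)

text \<open>Since 1 + T_i is the group element gamma_i, its p^m-th power is gamma_i^(p^m).\<close>

lemma omega_eq:
  assumes i: "i \<in> {1..l}" shows "omega p \<Gamma> m (Tvar p \<Gamma> \<gamma> i) = aug m i"
proof -
  have "\<one>\<^bsub>L\<^esub> \<oplus>\<^bsub>L\<^esub> Tvar p \<Gamma> \<gamma> i = group_like (\<gamma> i)"
    using \<gamma>_closed[OF i] L.diff_add_eq[OF group_like_closed[OF \<gamma>_closed[OF i]] L.one_closed]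
    by (simp add: Tvar_def group_like_def[symmetric] L.a_comm del: L_simps)
  then show ?thesis
    using group_like_pow[OF \<gamma>_closed[OF i], of "p ^ m"] by (simp add: omega_def aug_def del: L_simps)
qed

abbreviation "M\<^sub>\<Lambda> \<equiv> M_Lambda p l \<Gamma> \<gamma> X \<alpha> n v"
abbreviation "T_part \<equiv> ideal_smult L (Idl\<^bsub>L\<^esub> (Tvar p \<Gamma> \<gamma> ` {1..l})) DL"

text \<open>The case m = 0 of the kernel computation, because T_i is the generator of level
  0.\<close>

lemma T_part_eq: "T_part = {x \<in> carrier DL. ev 0 x = \<zero>\<^bsub>FX 0\<^esub>}"
proof -
  have "Tvar p \<Gamma> \<gamma> ` {1..l} = aug 0 ` {1..l}" by (rule image_cong[OF refl Tvar_eq])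
  then show ?thesis using ideal_smult_aug by simp
qed

lemma M_Lambda_generators:
  "M\<^sub>\<Lambda> = mod_span L DL (bp ` {1..n} \<union> {bv i \<ominus>\<^bsub>DL\<^esub> bv j | i j. 1 \<le> j \<and> j < i \<and> i \<le> n} \<union> T_part)"
  by (simp only: M_Lambda_def Let_def)

lemma bv_minus_closed: "i \<in> {1..n} \<Longrightarrow> j \<in> {1..n} \<Longrightarrow> bv i \<ominus>\<^bsub>DL\<^esub> bv j \<in> carrier DL"
  by (intro DL.M.minus_closed bv_closed)

lemma M_Lambda_generators_closed:
  "bp ` {1..n} \<union> {bv i \<ominus>\<^bsub>DL\<^esub> bv j | i j. 1 \<le> j \<and> j < i \<and> i \<le> n} \<union> T_part \<subseteq> carrier DL"
proof -
  have "bv i \<ominus>\<^bsub>DL\<^esub> bv j \<in> carrier DL" if "1 \<le> j" "j < i" "i \<le> n" for i j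
    using that by (intro bv_minus_closed) auto
  then show ?thesis unfolding T_part_eq using bp_closed by blast
qed

text \<open>The left-hand side is free of \<open>m\<close>. The degree of an image does not depend
  on the layer, so membership can be decided by degrees in layer m and used through vanishing in
  layer 0.\<close>

lemma M_Lambda_eq: "M\<^sub>\<Lambda> = {x \<in> carrier DL. ev m x \<in> Div0 K (Y m)}"
proof
  have "bp i \<in> {x \<in> carrier DL. ev m x \<in> Div0 K (Y m)}" if "i \<in> {1..n}" for i
    using bp_closed[OF that] ev_bp[OF that] principal_in_Div0[OF that] by simp
  moreover have "bv i \<ominus>\<^bsub>DL\<^esub> bv j \<in> {x \<in> carrier DL. ev m x \<in> Div0 K (Y m)}" if "1 \<le> j" "j < i" "i \<le> n" for i j
  proof -
    have ij: "i \<in> {1..n}" "j \<in> {1..n}" using that by auto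
    note c = vertex_closed[OF ij(1) G.one_closed[of m]] vertex_closed[OF ij(2) G.one_closed[of m]]
    have "ev m (bv i \<ominus>\<^bsub>DL\<^esub> bv j) = single K (v i, \<one>\<^bsub>G m\<^esub>) \<ominus>\<^bsub>Div_layer m\<^esub> single K (v j, \<one>\<^bsub>G m\<^esub>)"
      unfolding linear_maps_minus[OF module_DL module_Div_layer ev_spec(1) bv_closed[OF ij(1)] bv_closed[OF ij(2)]]
        ev_bv[OF ij(1)] ev_bv[OF ij(2)] ..
    also have "\<dots> = single K (v i, \<one>\<^bsub>G m\<^esub>) \<ominus>\<^bsub>FX m\<^esub> single K (v j, \<one>\<^bsub>G m\<^esub>)"
      by (simp add: a_minus_def a_inv_def m_inv_def FX_Div)
    finally have e: "ev m (bv i \<ominus>\<^bsub>DL\<^esub> bv j) = single K (v i, \<one>\<^bsub>G m\<^esub>) \<ominus>\<^bsub>FX m\<^esub> single K (v j, \<one>\<^bsub>G m\<^esub>)" .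
    have "K.total (single K (v i, \<one>\<^bsub>G m\<^esub>) \<ominus>\<^bsub>FX m\<^esub> single K (v j, \<one>\<^bsub>G m\<^esub>)) =
        \<one>\<^bsub>K\<^esub> \<ominus>\<^bsub>self_module K\<^esub> \<one>\<^bsub>K\<^esub>"
      unfolding linear_maps_minus[OF K.module_free_module module_self_module[OF K.is_cring] K.total_linear c]
        K.total_single ..
    also have "\<dots> = \<zero>\<^bsub>K\<^esub>" using K.r_neg[OF K.one_closed] by (simp add: a_minus_def)
    finally show ?thesis
      using ev_closed[OF bv_minus_closed[OF ij], of m] bv_minus_closed[OF ij] unfolding Div0_eq e[symmetric] by blast
  qed
  moreover have "T_part \<subseteq> {x \<in> carrier DL. ev m x \<in> Div0 K (Y m)}"
  proof
    fix x assume "x \<in> T_part"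
    then have x: "x \<in> carrier DL" "ev 0 x = \<zero>\<^bsub>FX 0\<^esub>" by (simp_all only: T_part_eq mem_Collect_eq)
    obtain z where z: "z \<in> {1..n} \<rightarrow> carrier L" "x = (\<Oplus>\<^bsub>DL\<^esub>i\<in>{1..n}. z i \<odot>\<^bsub>DL\<^esub> bv i)"
      by (rule DL_combination[OF x(1)])
    \<comment> \<open>An element that dies in layer 0 has degree zero there, hence in every
      layer.\<close>
    have "K.total (ev m x) = K.total (ev 0 x)" unfolding z(2) total_ev[OF z(1)] ..
    also have "\<dots> = \<zero>\<^bsub>K\<^esub>"
      unfolding x(2) using linear_maps_zero[OF K.module_free_module module_self_module[OF K.is_cring] K.total_linear]
      by (simp only: self_module_simps)
    finally show "x \<in> {x \<in> carrier DL. ev m x \<in> Div0 K (Y m)}"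
      using x(1) ev_closed[OF x(1)] by (simp add: Div0_eq del: Zp_simps)
  qed
  ultimately show "M\<^sub>\<Lambda> \<subseteq> {x \<in> carrier DL. ev m x \<in> Div0 K (Y m)}"
    unfolding M_Lambda_generators
    by (intro mod_span_minimal linear_maps_vimage_submodule[OF module_DL module_Div_layer ev_spec(1) Div0_submodule]) blast
  show "{x \<in> carrier DL. ev m x \<in> Div0 K (Y m)} \<subseteq> M\<^sub>\<Lambda>"
  proof
    fix x assume x: "x \<in> {x \<in> carrier DL. ev m x \<in> Div0 K (Y m)}"
    then obtain z where z: "z \<in> {1..n} \<rightarrow> carrier L" "x = (\<Oplus>\<^bsub>DL\<^esub>i\<in>{1..n}. z i \<odot>\<^bsub>DL\<^esub> bv i)"
      using DL_combination by blast
    have zi: "z i \<in> carrier L" if "i \<in> {1..n}" for i using z that by auto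
    have M: "submodule M\<^sub>\<Lambda> L DL"
      unfolding M_Lambda_generators by (rule mod_span_submodule[OF module_DL M_Lambda_generators_closed])
    show "x \<in> M\<^sub>\<Lambda>"
    proof (cases "n = 0")
      \<comment> \<open>Within the locale the graph may be empty, and then there is no vertex
        \<open>v 1\<close> to subtract.\<close>
      case True
      then have "x = \<zero>\<^bsub>DL\<^esub>" unfolding z(2) by simp
      then show ?thesis using subgroup.one_closed[OF submodule.axioms(1)[OF M]] by simp
    next
      case False
      then have one: "1 \<in> {1..n}" by simp
      \<comment> \<open>With \<open>s = \<Sum> z\<^sub>i\<close> we have \<open>x = \<Sum> z\<^sub>i (v\<^sub>i - v\<^sub>1) + s v\<^sub>1\<close>, and \<open>s\<close> lies in the augmentation ideal.\<close>
      let ?s = "\<Oplus>\<^bsub>L\<^esub>i\<in>{1..n}. z i"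
      have s: "?s \<in> carrier L" using zi by (intro L.finsum_closed) auto
      have d: "bv i \<ominus>\<^bsub>DL\<^esub> bv 1 \<in> M\<^sub>\<Lambda>" if i: "i \<in> {1..n}" for i
      proof (cases "i = 1")
        case True
        have "bv 1 \<ominus>\<^bsub>DL\<^esub> bv 1 = \<zero>\<^bsub>DL\<^esub>" using bv_closed[OF one] by (simp add: a_minus_def DL.M.r_neg)
        then show ?thesis using True subgroup.one_closed[OF submodule.axioms(1)[OF M]] by simp
      next
        case False
        then have "bv i \<ominus>\<^bsub>DL\<^esub> bv 1 \<in> {bv i \<ominus>\<^bsub>DL\<^esub> bv j | i j. 1 \<le> j \<and> j < i \<and> i \<le> n}"
          using i by (intro CollectI exI[of _ i] exI[of _ 1]) auto
        then show ?thesis unfolding M_Lambda_generators by (intro subsetD[OF mod_span_superset]) blast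
      qed
      have split: "z i \<odot>\<^bsub>DL\<^esub> bv i = z i \<odot>\<^bsub>DL\<^esub> (bv i \<ominus>\<^bsub>DL\<^esub> bv 1) \<oplus>\<^bsub>DL\<^esub> z i \<odot>\<^bsub>DL\<^esub> bv 1"
        if i: "i \<in> {1..n}" for i
      proof -
        have "bv i = (bv i \<ominus>\<^bsub>DL\<^esub> bv 1) \<oplus>\<^bsub>DL\<^esub> bv 1"
          using bv_closed[OF i] bv_closed[OF one] by (simp add: a_minus_def DL.M.a_assoc DL.M.l_neg)
        then show ?thesis
          using DL.smult_r_distr[OF zi[OF i] bv_minus_closed[OF i one] bv_closed[OF one]] by simp
      qed
      have "x = (\<Oplus>\<^bsub>DL\<^esub>i\<in>{1..n}. z i \<odot>\<^bsub>DL\<^esub> (bv i \<ominus>\<^bsub>DL\<^esub> bv 1) \<oplus>\<^bsub>DL\<^esub> z i \<odot>\<^bsub>DL\<^esub> bv 1)"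
        unfolding z(2)
        by (rule DL.finsum_cong_closed[OF split])
           (assumption, intro DL.M.add.m_closed DL.smult_closed zi bv_minus_closed bv_closed one)
      also have "\<dots> = (\<Oplus>\<^bsub>DL\<^esub>i\<in>{1..n}. z i \<odot>\<^bsub>DL\<^esub> (bv i \<ominus>\<^bsub>DL\<^esub> bv 1)) \<oplus>\<^bsub>DL\<^esub> (\<Oplus>\<^bsub>DL\<^esub>i\<in>{1..n}. z i \<odot>\<^bsub>DL\<^esub> bv 1)"
        by (intro DL.M.finsum_addf funcsetI DL.smult_closed zi bv_minus_closed bv_closed one)
      also have "(\<Oplus>\<^bsub>DL\<^esub>i\<in>{1..n}. z i \<odot>\<^bsub>DL\<^esub> bv 1) = ?s \<odot>\<^bsub>DL\<^esub> bv 1"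
      proof -
        have "(\<lambda>a. a \<odot>\<^bsub>DL\<^esub> bv 1) \<in> linear_maps L (self_module L) DL"
          using bv_closed[OF one] by (auto simp: linear_maps_def DL.smult_l_distr DL.smult_assoc1 simp del: L_simps)
        from linear_maps_finsum[OF module_L module_DL this, of z "{1..n}"] show ?thesis
          using z(1) by (simp only: self_module_simps finsum_self_module)
      qed
      finally have x_eq: "x = (\<Oplus>\<^bsub>DL\<^esub>i\<in>{1..n}. z i \<odot>\<^bsub>DL\<^esub> (bv i \<ominus>\<^bsub>DL\<^esub> bv 1)) \<oplus>\<^bsub>DL\<^esub> ?s \<odot>\<^bsub>DL\<^esub> bv 1" .
      \<comment> \<open>The augmentation of \<open>?s\<close> is the degree of \<open>x\<close>,
        which is zero; in layer 0 this forces the whole component to vanish.\<close>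
      have "?s 0 = \<zero>\<^bsub>A 0\<^esub>"
      proof (rule total_layer_zero[OF component_closed[OF s]])
        interpret h: ring_hom_cring L "A 0" "\<lambda>z. z 0"
          by (intro ring_hom_cring.intro ring_hom_cring_axioms.intro L.is_cring A.is_cring component_hom)
        have "?s 0 = (\<Oplus>\<^bsub>FX\<^esub>i\<in>{1..n}. z i 0)"
          if "FX = free_module K (carrier (G 0))" for FX
          using h.hom_finsum[OF z(1)] by (simp add: comp_def that)
        then have "K.total (?s 0) = (\<Oplus>\<^bsub>K\<^esub>i\<in>{1..n}. K.total (z i 0))"
          using linear_maps_finsum[OF K.module_free_module module_self_module[OF K.is_cring] K.total_linear[of "carrier (G 0)"],
              of "\<lambda>i. z i 0" "{1..n}"] component_closed'[OF zi]
          by (simp add: Pi_iff del: Zp_simps)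
        also have "\<dots> = K.total (ev m x)" unfolding z(2) total_ev[OF z(1)] ..
        also have "\<dots> = \<zero>\<^bsub>K\<^esub>" using x by (simp add: Div0_eq del: Zp_simps)
        finally show "K.total (?s 0) = \<zero>\<^bsub>K\<^esub>" .
      qed
      then have "?s \<in> Idl\<^bsub>L\<^esub> (aug 0 ` {1..l})" unfolding genideal_aug using s by blast
      then have "?s \<odot>\<^bsub>DL\<^esub> bv 1 \<in> ideal_smult L (Idl\<^bsub>L\<^esub> (aug 0 ` {1..l})) DL"
        unfolding ideal_smult_def using bv_closed[OF one] by (intro subsetD[OF mod_span_superset]) blast
      then have "?s \<odot>\<^bsub>DL\<^esub> bv 1 \<in> T_part" unfolding T_part_eq ideal_smult_aug .
      then have "?s \<odot>\<^bsub>DL\<^esub> bv 1 \<in> M\<^sub>\<Lambda>"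
        unfolding M_Lambda_generators by (intro subsetD[OF mod_span_superset]) blast
      moreover have "(\<Oplus>\<^bsub>DL\<^esub>i\<in>{1..n}. z i \<odot>\<^bsub>DL\<^esub> (bv i \<ominus>\<^bsub>DL\<^esub> bv 1)) \<in> M\<^sub>\<Lambda>"
        by (intro submodule_finsum[OF module_DL M] funcsetI DL.submoduleE(4)[OF M] zi d)
      ultimately show ?thesis unfolding x_eq using DL.submoduleE(5)[OF M] by blast
    qed
  qed
qed

text \<open>If the image of \<open>x\<close> is principal, it is also the image of some y in
  \<open>Pr_Lambda\<close>, and x - y lies in the kernel of evaluation.\<close>

lemma relations_eq:
  "ideal_smult L (Idl\<^bsub>L\<^esub> ((\<lambda>i. omega p \<Gamma> m (Tvar p \<Gamma> \<gamma> i)) ` {1..l})) DL <+>\<^bsub>DL\<^esub> Pr_Lambda p \<Gamma> X \<alpha> n v =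
    {x \<in> carrier DL. ev m x \<in> Pr K (Y m)}"
proof -
  let ?P = "Pr_Lambda p \<Gamma> X \<alpha> n v"
  have im: "(\<lambda>i. omega p \<Gamma> m (Tvar p \<Gamma> \<gamma> i)) ` {1..l} = aug m ` {1..l}" by (rule image_cong[OF refl omega_eq])
  have Pc: "y \<in> carrier DL" if "y \<in> ?P" for y using DL.submoduleE(1)[OF Pr_Lambda_submodule] that by blast
  have lin_minus: "ev m (x \<ominus>\<^bsub>DL\<^esub> y) = \<zero>\<^bsub>FX m\<^esub>" if "x \<in> carrier DL" "y \<in> carrier DL" "ev m x = ev m y" for x y
    using linear_maps_minus[OF module_DL module_Div_layer ev_spec(1) that(1,2), of m] ev(1)[OF that(2), of m] that(3)
    by (simp only: a_minus_def N.M.r_neg) (simp add: FX_Div)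
  show ?thesis
    unfolding im ideal_smult_aug
  proof (intro equalityI subsetI)
    fix x assume "x \<in> {x \<in> carrier DL. ev m x = \<zero>\<^bsub>FX m\<^esub>} <+>\<^bsub>DL\<^esub> ?P"
    then obtain k y where k: "k \<in> carrier DL" "ev m k = \<zero>\<^bsub>FX m\<^esub>" and y: "y \<in> ?P" and x: "x = k \<oplus>\<^bsub>DL\<^esub> y"
      by (auto simp: set_add_def')
    have "ev m x = \<zero>\<^bsub>FX m\<^esub> \<oplus>\<^bsub>Div_layer m\<^esub> ev m y" unfolding x ev(2)[OF k(1) Pc[OF y]] k(2) ..
    also have "\<dots> = ev m y" using N.M.l_zero[OF ev(1)[OF Pc[OF y]], of m] by (simp add: FX_Div)
    finally have "ev m x \<in> ev m ` ?P" using y by simp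
    then show "x \<in> {x \<in> carrier DL. ev m x \<in> Pr K (Y m)}"
      unfolding ev_Pr_Lambda using k(1) Pc[OF y] by (simp add: x)
  next
    fix x assume x: "x \<in> {x \<in> carrier DL. ev m x \<in> Pr K (Y m)}"
    then have "ev m x \<in> ev m ` ?P" unfolding ev_Pr_Lambda by blast
    then obtain y where y: "y \<in> ?P" "ev m x = ev m y" by blast
    have xc: "x \<in> carrier DL" using x by blast
    have "x = (x \<ominus>\<^bsub>DL\<^esub> y) \<oplus>\<^bsub>DL\<^esub> y"
      using xc Pc[OF y(1)] by (simp add: a_minus_def DL.M.a_assoc DL.M.l_neg)
    moreover have "x \<ominus>\<^bsub>DL\<^esub> y \<in> {x \<in> carrier DL. ev m x = \<zero>\<^bsub>FX m\<^esub>}"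
      using lin_minus[OF xc Pc[OF y(1)] y(2)] DL.M.minus_closed[OF xc Pc[OF y(1)]] by blast
    ultimately show "x \<in> {x \<in> carrier DL. ev m x = \<zero>\<^bsub>FX m\<^esub>} <+>\<^bsub>DL\<^esub> ?P"
      using y(1) unfolding set_add_def' by blast
  qed
qed

text \<open>Numerator and denominator of the quotient of Div_Lambda are the preimages of Div^0(X_m)
  and Pr(X_m) under one surjective Lambda-linear map, so the general isomorphism for preimages
  applies.\<close>

theorem Jacobian_layer_iso:
  "\<exists>h. h \<in> module_iso L (Jac_layer p \<Gamma> X \<alpha> m) (M_Lambda_quotient p l \<Gamma> \<gamma> X \<alpha> n v m)"
proof -
  have "Jac_layer p \<Gamma> X \<alpha> m = quotient_module ((Div_layer m)\<lparr>carrier := Div0 K (Y m)\<rparr>) (Pr K (Y m))"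
    by (simp only: Jac_layer_def Let_def)
  moreover have "M_Lambda_quotient p l \<Gamma> \<gamma> X \<alpha> n v m =
      quotient_module (DL\<lparr>carrier := {x \<in> carrier DL. ev m x \<in> Div0 K (Y m)}\<rparr>) {x \<in> carrier DL. ev m x \<in> Pr K (Y m)}"
    unfolding M_Lambda_quotient_def Let_def relations_eq M_Lambda_eq[of m] ..
  ultimately show ?thesis
    using quotient_module_iso_vimage[OF module_DL module_Div_layer ev_spec(1) ev_surj Div0_submodule Pr_submodule Pr_subset_Div0]
    by (simp only:) blast
qed

end

theorem theorem3p1:
  fixes p l n :: nat
    and \<Gamma> :: "('g, 'm) monoid_scheme"
    and \<gamma> :: "nat \<Rightarrow> 'g"
    and X :: "('v, 'e) pre_digraph"
    and \<alpha> :: "'e \<Rightarrow> 'g"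
    and v :: "nat \<Rightarrow> 'v"
  assumes "prime p" and "l \<ge> 1"
    and "group \<Gamma>" and "\<Gamma> \<cong> product_group {1..l} (\<lambda>_. add_monoid (Zp p))"
    and "topological_generators p \<Gamma> l \<gamma>"
    and "fin_digraph X" and "connected X"
    and "bij_betw v {1..n} (verts X)"
    and "\<alpha> \<in> arcs X \<rightarrow> carrier \<Gamma>"
    and "\<And>k. connected (X_layer p \<Gamma> X \<alpha> k)"
  shows "\<forall>m. \<exists>h. h \<in> module_iso (Iwasawa p \<Gamma>)
           (Jac_layer p \<Gamma> X \<alpha> m) (M_Lambda_quotient p l \<Gamma> \<gamma> X \<alpha> n v m)"
proof -
  interpret K: cring "Zp p" by (rule cring_Zp) fact
  \<comment> \<open>Commutativity is transported to Gamma from the product of copies of Z_p along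
    the given isomorphism.\<close>
  have "comm_group \<Gamma>"
  proof -
    have "comm_group (product_group {1..l} (\<lambda>_. add_monoid (Zp p)))"
      using K.a_comm
      by (intro group.group_comm_groupI product_group K.a_group) (auto intro!: restrict_ext simp: PiE_iff)
    moreover have "product_group {1..l} (\<lambda>_. add_monoid (Zp p)) \<cong> \<Gamma>"
      by (rule group.iso_sym[OF assms(3,4)])
    ultimately show ?thesis
      using comm_group.iso_imp_comm_group group.is_monoid[OF assms(3)] by blast
  qed
  then interpret voltage_graph p \<Gamma> l \<gamma> X \<alpha> n v
    using assms
    by (intro voltage_graph.intro iwasawa_generators.intro iwasawa_algebra.intro iwasawa_algebra_axioms.intro
        iwasawa_generators_axioms.intro voltage_graph_axioms.intro)
  show ?thesis using Jacobian_layer_iso by blast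
qed

end
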